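(* Let $\zeta$ be a primitive aperiodic substitution on $\mathcal A=\{1,\ldots,m\}$ with substitution matrix $\mathsf S$. Suppose that the characteristic polynomial of $\mathsf S$ is irreducible and that the second eigenvalue $\theta_2$ of $\mathsf S$ satisfies $|\theta_2|>1$. Then there exists a constant $\gamma>0$, depending only on the substitution $\zeta$, such that for Lebesgue-almost every $\vec s\in\Delta^{m-1}$ there exists $r_0=r_0(\vec s)>0$ such that for every Lip-cylindrical function $f$ on $\mathfrak X_\zeta^{\vec s}$ with $\int f\,d\widetilde\mu=0$, $$\sigma_f([\omega-r,\omega+r])\le C r^{\gamma}\qquad\text{for all }\omega\in\mathbb R\text{ and }0<r\le r_0.$$ Here $\sigma_f$ is the spectral measure of $f$ corresponding to the suspension flow $(\mathfrak X_\zeta^{\vec s},h_t)$, and $C>0$ depends only on $\|f\|_L$.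
   Context: A substitution on the finite alphabet $\mathcal A=\{1,\ldots,m\}$ is a map $\zeta:\mathcal A\to\mathcal A^+$, where $\mathcal A^+$ is the set of finite non-empty words; it is extended to words by concatenation. Its substitution matrix $\mathsf S=\mathsf S_\zeta$ is the $m\times m$ matrix whose entry $\mathsf S_\zeta(i,j)$ is the number of symbols $i$ in the word $\zeta(j)$. $\zeta$ is primitive if some power of $\mathsf S_\zeta$ has only positive entries. The eigenvalues of $\mathsf S_\zeta$ are ordered by magnitude, $\theta_1>|\theta_2|\ge\cdots$. Irreducibility of the characteristic polynomial is over $\mathbb Q$. The substitution space $X_\zeta\subset\mathcal A^{\mathbb Z}$ is the set of two-sided sequences $x$ such that for every $n\in\mathbb N$ the word $x[-n,n]$ occurs as a subword of $\zeta^k(a)$ for some $k\in\mathbb N$, $a\in\mathcal A$; $T_\zeta$ is the left shift on $X_\zeta$. For primitive $\zeta$ the system $(X_\zeta,T_\zeta)$ is minimal and uniquely ergodic, with unique invariant Borel probability measure $\mu$. $\zeta$ is aperiodic if $(X_\zeta,T_\zeta)$ has no periodic points. $\Delta^{m-1}=\{\vec s=(s_1,\ldots,s_m)\in\mathbb R^m: s_j>0,\ \sum_{j=1}^m s_j=1\}$. For $\vec s\in\Delta^{m-1}$, $(\mathfrak X_\zeta^{\vec s},\widetilde\mu,h_t)$ is the suspension flow over $(X_\zeta,\mu,T_\zeta)$ with roof function equal to $s_j$ on the cylinder set $\{x: x_0=j\}$: the space is $\{(x,t): x\in X_\zeta,\ 0\le t\le s_{x_0}\}$ with $(x,s_{x_0})$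 identified with $(T_\zeta x,0)$, $h_t$ is the unit-speed vertical flow, and $\widetilde\mu$ is its unique invariant probability measure (the normalized restriction of $\mu\times$Lebesgue). A Lip-cylindrical function on $\mathfrak X_\zeta^{\vec s}$ is a function of the form $f(x,t)=\psi_{x_0}(t)$, $0\le t\le s_{x_0}$, with $\psi_j\in\mathrm{Lip}[0,s_j]$ (Lipschitz functions) for $j\le m$; $\|f\|_L:=\max_{a\in\mathcal A}\|\psi_a\|_L$, where $\|\psi\|_L$ is the Lipschitz norm (supremum norm plus best Lipschitz constant). For $f\in L^2(\mathfrak X_\zeta^{\vec s},\widetilde\mu)$ the spectral measure $\sigma_f$ is the finite positive Borel measure on $\mathbb R$ with $\int_{-\infty}^{\infty}e^{2\pi i\omega t}\,d\sigma_f(\omega)=\langle f\circ h_t,f\rangle$ for all $t\in\mathbb R$, the inner product being that of $L^2$. *)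

theory Defs
  imports
    "HOL-Analysis.Analysis"
    "HOL-Library.Sublist"
    "Jordan_Normal_Form.Char_Poly"
begin

section \<open>Substitutions\<close>

text \<open>The alphabet of size \<open>m\<close> is \<open>{..<m}\<close>, i.e. the letters are numbered from \<open>0\<close>.\<close>

definition substitution :: "nat \<Rightarrow> (nat \<Rightarrow> nat list) \<Rightarrow> bool" where
  "substitution m \<zeta> \<longleftrightarrow> (\<forall>a<m. \<zeta> a \<noteq> [] \<and> set (\<zeta> a) \<subseteq> {..<m})"

definition subst_word :: "(nat \<Rightarrow> nat list) \<Rightarrow> nat list \<Rightarrow> nat list" where
  "subst_word \<zeta> w = concat (map \<zeta> w)"

definition subst_mat :: "nat \<Rightarrow> (nat \<Rightarrow> nat list) \<Rightarrow> int mat" where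
  "subst_mat m \<zeta> = mat m m (\<lambda>(i, j). int (count_list (\<zeta> j) i))"

definition primitive_subst :: "nat \<Rightarrow> (nat \<Rightarrow> nat list) \<Rightarrow> bool" where
  "primitive_subst m \<zeta> \<longleftrightarrow>
     (\<exists>k>0. \<forall>i<m. \<forall>j<m. 0 < (subst_mat m \<zeta> ^\<^sub>m k) $$ (i, j))"

text \<open>\<open>\<theta>\<close> lists the eigenvalues of \<open>A\<close> with algebraic multiplicity by decreasing modulus. Lists are
  indexed from \<open>0\<close>, so the second eigenvalue is \<open>\<theta> ! 1\<close>; its modulus does not depend on how ties
  in the ordering are broken.\<close>

definition eigenvalues_by_modulus :: "complex mat \<Rightarrow> complex list \<Rightarrow> bool" where
  "eigenvalues_by_modulus A \<theta> \<longleftrightarrow>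
     char_poly A = (\<Prod>z\<leftarrow>\<theta>. [:- z, 1:]) \<and> sorted_wrt (\<lambda>z w. cmod w \<le> cmod z) \<theta>"


section \<open>The substitution space\<close>

definition subst_space :: "nat \<Rightarrow> (nat \<Rightarrow> nat list) \<Rightarrow> (int \<Rightarrow> nat) set" where
  "subst_space m \<zeta> =
     {x. \<forall>n::nat. \<exists>k. \<exists>a<m. sublist (map x [- int n..int n]) ((subst_word \<zeta> ^^ k) [a])}"

definition shift :: "int \<Rightarrow> (int \<Rightarrow> nat) \<Rightarrow> int \<Rightarrow> nat" where
  "shift n x = (\<lambda>i. x (i + n))"

definition aperiodic_subst :: "nat \<Rightarrow> (nat \<Rightarrow> nat list) \<Rightarrow> bool" where
  "aperiodic_subst m \<zeta> \<longleftrightarrow> \<not> (\<exists>x \<in> subst_space m \<zeta>. \<exists>p>0. (shift 1 ^^ p) x = x)"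

text \<open>Here \<open>borel\<close> is the Borel sigma-algebra of the product topology on \<open>int \<Rightarrow> nat\<close>, with \<open>nat\<close>
  discrete. For primitive \<open>\<zeta>\<close> exactly one measure has this property.\<close>

definition subst_measure :: "nat \<Rightarrow> (nat \<Rightarrow> nat list) \<Rightarrow> (int \<Rightarrow> nat) measure \<Rightarrow> bool" where
  "subst_measure m \<zeta> \<mu> \<longleftrightarrow>
     space \<mu> = subst_space m \<zeta> \<and>
     sets \<mu> = sets (restrict_space borel (subst_space m \<zeta>)) \<and>
     emeasure \<mu> (space \<mu>) = 1 \<and>
     shift 1 \<in> measurable \<mu> \<mu> \<and> distr \<mu> \<mu> (shift 1) = \<mu>"


section \<open>The simplex\<close>

definition open_simplex :: "nat \<Rightarrow> (nat \<Rightarrow> real) set" where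
  "open_simplex m = {s \<in> {..<m} \<rightarrow>\<^sub>E UNIV. (\<forall>j<m. 0 < s j) \<and> (\<Sum>j<m. s j) = 1}"

definition simplex_point :: "nat \<Rightarrow> (nat \<Rightarrow> real) \<Rightarrow> nat \<Rightarrow> real" where
  "simplex_point m u = u(m - 1 := 1 - (\<Sum>j<m - 1. u j))"

text \<open>Lebesgue measure on the simplex, in the chart given by the first \<open>m - 1\<close> coordinates. The
  \<open>(m - 1)\<close>-dimensional surface measure is a constant multiple of it, so the null sets are the same.\<close>

definition simplex_lebesgue :: "nat \<Rightarrow> (nat \<Rightarrow> real) measure" where
  "simplex_lebesgue m =
     distr (restrict_space (\<Pi>\<^sub>M j\<in>{..<m - 1}. lborel)
              {u \<in> {..<m - 1} \<rightarrow>\<^sub>E UNIV. simplex_point m u \<in> open_simplex m})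
           (restrict_space (\<Pi>\<^sub>M j\<in>{..<m}. borel) (open_simplex m))
           (simplex_point m)"


section \<open>The suspension flow\<close>

text \<open>Because \<open>(x, s\<^bsub>x 0\<^esub>)\<close> is identified with \<open>(shift 1 x, 0)\<close>, each point of the suspension has
  exactly one representative with \<open>0 \<le> t < s\<^bsub>x 0\<^esub>\<close>; the suspension is modelled by these.\<close>

definition susp_space ::
  "nat \<Rightarrow> (nat \<Rightarrow> nat list) \<Rightarrow> (nat \<Rightarrow> real) \<Rightarrow> ((int \<Rightarrow> nat) \<times> real) set" where
  "susp_space m \<zeta> s = {(x, t). x \<in> subst_space m \<zeta> \<and> 0 \<le> t \<and> t < s (x 0)}"

definition roof_sum :: "(nat \<Rightarrow> real) \<Rightarrow> (int \<Rightarrow> nat) \<Rightarrow> int \<Rightarrow> real" where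
  "roof_sum s x n =
     (if 0 \<le> n then (\<Sum>i\<in>{0..<n}. s (x i)) else - (\<Sum>i\<in>{n..<0}. s (x i)))"

text \<open>Moving up by \<open>t\<close> from \<open>(x, u)\<close> leads to \<open>(x, u + t)\<close>, which is identified with
  \<open>(shift n x, u + t - roof_sum s x n)\<close> for every integer \<open>n\<close>; one \<open>n\<close> gives the representative.\<close>

definition susp_flow ::
  "(nat \<Rightarrow> real) \<Rightarrow> real \<Rightarrow> (int \<Rightarrow> nat) \<times> real \<Rightarrow> (int \<Rightarrow> nat) \<times> real" where
  "susp_flow s t = (\<lambda>(x, u).
     let n = (THE n. roof_sum s x n \<le> u + t \<and> u + t < roof_sum s x (n + 1))
     in (shift n x, u + t - roof_sum s x n))"

definition susp_measure ::
  "nat \<Rightarrow> (nat \<Rightarrow> nat list) \<Rightarrow> (int \<Rightarrow> nat) measure \<Rightarrow> (nat \<Rightarrow> real) \<Rightarrow>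
     ((int \<Rightarrow> nat) \<times> real) measure" where
  "susp_measure m \<zeta> \<mu> s =
     uniform_measure (restrict_space (\<mu> \<Otimes>\<^sub>M lborel) (susp_space m \<zeta> s)) (susp_space m \<zeta> s)"


section \<open>Lip-cylindrical functions\<close>

definition lip_family :: "nat \<Rightarrow> (nat \<Rightarrow> real) \<Rightarrow> (nat \<Rightarrow> real \<Rightarrow> complex) \<Rightarrow> bool" where
  "lip_family m s \<psi> \<longleftrightarrow> (\<forall>j<m. \<exists>L. L-lipschitz_on {0..s j} (\<psi> j))"

definition lip_cyl :: "(nat \<Rightarrow> real \<Rightarrow> complex) \<Rightarrow> (int \<Rightarrow> nat) \<times> real \<Rightarrow> complex" where
  "lip_cyl \<psi> = (\<lambda>(x, t). \<psi> (x 0) t)"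

definition lip_norm :: "real \<Rightarrow> (real \<Rightarrow> complex) \<Rightarrow> real" where
  "lip_norm b g = (SUP t\<in>{0..b}. cmod (g t)) + Inf {L. L-lipschitz_on {0..b} g}"

definition lip_cyl_norm :: "nat \<Rightarrow> (nat \<Rightarrow> real) \<Rightarrow> (nat \<Rightarrow> real \<Rightarrow> complex) \<Rightarrow> real" where
  "lip_cyl_norm m s \<psi> = (MAX j\<in>{..<m}. lip_norm (s j) (\<psi> j))"


section \<open>Spectral measures\<close>

text \<open>For a measure-preserving flow \<open>h\<close> on \<open>M\<close> and \<open>f\<close> in \<open>L\<^sup>2\<close>, there is exactly one such \<open>\<sigma>\<close>
  (Bochner's theorem and uniqueness of the Fourier transform).\<close>

definition spectral_measure ::
  "'a measure \<Rightarrow> (real \<Rightarrow> 'a \<Rightarrow> 'a) \<Rightarrow> ('a \<Rightarrow> complex) \<Rightarrow> real measure \<Rightarrow> bool" where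
  "spectral_measure M h f \<sigma> \<longleftrightarrow>
     sets \<sigma> = sets borel \<and> finite_measure \<sigma> \<and>
     (\<forall>t. (\<integral>\<omega>. exp (2 * complex_of_real pi * \<i> * complex_of_real (\<omega> * t)) \<partial>\<sigma>) =
          (\<integral>p. f (h t p) * cnj (f p) \<partial>M))"

end

theory Submission
  imports Defs "HOL-Computational_Algebra.Field_as_Ring" "HOL-Probability.Probability_Measure"
begin

text \<open>The mass \<open>\<sigma>\<^sub>f[\<omega> - r, \<omega> + r]\<close> is controlled by the twisted ergodic integrals
  \<open>\<integral>\<^sub>0\<^bsup>R\<^esup> e\<^bsup>- 2 \<pi> \<i> \<omega> t\<^esup> f(h\<^sub>t p) dt\<close> with \<open>R \<approx> 1/r\<close>, which are exponential sums over words of length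
  \<open>\<approx> R\<close>, cut into blocks \<open>\<zeta>\<^sup>n(a)\<close> with \<open>n \<approx> log R\<close>. There are three ranges of \<open>\<omega>\<close>. If \<open>\<bar>\<omega>\<bar>\<close> exceeds a small
  power of \<open>R\<close>, the Fourier coefficients of the Lipschitz functions \<open>\<psi>\<^sub>j\<close> are small. If it is below a small
  negative power of \<open>R\<close>, the twist is negligible on shorter blocks, over which the sums of the mean-zero
  function \<open>f\<close> save a power. In between, each level \<open>k\<close> at which the phase
  \<open>\<omega> \<bar>\<zeta>\<^sup>k(v)\<bar>\<^sub>s\<close> of a return word \<open>v\<close> is far from the integers gains a constant factor.

  That this happens at a positive proportion of levels, for almost every \<open>s\<close> and all such \<open>\<omega>\<close>, is an
  Erdos--Kahane argument. By Cayley--Hamilton the phases satisfy the linear recurrence of the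
  characteristic polynomial, so their nearest integers satisfy it with a bounded error that vanishes
  wherever consecutive phases are close to integers. Hence few integer sequences occur, and each one determines
  the projections of \<open>\<omega> s\<close> along \<open>\<theta>\<^sub>1\<close> and \<open>\<theta>\<^sub>2\<close> up to an exponentially small error; eliminating \<open>\<omega>\<close>
  confines \<open>s\<close> to a thin strip. Irreducibility enters by making the projections linearly independent.\<close>

section \<open>Integer sequences and the shift\<close>

text \<open>Two balances shape the argument. In the exceptional sets the number of integer sequences
  competes with the width of the strips: \<open>\<delta>\<close> and \<open>\<eta>\<close> are small
  multiples of \<open>b\<close>, the logarithm of the smaller of the two moduli, so that the count
  grows more slowly than the strips shrink. Both moduli must exceed \<open>1\<close>, because
  rounding errors stay bounded while each projection is magnified by the powers of its eigenvalue;
  one projection alone would leave the free factor \<open>\<omega>\<close> undetermined. In the word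
  sums the incomplete blocks at the two ends cost \<open>B ^ n\<close>, which is why
  \<open>R\<close> is compared with \<open>B ^ (2 * n)\<close>: they then cost at most the square
  root of \<open>R\<close>. The projections are obtained without eigenvectors. Applying the
  characteristic polynomial with one factor \<open>X - z\<close> removed to the shift leaves a
  multiple of \<open>z ^ k\<close>, which is why polynomials act on sequences here. A return word
  supplies the phases because cancellation needs two copies of the same block inside the image of
  every letter.\<close>

definition shift_poly :: "'a::comm_ring_1 poly \<Rightarrow> (nat \<Rightarrow> 'a) \<Rightarrow> nat \<Rightarrow> 'a" where
  "shift_poly b t k = (\<Sum>i\<le>degree b. coeff b i * t (k + i))"

lemma shift_poly_le:
  assumes "degree b \<le> n"
  shows "shift_poly b t k = (\<Sum>i\<le>n. coeff b i * t (k + i))"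
  unfolding shift_poly_def
  by (rule sum.mono_neutral_left) (use assms in \<open>auto simp: coeff_eq_0\<close>)

lemma shift_poly_0 [simp]: "shift_poly 0 t k = 0"
  and shift_poly_1 [simp]: "shift_poly 1 t k = t k"
  by (simp_all add: shift_poly_def)

lemma shift_poly_add: "shift_poly (b + c) t k = shift_poly b t k + shift_poly c t k"
  using shift_poly_le[of b "max (degree b) (degree c)"] shift_poly_le[of c "max (degree b) (degree c)"]
    shift_poly_le[OF degree_add_le_max, of b c]
  by (simp add: sum.distrib distrib_right)

lemma shift_poly_smult: "shift_poly (Polynomial.smult x b) t k = x * shift_poly b t k"
  using shift_poly_le[OF degree_smult_le, of x b]
  by (simp add: shift_poly_def sum_distrib_left mult.assoc)

lemma shift_poly_diff: "shift_poly (b - c) t k = shift_poly b t k - shift_poly c t k"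
  using shift_poly_add[of "b - c" c t k] by simp

lemma shift_poly_sum: "shift_poly (\<Sum>i\<in>I. b i) t k = (\<Sum>i\<in>I. shift_poly (b i) t k)"
  by (induction I rule: infinite_finite_induct) (auto simp: shift_poly_add)

lemma shift_poly_pCons: "shift_poly (pCons c b) t k = c * t k + shift_poly b t (Suc k)"
proof -
  have "shift_poly (pCons c b) t k = (\<Sum>i\<le>Suc (degree b). coeff (pCons c b) i * t (k + i))"
    by (rule shift_poly_le) (rule degree_pCons_le)
  also have "\<dots> = c * t k + (\<Sum>i\<le>degree b. coeff b i * t (Suc k + i))"
    by (subst sum.atMost_Suc_shift) simp
  finally show ?thesis by (simp add: shift_poly_def)
qed

lemma shift_poly_seq_sum:
  "shift_poly b (\<lambda>k. \<Sum>i\<in>I. x i * t i k) k = (\<Sum>i\<in>I. x i * shift_poly b (t i) k)"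
proof -
  have "shift_poly b (\<lambda>k. \<Sum>i\<in>I. x i * t i k) k
      = (\<Sum>l\<le>degree b. \<Sum>i\<in>I. x i * (coeff b l * t i (k + l)))"
    unfolding shift_poly_def by (simp add: sum_distrib_left mult_ac)
  also have "\<dots> = (\<Sum>i\<in>I. x i * shift_poly b (t i) k)"
    unfolding shift_poly_def by (subst sum.swap) (simp add: sum_distrib_left)
  finally show ?thesis .
qed

lemma shift_poly_seq_0 [simp]: "shift_poly b (\<lambda>_. 0) k = 0"
  by (simp add: shift_poly_def)

lemma shift_poly_Suc: "shift_poly b t (Suc k) = shift_poly b (\<lambda>k. t (Suc k)) k"
  by (simp add: shift_poly_def)

text \<open>Together with linearity this makes sequences a module over the polynomial ring, with the
  variable acting as the shift. Factorizations and Bezout identities can then be applied to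
  sequences.\<close>

lemma shift_poly_mult: "shift_poly (b * c) t k = shift_poly b (shift_poly c t) k"
proof (induction b arbitrary: k)
  case (pCons x b)
  then show ?case
    by (simp add: shift_poly_pCons shift_poly_add shift_poly_smult)
qed simp

lemma (in comm_ring_hom) shift_poly_hom:
  "shift_poly (map_poly hom b) (\<lambda>k. hom (t k)) k = hom (shift_poly b t k)"
  using shift_poly_le[OF degree_map_poly_le, of hom b]
  by (simp add: shift_poly_def coeff_map_poly hom_sum hom_mult)

text \<open>Cayley-Hamilton through the adjugate. The matrix \<open>X\<close>, the indeterminate
  times the identity minus \<open>S\<close>, acts on vectors of sequences and kills
  \<open>a\<close>, which is the recurrence; multiplying by its adjugate leaves the determinant,
  that is \<open>char_poly S\<close>, on the diagonal.\<close>

lemma shift_poly_char_poly: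
  fixes S :: "'a::comm_ring_1 mat"
  assumes S: "S \<in> carrier_mat n n"
    and rec: "\<And>i k. i < n \<Longrightarrow> a i (Suc k) = (\<Sum>j<n. S $$ (i, j) * a j k)"
    and "l < n"
  shows "shift_poly (char_poly S) (a l) k = 0"
proof -
  define X where "X = char_poly_matrix S"
  have X: "X \<in> carrier_mat n n"
    using S by (simp add: X_def)
  note adj = adj_mat(1,3)[OF X]
  have Xij: "X $$ (i, j) = (if i = j then [:0, 1:] else 0) + [:- S $$ (i, j):]" if "i < n" "j < n" for i j
    using that S by (simp add: X_def char_poly_matrix_def)
  have X0: "(\<Sum>j<n. shift_poly (X $$ (i, j)) (a j) k) = 0" if "i < n" for i k
  proof -
    have "(\<Sum>j<n. shift_poly (X $$ (i, j)) (a j) k)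
        = (\<Sum>j<n. (if i = j then a j (Suc k) else 0) - S $$ (i, j) * a j k)"
      by (rule sum.cong) (auto simp: Xij that shift_poly_add shift_poly_pCons)
    also have "\<dots> = 0"
      using that by (simp add: sum_subtractf rec)
    finally show ?thesis .
  qed
  have adjX: "(\<Sum>i<n. adj_mat X $$ (l, i) * X $$ (i, j)) = (if l = j then char_poly S else 0)" if "j < n" for j
  proof -
    have "(adj_mat X * X) $$ (l, j) = (\<Sum>i<n. adj_mat X $$ (l, i) * X $$ (i, j))"
      using adj(1) X that \<open>l < n\<close> by (auto simp: scalar_prod_def atLeast0LessThan)
    then show ?thesis
      using adj(2) that \<open>l < n\<close> by (auto simp: X_def[symmetric] char_poly_def)
  qed
  have "shift_poly (char_poly S) (a l) k = (\<Sum>j<n. shift_poly (if l = j then char_poly S else 0) (a j) k)"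
    using \<open>l < n\<close> by (subst sum.remove[of _ l]) auto
  also have "\<dots> = (\<Sum>j<n. \<Sum>i<n. shift_poly (adj_mat X $$ (l, i)) (shift_poly (X $$ (i, j)) (a j)) k)"
    by (rule sum.cong) (auto simp flip: adjX simp: shift_poly_sum shift_poly_mult)
  also have "\<dots> = (\<Sum>i<n. shift_poly (adj_mat X $$ (l, i)) (\<lambda>k. \<Sum>j<n. shift_poly (X $$ (i, j)) (a j) k) k)"
    by (subst sum.swap) (simp add: shift_poly_seq_sum[where x = "\<lambda>_. 1", simplified])
  also have "\<dots> = 0"
    by (rule sum.neutral) (simp add: X0)
  finally show ?thesis .
qed

text \<open>Read a kernel vector as the coefficients of a polynomial \<open>q\<close>: the rows then
  say that \<open>q\<close> applied to the shift kills every \<open>a j\<close> at index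
  \<open>0\<close>. When \<open>a\<close> is the orbit of a vector under a matrix, the columns are
  its iterates, so this is a Krylov matrix.\<close>

lemma det_krylov_eq_0_iff:
  fixes a :: "nat \<Rightarrow> nat \<Rightarrow> 'a::field"
  shows "det (mat n n (\<lambda>(j, i). a j i)) = 0 \<longleftrightarrow>
    (\<exists>q. q \<noteq> 0 \<and> degree q < n \<and> (\<forall>j<n. shift_poly q (a j) 0 = 0))"
proof -
  let ?M = "mat n n (\<lambda>(j, i). a j i)"
  have M: "?M \<in> carrier_mat n n" by simp
  have row: "(?M *\<^sub>v v) $ j = (\<Sum>i<n. a j i * v $ i)" if "j < n" "v \<in> carrier_vec n" for j v
    using that by (simp add: scalar_prod_def atLeast0LessThan)
  show ?thesis
    unfolding det_0_iff_vec_prod_zero_field[OF M]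
  proof
    assume "\<exists>v. v \<in> carrier_vec n \<and> v \<noteq> 0\<^sub>v n \<and> ?M *\<^sub>v v = 0\<^sub>v n"
    then obtain v where v: "v \<in> carrier_vec n" "v \<noteq> 0\<^sub>v n" "?M *\<^sub>v v = 0\<^sub>v n" by blast
    define q where "q = (\<Sum>i<n. monom (v $ i) i)"
    have cq: "coeff q i = (if i < n then v $ i else 0)" for i
      by (auto simp: q_def coeff_sum)
    from v(1,2) obtain i where i: "i < n" "v $ i \<noteq> 0"
      by (metis carrier_vecD eq_vecI index_zero_vec(1) index_zero_vec(2))
    have "q \<noteq> 0"
      using cq[of i] i by auto
    moreover have dq: "degree q \<le> n - 1"
      by (rule degree_le) (auto simp: cq)
    moreover have "shift_poly q (a j) 0 = 0" if "j < n" for j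
    proof -
      have "{..n - 1} = {..<n}" using i by auto
      then have "shift_poly q (a j) 0 = (\<Sum>i<n. a j i * v $ i)"
        by (simp add: shift_poly_le[OF dq] cq mult.commute)
      also have "\<dots> = 0"
        using row[OF that v(1)] v(3) that by simp
      finally show ?thesis .
    qed
    ultimately show "\<exists>q. q \<noteq> 0 \<and> degree q < n \<and> (\<forall>j<n. shift_poly q (a j) 0 = 0)"
      using i by (intro exI[of _ q]) auto
  next
    assume "\<exists>q. q \<noteq> 0 \<and> degree q < n \<and> (\<forall>j<n. shift_poly q (a j) 0 = 0)"
    then obtain q where q: "q \<noteq> 0" "degree q < n" and q0: "\<And>j. j < n \<Longrightarrow> shift_poly q (a j) 0 = 0" by blast
    define v where "v = vec n (coeff q)"
    have v: "v \<in> carrier_vec n" by (simp add: v_def)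
    have "v $ degree q \<noteq> 0"
      using q by (simp add: v_def)
    then have "v \<noteq> 0\<^sub>v n"
      using q(2) by auto
    moreover have "?M *\<^sub>v v = 0\<^sub>v n"
    proof (rule eq_vecI)
      fix j assume "j < dim_vec (0\<^sub>v n :: 'a vec)"
      then have j: "j < n" by simp
      have "{..n - 1} = {..<n}" using j by auto
      then show "(?M *\<^sub>v v) $ j = 0\<^sub>v n $ j"
        using q0[OF j] q(2) row[OF j v] shift_poly_le[of q "n - 1" "a j" 0] j
        by (simp add: v_def mult.commute)
    qed simp
    ultimately show "\<exists>v. v \<in> carrier_vec n \<and> v \<noteq> 0\<^sub>v n \<and> ?M *\<^sub>v v = 0\<^sub>v n"
      using v by blast
  qed
qed

text \<open>A polynomial \<open>q\<close> of degree below \<open>n\<close> that kills all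
  \<open>a j\<close> at index \<open>0\<close> kills them at every index, since the recurrence
  commutes with the shift. It is coprime to the irreducible characteristic polynomial, which kills
  them too, so by Bezout \<open>1\<close> kills them, against
  \<open>a l 0 \<noteq> 0\<close>.\<close>

lemma irreducible_char_poly_krylov:
  fixes S :: "'a::{field_gcd} mat"
  assumes S: "S \<in> carrier_mat n n"
    and irr: "irreducible (char_poly S)"
    and rec: "\<And>i k. i < n \<Longrightarrow> a i (Suc k) = (\<Sum>j<n. S $$ (i, j) * a j k)"
    and nz: "l < n" "a l 0 \<noteq> 0"
  shows "det (mat n n (\<lambda>(j, i). a j i)) \<noteq> 0"
proof
  assume "det (mat n n (\<lambda>(j, i). a j i)) = 0"
  then obtain q where q: "q \<noteq> 0" "degree q < n" and q0: "\<And>j. j < n \<Longrightarrow> shift_poly q (a j) 0 = 0"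
    unfolding det_krylov_eq_0_iff by blast
  have qk: "\<forall>j<n. shift_poly q (a j) k = 0" for k
  proof (induction k)
    case (Suc k)
    have "shift_poly q (a j) (Suc k) = shift_poly q (\<lambda>k. \<Sum>i<n. S $$ (j, i) * a i k) k" if "j < n" for j
      using that by (simp add: shift_poly_Suc rec)
    then show ?case
      using Suc by (simp only: shift_poly_seq_sum) simp
  qed (use q0 in simp)
  let ?p = "char_poly S"
  have "degree ?p = n"
    using degree_monic_char_poly[OF S] by simp
  then have "\<not> ?p dvd q"
    using q dvd_imp_degree_le[of ?p q] by linarith
  then have "coprime ?p q"
    by (intro prime_elem_imp_coprime irreducible_imp_prime_elem irr)
  then have "fst (bezout_coefficients ?p q) * ?p + snd (bezout_coefficients ?p q) * q = 1"
    by (simp only: bezout_coefficients_fst_snd coprime_imp_gcd_eq_1)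
  then have "a l 0 = shift_poly (fst (bezout_coefficients ?p q) * ?p + snd (bezout_coefficients ?p q) * q) (a l) 0"
    by (simp only: shift_poly_1)
  also have "\<dots> = 0"
  proof -
    have "shift_poly ?p (a l) = (\<lambda>_. 0)" "shift_poly q (a l) = (\<lambda>_. 0)"
      by (rule ext, rule shift_poly_char_poly[of S n a, OF S _ nz(1)], rule rec, assumption) (use qk nz(1) in blast)
    then show ?thesis by (simp only: shift_poly_add shift_poly_mult shift_poly_seq_0 add_0)
  qed
  finally show False using nz(2) by simp
qed

text \<open>Separability over the rationals: \<open>p\<close> is coprime to its derivative, and the
  Bezout identity, carried over to the complex numbers, excludes a common root of \<open>p\<close>
  and \<open>pderiv p\<close>, which a double root would be.\<close>

lemma irreducible_imp_distinct_roots: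
  fixes p :: "rat poly" and z w :: complex
  assumes "irreducible p" and "map_poly of_rat p = [:- z, 1:] * ([:- w, 1:] * r)"
  shows "z \<noteq> w"
proof
  assume "z = w"
  let ?h = "map_poly (of_rat :: rat \<Rightarrow> complex)"
  interpret h: map_poly_comm_ring_hom "of_rat :: rat \<Rightarrow> complex" ..
  have "degree p \<noteq> 0"
    using assms(1) by (metis Factorial_Ring.irreducible_def is_unit_iff_degree)
  then have "degree (pderiv p) < degree p" "pderiv p \<noteq> 0"
    by (simp_all only: degree_pderiv pderiv_eq_0_iff) simp
  then have "\<not> p dvd pderiv p"
    using dvd_imp_degree_le[of p "pderiv p"] by linarith
  then have "coprime p (pderiv p)"
    by (intro prime_elem_imp_coprime irreducible_imp_prime_elem assms(1))
  then obtain u v where uv: "u * p + v * pderiv p = 1"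
    using bezout_coefficients_fst_snd[of p "pderiv p"] by (simp only: coprime_imp_gcd_eq_1)
  have "poly (?h p) z = 0"
    by (simp add: assms(2))
  moreover have "poly (pderiv (?h p)) z = 0"
    by (simp only: assms(2) \<open>z = w\<close> pderiv_mult poly_add poly_mult) (simp add: pderiv_pCons)
  then have "poly (?h (pderiv p)) z = 0"
    by (simp add: of_rat_hom.map_poly_pderiv)
  moreover have "poly (?h (u * p + v * pderiv p)) z = 1"
    by (simp only: uv h.hom_one poly_1)
  ultimately show False
    by (simp only: h.hom_add h.hom_mult poly_add poly_mult) simp
qed

text \<open>Each of \<open>q1\<close> and \<open>q2\<close> lacks one linear factor of the
  characteristic polynomial and thereby selects the component of \<open>z1\<close> or
  \<open>z2\<close>. The nonvanishing minor says that the two vectors of projections are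
  independent: otherwise a combination \<open>q2 - u q1\<close>, of degree below \<open>n\<close>,
  would kill all sequences at index \<open>0\<close>, hence be zero, and the two roots would
  agree.\<close>

lemma irreducible_char_poly_spectral_data:
  fixes S :: "int mat" and a :: "nat \<Rightarrow> nat \<Rightarrow> int"
  assumes S: "S \<in> carrier_mat n n"
    and irr: "irreducible (char_poly (map_mat rat_of_int S))"
    and ev: "eigenvalues_by_modulus (map_mat complex_of_int S) \<theta>"
    and len: "2 \<le> length \<theta>" and big: "cmod (\<theta> ! 1) > 1"
    and rec: "\<And>i k. i < n \<Longrightarrow> a i (Suc k) = (\<Sum>j<n. S $$ (i, j) * a j k)"
    and nz: "l < n" "a l 0 \<noteq> 0"
  obtains z1 z2 :: complex and q1 q2 :: "complex poly"
  where "cmod z1 > 1" "cmod z2 > 1"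
    "[:- z1, 1:] * q1 = map_poly of_int (char_poly S)" "[:- z2, 1:] * q2 = map_poly of_int (char_poly S)"
    "\<exists>i<n. \<exists>j<n. shift_poly q1 (\<lambda>k. of_int (a i k)) 0 * shift_poly q2 (\<lambda>k. of_int (a j k)) 0
               \<noteq> shift_poly q1 (\<lambda>k. of_int (a j k)) 0 * shift_poly q2 (\<lambda>k. of_int (a i k)) 0"
proof -
  let ?pC = "map_poly of_int (char_poly S) :: complex poly"
  obtain z1 z2 zs where \<theta>: "\<theta> = z1 # z2 # zs"
    using len by (cases \<theta> rule: remdups_adj.cases) auto
  define R where "R = (\<Prod>z\<leftarrow>zs. [:- z, 1:])"
  have pC: "?pC = [:- z1, 1:] * ([:- z2, 1:] * R)"
    using ev unfolding eigenvalues_by_modulus_def of_int_hom.char_poly_hom[OF S] \<theta> R_def list.map prod_list.Cons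
    by blast
  have pR: "char_poly (map_mat rat_of_int S) = map_poly rat_of_int (char_poly S)"
    by (rule of_int_hom.char_poly_hom[OF S])
  have "map_poly of_rat (char_poly (map_mat rat_of_int S)) = ?pC"
    unfolding pR by (subst map_poly_map_poly) (auto simp: o_def)
  then have "z1 \<noteq> z2"
    using irreducible_imp_distinct_roots[OF irr] pC by metis
  have degp: "degree ?pC = n" "?pC \<noteq> 0"
    using degree_monic_char_poly[OF S] by (auto simp: degree_map_poly leading_coeff_0_iff)
  have R0: "R \<noteq> 0"
    using pC degp(2) by auto
  define q1 where "q1 = [:- z2, 1:] * R"
  define q2 where "q2 = [:- z1, 1:] * R"
  have q1: "[:- z1, 1:] * q1 = ?pC" and q2: "[:- z2, 1:] * q2 = ?pC"
    unfolding q1_def q2_def pC by (simp_all only: mult_ac)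
  have q0: "q1 \<noteq> 0" "q2 \<noteq> 0"
    using q1 q2 degp(2) by auto
  have "degree ([:- z1, 1:] * q1) = 1 + degree q1" "degree ([:- z2, 1:] * q2) = 1 + degree q2"
    using q0 by (subst degree_mult_eq; simp)+
  then have dq: "degree q1 < n" "degree q2 < n"
    using q1 q2 degp(1) by auto
  define w1 where "w1 j = shift_poly q1 (\<lambda>k. of_int (a j k)) 0" for j
  define w2 where "w2 j = shift_poly q2 (\<lambda>k. of_int (a j k)) 0" for j
  \<comment> \<open>Irreducibility lives over the rationals, the eigenvalues over the complex
    numbers; the determinant is an integer, so its nonvanishing passes from one field to the
    other.\<close>
  have "det (mat n n (\<lambda>(j, i). rat_of_int (a j i))) \<noteq> 0"
    using irreducible_char_poly_krylov[of "map_mat rat_of_int S" n "\<lambda>j i. rat_of_int (a j i)" l]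
      S irr rec nz by simp
  moreover have "mat n n (\<lambda>(j, i). rat_of_int (a j i)) = map_mat rat_of_int (mat n n (\<lambda>(j, i). a j i))"
    by (rule eq_matI) auto
  ultimately have "det (mat n n (\<lambda>(j, i). a j i)) \<noteq> 0"
    by (simp add: of_int_hom.hom_det)
  moreover have "mat n n (\<lambda>(j, i). complex_of_int (a j i)) = map_mat complex_of_int (mat n n (\<lambda>(j, i). a j i))"
    by (rule eq_matI) auto
  ultimately have detC: "det (mat n n (\<lambda>(j, i). complex_of_int (a j i))) \<noteq> 0"
    by (simp add: of_int_hom.hom_det)
  have inj: "q = 0" if "degree q < n" "\<And>j. j < n \<Longrightarrow> shift_poly q (\<lambda>k. complex_of_int (a j k)) 0 = 0" for q
    using detC that unfolding det_krylov_eq_0_iff by blast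
  have "\<exists>i<n. \<exists>j<n. w1 i * w2 j \<noteq> w1 j * w2 i"
  proof (rule ccontr)
    assume "\<not> ?thesis"
    then have eq: "w1 i * w2 j = w1 j * w2 i" if "i < n" "j < n" for i j
      using that by blast
    obtain b where b: "b < n" "w1 b \<noteq> 0"
      using inj[of q1] dq q0 unfolding w1_def by blast
    define u where "u = w2 b / w1 b"
    have "q2 - Polynomial.smult u q1 = 0"
    proof (rule inj)
      show "degree (q2 - Polynomial.smult u q1) < n"
        by (rule degree_diff_less) (use dq degree_smult_le[of u q1] in auto)
      fix j assume "j < n"
      then show "shift_poly (q2 - Polynomial.smult u q1) (\<lambda>k. complex_of_int (a j k)) 0 = 0"
        using b eq[of b j]
        by (simp add: shift_poly_diff shift_poly_smult u_def field_simps flip: w1_def w2_def)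
    qed
    then have "R * [:- z1, 1:] = R * Polynomial.smult u [:- z2, 1:]"
      by (simp add: q1_def q2_def smult_diff_right mult.commute)
    then have "[:- z1, 1:] = Polynomial.smult u [:- z2, 1:]"
      using R0 mult_left_cancel by blast
    then show False
      using \<open>z1 \<noteq> z2\<close> by auto
  qed
  moreover have "cmod z2 > 1" "cmod z1 > 1"
    using big ev by (auto simp: \<theta> eigenvalues_by_modulus_def)
  ultimately show thesis
    using that q1 q2 unfolding w1_def w2_def by blast
qed

section \<open>Measure of strips in the simplex\<close>

lemma emeasure_lborel_affine_le:
  fixes \<alpha> \<beta> \<epsilon> :: real
  assumes "\<beta> \<noteq> 0" "0 \<le> \<epsilon>"
  shows "emeasure lborel {x. \<bar>\<alpha> + \<beta> * x\<bar> \<le> \<epsilon>} \<le> ennreal (2 * \<epsilon> / \<bar>\<beta>\<bar>)"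
proof -
  have "{x. \<bar>\<alpha> + \<beta> * x\<bar> \<le> \<epsilon>} \<subseteq> {- \<alpha> / \<beta> - \<epsilon> / \<bar>\<beta>\<bar> .. - \<alpha> / \<beta> + \<epsilon> / \<bar>\<beta>\<bar>}"
  proof
    fix x assume "x \<in> {x. \<bar>\<alpha> + \<beta> * x\<bar> \<le> \<epsilon>}"
    then have "\<bar>\<alpha> + \<beta> * x\<bar> / \<bar>\<beta>\<bar> \<le> \<epsilon> / \<bar>\<beta>\<bar>"
      by (intro divide_right_mono) auto
    moreover have "\<bar>\<alpha> + \<beta> * x\<bar> / \<bar>\<beta>\<bar> = \<bar>\<alpha> / \<beta> + x\<bar>"
      using assms(1) unfolding abs_divide[symmetric] add_divide_distrib by simp
    ultimately have "\<bar>\<alpha> / \<beta> + x\<bar> \<le> \<epsilon> / \<bar>\<beta>\<bar>" by linarith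
    then show "x \<in> {- \<alpha> / \<beta> - \<epsilon> / \<bar>\<beta>\<bar> .. - \<alpha> / \<beta> + \<epsilon> / \<bar>\<beta>\<bar>}"
      unfolding minus_divide_left[symmetric] atLeastAtMost_iff by linarith
  qed
  then have "emeasure lborel {x. \<bar>\<alpha> + \<beta> * x\<bar> \<le> \<epsilon>} \<le> emeasure lborel {- \<alpha> / \<beta> - \<epsilon> / \<bar>\<beta>\<bar> .. - \<alpha> / \<beta> + \<epsilon> / \<bar>\<beta>\<bar>}"
    by (intro emeasure_mono) auto
  also have "\<dots> = ennreal (2 * \<epsilon> / \<bar>\<beta>\<bar>)"
    using assms(2) by (subst emeasure_lborel_Icc) simp_all
  finally show ?thesis .
qed

text \<open>Fubini with coordinate \<open>j\<close> innermost: every line in this direction meets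
  the strip in a set of length at most \<open>2 * \<epsilon> / \<bar>d j\<bar>\<close>, and the
  remaining cube has measure \<open>1\<close>.\<close>

lemma emeasure_cube_strip_le:
  fixes d :: "nat \<Rightarrow> real"
  assumes I: "finite I" "j \<in> I" and d: "d j \<noteq> 0" and \<epsilon>: "0 \<le> \<epsilon>"
  shows "emeasure (\<Pi>\<^sub>M i\<in>I. lborel) {u \<in> I \<rightarrow>\<^sub>E {0..1}. \<bar>\<alpha> + (\<Sum>i\<in>I. d i * u i)\<bar> \<le> \<epsilon>}
    \<le> ennreal (2 * \<epsilon> / \<bar>d j\<bar>)" (is "emeasure ?P ?A \<le> ?r")
proof -
  interpret product_sigma_finite "\<lambda>_::nat. lborel :: real measure" ..
  define J where "J = I - {j}"
  have J: "finite J" "j \<notin> J" "I = insert j J"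
    using I by (auto simp: J_def)
  let ?PJ = "\<Pi>\<^sub>M i\<in>J. lborel :: real measure"
  have "{u \<in> space ?P. (\<forall>i\<in>I. 0 \<le> u i \<and> u i \<le> 1) \<and> \<bar>\<alpha> + (\<Sum>i\<in>I. d i * u i)\<bar> \<le> \<epsilon>} \<in> sets ?P"
    using I(1) by measurable
  moreover have "?A = {u \<in> space ?P. (\<forall>i\<in>I. 0 \<le> u i \<and> u i \<le> 1) \<and> \<bar>\<alpha> + (\<Sum>i\<in>I. d i * u i)\<bar> \<le> \<epsilon>}"
    by (auto simp: space_PiM PiE_iff)
  ultimately have A: "?A \<in> sets ?P" by simp
  have cube: "(J \<rightarrow>\<^sub>E {0..1}) \<in> sets ?PJ"
    using J by (intro sets_PiM_I_finite) auto
  have "emeasure ?P ?A = (\<integral>\<^sup>+u. indicator ?A u \<partial>(\<Pi>\<^sub>M i\<in>insert j J. lborel))"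
    using A by (simp add: J(3))
  also have "\<dots> = (\<integral>\<^sup>+u. (\<integral>\<^sup>+y. indicator ?A (u(j := y)) \<partial>lborel) \<partial>?PJ)"
    by (rule product_nn_integral_insert) (use J A in \<open>auto simp flip: J(3)\<close>)
  also have "\<dots> \<le> (\<integral>\<^sup>+u. ?r * indicator (J \<rightarrow>\<^sub>E {0..1}) u \<partial>?PJ)"
  proof (rule nn_integral_mono)
    fix u :: "nat \<Rightarrow> real" assume u: "u \<in> space ?PJ"
    show "(\<integral>\<^sup>+y. indicator ?A (u(j := y)) \<partial>lborel) \<le> ?r * indicator (J \<rightarrow>\<^sub>E {0..1}) u"
    proof (cases "u \<in> J \<rightarrow>\<^sub>E {0..1}")
      case True
      let ?B = "{y. \<bar>(\<alpha> + (\<Sum>i\<in>J. d i * u i)) + d j * y\<bar> \<le> \<epsilon>}"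
      have sum: "(\<Sum>i\<in>I. d i * (u(j := y)) i) = d j * y + (\<Sum>i\<in>J. d i * u i)" for y
        unfolding J(3) using J(1,2) by (subst sum.insert) (auto intro!: sum.cong)
      have "(\<integral>\<^sup>+y. indicator ?A (u(j := y)) \<partial>lborel) \<le> (\<integral>\<^sup>+y. indicator ?B y \<partial>lborel)"
        by (rule nn_integral_mono) (auto simp: indicator_def sum add_ac simp del: fun_upd_apply)
      also have "\<dots> = emeasure lborel ?B"
        by (rule nn_integral_indicator) measurable
      also have "\<dots> \<le> ?r"
        by (rule emeasure_lborel_affine_le) fact+
      finally show ?thesis using True by simp
    next
      case False
      have "u(j := y) \<notin> ?A" for y
      proof
        assume "u(j := y) \<in> ?A"
        then have "\<forall>i\<in>J. u i \<in> {0..1}"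
          using J by (auto simp: PiE_iff split: if_splits)
        with False u show False by (auto simp: space_PiM PiE_iff)
      qed
      then show ?thesis by simp
    qed
  qed
  also have "\<dots> = ?r * emeasure ?PJ (J \<rightarrow>\<^sub>E {0..1})"
    using cube by (rule nn_integral_cmult_indicator)
  also have "emeasure ?PJ (J \<rightarrow>\<^sub>E {0..1::real}) = 1"
    by (subst emeasure_PiM) (use J in auto)
  finally show ?thesis by simp
qed

lemma simplex_point_measurable:
  assumes "0 < m"
  shows "simplex_point m \<in> measurable (\<Pi>\<^sub>M j\<in>{..<m - 1}. lborel) (\<Pi>\<^sub>M j\<in>{..<m}. borel)"
proof -
  have "(\<lambda>u. u) \<in> measurable (\<Pi>\<^sub>M j\<in>{..<m - 1}. lborel) (\<Pi>\<^sub>M j\<in>{..<m - 1}. borel :: real measure)"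
    by (rule measurable_ident_sets) (intro sets_PiM_cong, auto)
  then show ?thesis
    unfolding simplex_point_def using assms
    by (intro measurable_fun_upd[where J = "{..<m - 1}"]) (auto, measurable)
qed

lemma open_simplex_bounds:
  assumes "s \<in> open_simplex m" "j < m"
  shows "0 < s j" "s j \<le> 1"
proof -
  show "0 < s j" using assms by (simp add: open_simplex_def)
  have "s j \<le> (\<Sum>j<m. s j)"
    by (rule member_le_sum) (use assms in \<open>auto simp: open_simplex_def intro: less_imp_le\<close>)
  then show "s j \<le> 1"
    using assms(1) by (simp add: open_simplex_def)
qed

lemma open_simplex_sets: "open_simplex m \<in> sets (\<Pi>\<^sub>M j\<in>{..<m}. borel)"
proof -
  have "open_simplex m = {s \<in> space (\<Pi>\<^sub>M j\<in>{..<m}. borel). (\<forall>j\<in>{..<m}. 0 < s j) \<and> (\<Sum>j<m. s j) = 1}"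
    by (auto simp: open_simplex_def space_PiM)
  also have "\<dots> \<in> sets (\<Pi>\<^sub>M j\<in>{..<m}. borel)"
    by measurable
  finally show ?thesis .
qed

text \<open>\<open>W\<close> is complex because the eigenvalues may be; measure estimates use the
  real or the imaginary part of the condition.\<close>

definition simplex_strip :: "nat \<Rightarrow> (nat \<Rightarrow> complex) \<Rightarrow> real \<Rightarrow> (nat \<Rightarrow> real) set" where
  "simplex_strip m W \<epsilon> = {s \<in> open_simplex m. cmod (\<Sum>j<m. of_real (s j) * W j) \<le> \<epsilon>}"

lemma sets_simplex_lebesgue:
  "sets (simplex_lebesgue m) = sets (restrict_space (\<Pi>\<^sub>M j\<in>{..<m}. borel) (open_simplex m))"
  and space_simplex_lebesgue: "space (simplex_lebesgue m) = open_simplex m"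
  using open_simplex_sets[THEN sets.sets_into_space, of m]
  by (auto simp: simplex_lebesgue_def space_restrict_space)

lemma simplex_strip_sets: "simplex_strip m W \<epsilon> \<in> sets (simplex_lebesgue m)"
proof -
  have "{s \<in> space (\<Pi>\<^sub>M j\<in>{..<m}. borel). cmod (\<Sum>j<m. of_real (s j) * W j) \<le> \<epsilon>} \<in> sets (\<Pi>\<^sub>M j\<in>{..<m}. borel)"
    by measurable
  moreover have "simplex_strip m W \<epsilon> =
      {s \<in> space (\<Pi>\<^sub>M j\<in>{..<m}. borel). cmod (\<Sum>j<m. of_real (s j) * W j) \<le> \<epsilon>} \<inter> open_simplex m"
    using open_simplex_sets[THEN sets.sets_into_space, of m] by (auto simp: simplex_strip_def)
  ultimately show ?thesis
    unfolding sets_simplex_lebesgue sets_restrict_space by blast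
qed

lemma emeasure_simplex_lebesgue_le:
  assumes m: "0 < m" and S: "S \<in> sets (simplex_lebesgue m)"
    and B: "B \<in> sets (\<Pi>\<^sub>M j\<in>{..<m - 1}. lborel)"
    and sub: "\<And>u. u \<in> {..<m - 1} \<rightarrow>\<^sub>E {0..1} \<Longrightarrow> simplex_point m u \<in> S \<Longrightarrow> u \<in> B"
  shows "emeasure (simplex_lebesgue m) S \<le> emeasure (\<Pi>\<^sub>M j\<in>{..<m - 1}. lborel) B"
proof -
  let ?P = "\<Pi>\<^sub>M j\<in>{..<m - 1}. lborel :: real measure"
  let ?Q = "\<Pi>\<^sub>M j\<in>{..<m}. borel :: real measure"
  let ?D = "{u \<in> {..<m - 1} \<rightarrow>\<^sub>E UNIV. simplex_point m u \<in> open_simplex m}"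
  have D: "?D \<in> sets ?P"
  proof -
    have "?D = simplex_point m -` open_simplex m \<inter> space ?P"
      by (auto simp: space_PiM)
    then show ?thesis
      using measurable_sets[OF simplex_point_measurable[OF m] open_simplex_sets] by (simp only:)
  qed
  have f: "simplex_point m \<in> measurable (restrict_space ?P ?D) (restrict_space ?Q (open_simplex m))"
    by (intro measurable_restrict_space3 simplex_point_measurable m) auto
  have S': "S \<in> sets (restrict_space ?Q (open_simplex m))"
    using S by (simp add: sets_simplex_lebesgue)
  have SO: "S \<subseteq> open_simplex m"
    using sets.sets_into_space[OF S] by (simp add: space_simplex_lebesgue)
  have cube: "u \<in> {..<m - 1} \<rightarrow>\<^sub>E {0..1}" if "u \<in> ?D" for u
  proof -
    have "0 \<le> u j \<and> u j \<le> 1" if "j < m - 1" for j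
    proof -
      have "simplex_point m u j = u j" "j < m"
        using that by (auto simp: simplex_point_def)
      then show ?thesis
        using open_simplex_bounds[of "simplex_point m u" m j] \<open>u \<in> ?D\<close> by simp
    qed
    with that show ?thesis by (auto simp: PiE_iff)
  qed
  have "emeasure (simplex_lebesgue m) S
      = emeasure (restrict_space ?P ?D) (simplex_point m -` S \<inter> space (restrict_space ?P ?D))"
    unfolding simplex_lebesgue_def by (rule emeasure_distr[OF f S'])
  also have "\<dots> = emeasure ?P (simplex_point m -` S \<inter> space (restrict_space ?P ?D))"
    using D by (intro emeasure_restrict_space) (auto simp: space_restrict_space space_PiM)
  also have "\<dots> \<le> emeasure ?P B"
    using sub cube B by (intro emeasure_mono) (auto simp: space_restrict_space)
  finally show ?thesis .
qed

lemma emeasure_simplex_lebesgue_le_1: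
  assumes "0 < m" "S \<in> sets (simplex_lebesgue m)"
  shows "emeasure (simplex_lebesgue m) S \<le> 1"
proof -
  interpret product_sigma_finite "\<lambda>_::nat. lborel :: real measure" ..
  have "({..<m - 1} \<rightarrow>\<^sub>E {0..1::real}) \<in> sets (\<Pi>\<^sub>M i\<in>{..<m - 1}. lborel)"
    by (intro sets_PiM_I_finite) auto
  then have "emeasure (simplex_lebesgue m) S \<le> emeasure (\<Pi>\<^sub>M i\<in>{..<m - 1}. lborel) ({..<m - 1} \<rightarrow>\<^sub>E {0..1::real})"
    by (rule emeasure_simplex_lebesgue_le[OF assms])
  also have "\<dots> = 1"
    by (subst emeasure_PiM) auto
  finally show ?thesis .
qed

lemma simplex_point_sum:
  fixes W :: "nat \<Rightarrow> complex"
  assumes "0 < m"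
  shows "(\<Sum>j<m. of_real (simplex_point m u j) * W j)
    = W (m - 1) + (\<Sum>j<m - 1. of_real (u j) * (W j - W (m - 1)))"
proof -
  have "(\<Sum>j<m. of_real (simplex_point m u j) * W j)
      = (\<Sum>j<m - 1. of_real (simplex_point m u j) * W j) + of_real (simplex_point m u (m - 1)) * W (m - 1)"
    using assms by (cases m) auto
  also have "(\<Sum>j<m - 1. of_real (simplex_point m u j) * W j) = (\<Sum>j<m - 1. of_real (u j) * W j)"
    by (rule sum.cong) (auto simp: simplex_point_def)
  finally show ?thesis
    by (simp add: simplex_point_def algebra_simps sum_subtractf sum_distrib_left)
qed

text \<open>The bound must be uniform in \<open>W\<close>, since the strips come from many integer
  sequences. In the chart the linear form has coefficients \<open>W j - W (m - 1)\<close>. If one of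
  them is at least \<open>\<kappa> / 4\<close> in modulus, its real or imaginary part is at least
  \<open>\<kappa> / 8\<close>, and slicing gives \<open>2 * \<epsilon> / (\<kappa> / 8)\<close>.
  Otherwise all entries of \<open>W\<close> lie within \<open>\<kappa> / 2\<close> of
  \<open>W j0\<close>, so a convex combination cannot be smaller than
  \<open>\<kappa> / 2\<close>.\<close>

lemma emeasure_simplex_strip_le:
  assumes m: "j0 < m" and \<kappa>: "0 < \<kappa>" "\<kappa> \<le> cmod (W j0)" and \<epsilon>: "0 \<le> \<epsilon>"
  shows "emeasure (simplex_lebesgue m) (simplex_strip m W \<epsilon>) \<le> ennreal (16 * \<epsilon> / \<kappa>)"
proof (cases "\<exists>j<m - 1. \<kappa> / 4 \<le> cmod (W j - W (m - 1))")
  case True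
  then obtain j where j: "j < m - 1" "\<kappa> / 4 \<le> cmod (W j - W (m - 1))" by blast
  have m0: "0 < m" using m by simp
  \<comment> \<open>The function \<open>g\<close> will be \<open>Re\<close> or \<open>Im\<close>,
    whichever is large on the chosen coefficient.\<close>
  have *: "emeasure (simplex_lebesgue m) (simplex_strip m W \<epsilon>) \<le> ennreal (16 * \<epsilon> / \<kappa>)"
    if g: "\<And>z. \<bar>g z\<bar> \<le> cmod z" "\<And>x z. g (of_real x * z) = x * g z" "\<And>z w. g (z + w) = g z + g w"
      and gj: "\<kappa> / 8 \<le> \<bar>g (W j - W (m - 1))\<bar>" for g :: "complex \<Rightarrow> real"
  proof -
    let ?P = "\<Pi>\<^sub>M j\<in>{..<m - 1}. lborel :: real measure"
    let ?d = "\<lambda>j. g (W j - W (m - 1))"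
    let ?B = "{u \<in> {..<m - 1} \<rightarrow>\<^sub>E {0..1}. \<bar>g (W (m - 1)) + (\<Sum>i\<in>{..<m - 1}. ?d i * u i)\<bar> \<le> \<epsilon>}"
    have gsum: "g (\<Sum>i\<in>I. h i) = (\<Sum>i\<in>I. g (h i))" for h and I :: "nat set"
      using g(2)[of 0 0] by (induction I rule: infinite_finite_induct) (auto simp: g(3))
    have "{u \<in> space ?P. (\<forall>i\<in>{..<m - 1}. 0 \<le> u i \<and> u i \<le> 1) \<and> \<bar>g (W (m - 1)) + (\<Sum>i\<in>{..<m - 1}. ?d i * u i)\<bar> \<le> \<epsilon>} \<in> sets ?P"
      by measurable
    moreover have "?B = {u \<in> space ?P. (\<forall>i\<in>{..<m - 1}. 0 \<le> u i \<and> u i \<le> 1) \<and> \<bar>g (W (m - 1)) + (\<Sum>i\<in>{..<m - 1}. ?d i * u i)\<bar> \<le> \<epsilon>}"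
      by (auto simp: space_PiM PiE_iff)
    ultimately have B: "?B \<in> sets ?P" by simp
    have "u \<in> ?B" if u: "u \<in> {..<m - 1} \<rightarrow>\<^sub>E {0..1}" and s: "simplex_point m u \<in> simplex_strip m W \<epsilon>" for u
    proof -
      have "\<bar>g (\<Sum>j<m. of_real (simplex_point m u j) * W j)\<bar> \<le> \<epsilon>"
        using g(1)[of "\<Sum>j<m. of_real (simplex_point m u j) * W j"] s by (simp add: simplex_strip_def)
      then show ?thesis
        using u unfolding simplex_point_sum[OF m0] by (simp add: g gsum mult.commute)
    qed
    then have "emeasure (simplex_lebesgue m) (simplex_strip m W \<epsilon>) \<le> emeasure ?P ?B"
      by (intro emeasure_simplex_lebesgue_le simplex_strip_sets B m0) auto
    also have "\<dots> \<le> ennreal (2 * \<epsilon> / \<bar>?d j\<bar>)"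
      by (rule emeasure_cube_strip_le) (use j gj \<kappa> \<epsilon> in auto)
    also have "\<dots> \<le> ennreal (16 * \<epsilon> / \<kappa>)"
    proof (rule ennreal_leI)
      have "2 * \<epsilon> / \<bar>?d j\<bar> \<le> 2 * \<epsilon> / (\<kappa> / 8)"
        by (rule divide_left_mono) (use gj \<kappa> \<epsilon> in auto)
      then show "2 * \<epsilon> / \<bar>?d j\<bar> \<le> 16 * \<epsilon> / \<kappa>" by simp
    qed
    finally show ?thesis .
  qed
  have "\<kappa> / 8 \<le> \<bar>Re (W j - W (m - 1))\<bar> \<or> \<kappa> / 8 \<le> \<bar>Im (W j - W (m - 1))\<bar>"
    using cmod_le[of "W j - W (m - 1)"] j(2) by linarith
  then show ?thesis
  proof
    assume "\<kappa> / 8 \<le> \<bar>Re (W j - W (m - 1))\<bar>"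
    then show ?thesis
      by (intro *[of Re]) (auto simp: abs_Re_le_cmod)
  next
    assume "\<kappa> / 8 \<le> \<bar>Im (W j - W (m - 1))\<bar>"
    then show ?thesis
      by (intro *[of Im]) (auto simp: abs_Im_le_cmod)
  qed
next
  case False
  then have near: "cmod (W j - W (m - 1)) \<le> \<kappa> / 4" if "j < m" for j
    using that \<kappa>(1) by (cases "j = m - 1") (auto simp: not_le intro: less_imp_le)
  show ?thesis
  proof (cases "\<kappa> / 2 \<le> \<epsilon>")
    case True
    \<comment> \<open>For such \<open>\<epsilon>\<close> the claimed bound is at least
      \<open>8\<close>, so the total mass suffices.\<close>
    have "emeasure (simplex_lebesgue m) (simplex_strip m W \<epsilon>) \<le> 1"
      using m by (intro emeasure_simplex_lebesgue_le_1 simplex_strip_sets) auto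
    also have "\<dots> \<le> ennreal (16 * \<epsilon> / \<kappa>)"
      using True \<kappa> by (simp add: field_simps)
    finally show ?thesis .
  next
    case F: False
    have "simplex_strip m W \<epsilon> = {}"
    proof (rule ccontr)
      assume "simplex_strip m W \<epsilon> \<noteq> {}"
      then obtain s where s: "s \<in> open_simplex m" "cmod (\<Sum>j<m. of_real (s j) * W j) \<le> \<epsilon>"
        by (auto simp: simplex_strip_def)
      have s1: "(\<Sum>j<m. s j) = 1" and s0: "\<And>j. j < m \<Longrightarrow> 0 < s j"
        using s by (auto simp: open_simplex_def)
      have "W j0 = (\<Sum>j<m. of_real (s j) * W j0)"
        unfolding sum_distrib_right[symmetric] of_real_sum[symmetric] s1 by simp
      also have "\<dots> = (\<Sum>j<m. of_real (s j) * W j) + (\<Sum>j<m. of_real (s j) * (W j0 - W j))"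
        by (simp add: algebra_simps sum_subtractf)
      finally have eq: "W j0 = (\<Sum>j<m. of_real (s j) * W j) + (\<Sum>j<m. of_real (s j) * (W j0 - W j))" .
      have "cmod (\<Sum>j<m. of_real (s j) * (W j0 - W j)) \<le> (\<Sum>j<m. s j * (\<kappa> / 2))"
      proof (rule sum_norm_le)
        fix j assume "j \<in> {..<m}"
        then have j: "j < m" by simp
        have "cmod (W j0 - W j) \<le> \<kappa> / 4 + \<kappa> / 4"
          using norm_triangle_ineq4[of "W j0 - W (m - 1)" "W j - W (m - 1)"] near[OF m] near[OF j]
          by simp
        then show "cmod (of_real (s j) * (W j0 - W j)) \<le> s j * (\<kappa> / 2)"
          using s0[OF j] by (auto simp: norm_mult)
      qed
      also have "\<dots> = \<kappa> / 2"
        unfolding sum_distrib_right[symmetric] s1 by simp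
      finally have "cmod (W j0) \<le> \<epsilon> + \<kappa> / 2"
        using s(2) norm_triangle_ineq[of "\<Sum>j<m. of_real (s j) * W j" "\<Sum>j<m. of_real (s j) * (W j0 - W j)"]
        unfolding eq[symmetric] by linarith
      with F \<kappa> show False by linarith
    qed
    then show ?thesis by simp
  qed
qed

section \<open>Counting integer sequences with few defects\<close>

text \<open>A count by exponential weights: each nonzero value gets the weight \<open>t\<close>. A
  function in \<open>D\<close> weighs at least \<open>t powr j\<close>, while the weights of all
  functions add up to a product over the \<open>N\<close> places. A small \<open>t\<close> makes
  that product grow slowly, at a price that is harmless when \<open>j\<close> is a small multiple of
  \<open>N\<close>.\<close>

lemma card_sparse_functions_le:
  fixes H :: int and t j :: real and N :: nat
  assumes H: "0 \<le> H" and t: "0 < t" "t \<le> 1"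
  defines "D \<equiv> {d \<in> {..<N} \<rightarrow>\<^sub>E {- H..H}. real (card {k. k < N \<and> d k \<noteq> 0}) \<le> j}"
  shows "finite D" "real (card D) * t powr j \<le> (1 + 2 * of_int H * t) ^ N"
proof -
  let ?P = "{..<N} \<rightarrow>\<^sub>E {- H..H}"
  let ?w = "\<lambda>x. if x = 0 then 1 else t"
  have fin: "finite ?P" by (intro finite_PiE) auto
  then show "finite D" by (simp add: D_def)
  have prod: "(\<Prod>k<N. ?w (d k)) = t ^ card {k. k < N \<and> d k \<noteq> 0}" for d :: "nat \<Rightarrow> int"
  proof -
    have "(\<Prod>k<N. ?w (d k)) = (\<Prod>k\<in>{k. k < N \<and> d k \<noteq> 0}. ?w (d k))"
      by (rule prod.mono_neutral_right) auto
    also have "\<dots> = t ^ card {k. k < N \<and> d k \<noteq> 0}"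
      by simp
    finally show ?thesis .
  qed
  have "real (card D) * t powr j = (\<Sum>d\<in>D. t powr j)" by simp
  also have "\<dots> \<le> (\<Sum>d\<in>D. \<Prod>k<N. ?w (d k))"
  proof (rule sum_mono)
    fix d assume "d \<in> D"
    then have "t powr j \<le> t powr real (card {k. k < N \<and> d k \<noteq> 0})"
      using t by (intro powr_mono') (auto simp: D_def)
    then show "t powr j \<le> (\<Prod>k<N. ?w (d k))"
      using t by (simp add: prod powr_realpow)
  qed
  also have "\<dots> \<le> (\<Sum>d\<in>?P. \<Prod>k<N. ?w (d k))"
  proof (rule sum_mono2[OF fin])
    show "0 \<le> (\<Prod>k<N. ?w (d k))" for d :: "nat \<Rightarrow> int"
      using t unfolding prod by simp
  qed (auto simp: D_def)
  also have "\<dots> = (\<Prod>k<N. \<Sum>x\<in>{- H..H}. ?w x)"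
    by (rule prod_sum_PiE[symmetric]) auto
  also have "\<dots> = (1 + 2 * of_int H * t) ^ N"
  proof -
    have "{- H..H} = insert 0 ({- H..-1} \<union> {1..H})" using H by auto
    then have "(\<Sum>x\<in>{- H..H}. ?w x) = 1 + (\<Sum>x\<in>{- H..-1} \<union> {1..H}. ?w x)"
      by (simp only: sum.insert) (subst sum.insert, auto)
    also have "(\<Sum>x\<in>{- H..-1} \<union> {1..H}. ?w x) = 2 * of_int H * t"
    proof -
      have "(\<Sum>x\<in>{- H..-1} \<union> {1..H}. ?w x) = (\<Sum>x\<in>{- H..-1} \<union> {1..H}. t)"
        by (rule sum.cong) auto
      also have "\<dots> = 2 * of_int H * t"
        using H by (subst sum.union_disjoint) auto
      finally show ?thesis .
    qed
    finally have "(\<Sum>x\<in>{- H..H}. ?w x) = 1 + 2 * of_int H * t" .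
    then show ?thesis by simp
  qed
  finally show "real (card D) * t powr j \<le> (1 + 2 * of_int H * t) ^ N" .
qed

text \<open>Since \<open>p\<close> is monic of degree \<open>m\<close>, the recurrence with
  prescribed right-hand side determines each term from the \<open>m\<close> preceding ones.\<close>

lemma shift_poly_inj:
  fixes p :: "int poly"
  assumes p: "degree p = m" "lead_coeff p = 1"
    and init: "\<And>i. i < m \<Longrightarrow> K i = K' i"
    and step: "\<And>k. k < N \<Longrightarrow> shift_poly p K k = shift_poly p K' k"
    and "i < N + m"
  shows "K i = K' i"
  using \<open>i < N + m\<close>
proof (induction i rule: less_induct)
  case (less i)
  show ?case
  proof (cases "i < m")
    case False
    define k where "k = i - m"
    have k: "k < N" "i = k + m"
      using False less.prems by (auto simp: k_def)
    have split: "shift_poly p L k = (\<Sum>l<m. coeff p l * L (k + l)) + L i" for L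
      using p by (simp add: shift_poly_def lessThan_Suc_atMost[symmetric] k)
    have "(\<Sum>l<m. coeff p l * K (k + l)) = (\<Sum>l<m. coeff p l * K' (k + l))"
      by (rule sum.cong) (use less.IH k in auto)
    then show ?thesis
      using step[OF k(1)] by (simp add: split)
  qed (use init in simp)
qed

text \<open>A sequence is encoded by its first \<open>m\<close> values and its defects, the values
  of \<open>shift_poly p K\<close>, which form a sparse bounded function.\<close>

lemma card_approximate_recurrences_le:
  fixes p :: "int poly" and H M :: int and t j :: real and N m :: nat
  assumes p: "degree p = m" "lead_coeff p = 1"
    and H: "0 \<le> H" and M: "0 \<le> M" and t: "0 < t" "t \<le> 1"
  defines "KK \<equiv> {K \<in> {..<N + m} \<rightarrow>\<^sub>E UNIV. (\<forall>i<m. \<bar>K i\<bar> \<le> M) \<and> (\<forall>k<N. \<bar>shift_poly p K k\<bar> \<le> H)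
    \<and> real (card {k. k < N \<and> shift_poly p K k \<noteq> 0}) \<le> j}"
  shows "finite KK" "real (card KK) \<le> (2 * of_int M + 1) ^ m * (t powr (- j) * (1 + 2 * of_int H * t) ^ N)"
proof -
  define D where "D = {d \<in> {..<N} \<rightarrow>\<^sub>E {- H..H}. real (card {k. k < N \<and> d k \<noteq> 0}) \<le> j}"
  note D = card_sparse_functions_le[OF H t, of N j, folded D_def]
  let ?I = "{..<m} \<rightarrow>\<^sub>E {- M..M}"
  have finI: "finite ?I" by (intro finite_PiE) auto
  define F where "F K = (restrict K {..<m}, restrict (shift_poly p K) {..<N})" for K :: "nat \<Rightarrow> int"
  have supp: "{k. k < N \<and> restrict (shift_poly p K) {..<N} k \<noteq> 0} = {k. k < N \<and> shift_poly p K k \<noteq> 0}"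
    for K by auto
  have FK: "F ` KK \<subseteq> ?I \<times> D"
  proof (rule image_subsetI)
    fix K assume K: "K \<in> KK"
    have "\<forall>i<m. \<bar>K i\<bar> \<le> M" "\<forall>k<N. \<bar>shift_poly p K k\<bar> \<le> H"
      using K by (simp_all add: KK_def)
    then have "\<forall>i<m. K i \<in> {- M..M}" "\<forall>k<N. shift_poly p K k \<in> {- H..H}"
      by force+
    then show "F K \<in> ?I \<times> D"
      using K unfolding F_def D_def KK_def mem_Collect_eq mem_Times_iff fst_conv snd_conv restrict_PiE_iff supp
      by blast
  qed
  have inj: "inj_on F KK"
  proof (rule inj_onI)
    fix K K' assume K: "K \<in> KK" "K' \<in> KK" and "F K = F K'"
    then have eq: "restrict K {..<m} = restrict K' {..<m}"
      "restrict (shift_poly p K) {..<N} = restrict (shift_poly p K') {..<N}"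
      by (auto simp: F_def)
    have "K i = K' i" if "i < N + m" for i
      using that
    proof (rule shift_poly_inj[OF p, rotated 2])
      show "K i = K' i" if "i < m" for i
        using fun_cong[OF eq(1), of i] that by simp
      show "shift_poly p K k = shift_poly p K' k" if "k < N" for k
        using fun_cong[OF eq(2), of k] that by simp
    qed
    then show "K = K'"
      using K by (intro PiE_ext[of K "{..<N + m}" "\<lambda>_. UNIV" K']) (auto simp: KK_def)
  qed
  have fin: "finite (?I \<times> D)" using finI D(1) by simp
  then show "finite KK"
    using FK inj by (meson finite_imageD finite_subset)
  have "card KK \<le> card (?I \<times> D)"
    by (rule card_inj_on_le[OF inj FK fin])
  also have "card (?I \<times> D) = nat (2 * M + 1) ^ m * card D"
    by (simp add: card_cartesian_product card_PiE)
  finally have "real (card KK) \<le> real (nat (2 * M + 1) ^ m * card D)"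
    by (rule of_nat_mono)
  also have "\<dots> = (2 * of_int M + 1) ^ m * real (card D)"
    using M by (simp add: of_nat_nat)
  finally have *: "real (card KK) \<le> (2 * of_int M + 1) ^ m * real (card D)" .
  have "real (card D) \<le> t powr (- j) * (1 + 2 * of_int H * t) ^ N"
    using D(2) t by (simp add: powr_minus field_simps)
  then have "(2 * of_int M + 1) ^ m * real (card D)
      \<le> (2 * of_int M + 1) ^ m * (t powr (- j) * (1 + 2 * of_int H * t) ^ N)"
    using M by (intro mult_left_mono) auto
  with * show "real (card KK) \<le> (2 * of_int M + 1) ^ m * (t powr (- j) * (1 + 2 * of_int H * t) ^ N)"
    by (rule order_trans)
qed

text \<open>Applying \<open>q\<close> leaves a sequence killed by the shift minus \<open>z\<close>,
  hence a geometric one.\<close>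

lemma shift_poly_root_power:
  fixes z :: "'a::comm_ring_1"
  assumes "\<And>k. shift_poly ([:- z, 1:] * q) t k = 0"
  shows "shift_poly q t k = z ^ k * shift_poly q t 0"
proof (induction k)
  case (Suc k)
  have "shift_poly [:- z, 1:] (shift_poly q t) k = 0"
    using assms by (simp only: shift_poly_mult)
  then have "shift_poly q t (Suc k) = z * shift_poly q t k"
    by (simp add: shift_poly_pCons)
  then show ?case
    using Suc by simp
qed simp

lemma norm_shift_poly_le:
  fixes q :: "'a::{comm_ring_1,real_normed_algebra_1} poly"
  assumes "\<And>i. i \<le> degree q \<Longrightarrow> norm (t (k + i)) \<le> c"
  shows "norm (shift_poly q t k) \<le> (\<Sum>i\<le>degree q. norm (coeff q i)) * c"
  unfolding shift_poly_def sum_distrib_right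
proof (rule sum_norm_le)
  fix i assume "i \<in> {..degree q}"
  then show "norm (coeff q i * t (k + i)) \<le> norm (coeff q i) * c"
    using mult_left_mono[OF assms[of i] norm_ge_zero, of "coeff q i"] norm_mult_ineq[of "coeff q i" "t (k + i)"]
    by (simp add: mult.commute)
qed

lemma shift_poly_seq_diff: "shift_poly b (\<lambda>k. t k - u k) k = shift_poly b t k - shift_poly b u k"
  by (simp only: shift_poly_def right_diff_distrib sum_subtractf)

section \<open>The Erdos--Kahane argument\<close>

text \<open>In the application \<open>a j k\<close> counts the letter \<open>j\<close> in the
  \<open>k\<close>-th image of the return word and \<open>p\<close> is the characteristic
  polynomial, so that \<open>phase s \<omega> k\<close> is \<open>\<omega>\<close> times the length
  of that image.\<close>

locale integer_recurrence =
  fixes m :: nat and p :: "int poly" and a :: "nat \<Rightarrow> nat \<Rightarrow> int"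
    and z1 z2 :: complex and q1 q2 :: "complex poly" and i1 i2 :: nat
  assumes p: "degree p = m" "lead_coeff p = 1"
    and rec: "\<And>j k. j < m \<Longrightarrow> shift_poly p (a j) k = 0"
    and z: "cmod z1 > 1" "cmod z2 > 1"
    and q: "[:- z1, 1:] * q1 = map_poly of_int p" "[:- z2, 1:] * q2 = map_poly of_int p"
    and i12: "i1 < m" "i2 < m"
      "shift_poly q1 (\<lambda>k. of_int (a i1 k)) 0 * shift_poly q2 (\<lambda>k. of_int (a i2 k)) 0
        \<noteq> shift_poly q1 (\<lambda>k. of_int (a i2 k)) 0 * shift_poly q2 (\<lambda>k. of_int (a i1 k)) 0"
begin

definition w1 where "w1 j = shift_poly q1 (\<lambda>k. of_int (a j k)) 0"
definition w2 where "w2 j = shift_poly q2 (\<lambda>k. of_int (a j k)) 0"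
definition lin :: "(nat \<Rightarrow> complex) \<Rightarrow> (nat \<Rightarrow> real) \<Rightarrow> complex" where
  "lin W s = (\<Sum>j<m. of_real (s j) * W j)"
definition phase :: "(nat \<Rightarrow> real) \<Rightarrow> real \<Rightarrow> nat \<Rightarrow> real" where
  "phase s \<omega> k = \<omega> * (\<Sum>j<m. s j * of_int (a j k))"
text \<open>If \<open>m + 1\<close> consecutive phases are closer than \<open>rho\<close> to
  integers, the defect of the nearest integers is an integer of modulus below
  \<open>1\<close>.\<close>

definition rho :: real where "rho = 1 / (\<Sum>i\<le>m. \<bar>of_int (coeff p i)\<bar>)"
text \<open>The word refers to approximation by integers. For the exponential sums the bad levels
  are the useful ones: they give the cancellation.\<close>

definition bad :: "(nat \<Rightarrow> real) \<Rightarrow> real \<Rightarrow> nat \<Rightarrow> bool" where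
  "bad s \<omega> k \<longleftrightarrow> rho \<le> \<bar>phase s \<omega> k - of_int (round (phase s \<omega> k))\<bar>"
definition H :: int where "H = (\<Sum>i\<le>m. \<bar>coeff p i\<bar>)"
definition \<beta> :: real where "\<beta> = min (cmod z1) (cmod z2)"
definition c0 :: real where
  "c0 = (\<Sum>i\<le>degree q1. cmod (coeff q1 i)) + (\<Sum>i\<le>degree q2. cmod (coeff q2 i))"
definition \<Lambda> :: real where "\<Lambda> = (\<Sum>j<m. cmod (w1 j) + cmod (w2 j))"
definition A0 :: real where "A0 = (\<Sum>j<m. \<Sum>k<m. \<bar>of_int (a j k)\<bar>)"

lemma H_pos: "1 \<le> H"
proof -
  have "\<bar>coeff p m\<bar> \<le> H"
    unfolding H_def by (rule member_le_sum) auto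
  then show ?thesis using p by simp
qed

lemma rho_H: "rho = 1 / of_int H"
  by (simp add: rho_def H_def)

lemma rho_pos: "0 < rho" "rho \<le> 1"
  using H_pos by (auto simp: rho_H)

lemma beta_gt_1: "1 < \<beta>" "\<beta> \<le> cmod z1" "\<beta> \<le> cmod z2"
  using z by (auto simp: \<beta>_def)

lemma degree_q: "degree q1 + 1 = m" "degree q2 + 1 = m"
proof -
  have "map_poly complex_of_int p \<noteq> 0" "degree (map_poly complex_of_int p) = m"
    using p by (auto simp: leading_coeff_0_iff)
  then have "q1 \<noteq> 0" "q2 \<noteq> 0" "degree ([:- z1, 1:] * q1) = m" "degree ([:- z2, 1:] * q2) = m"
    using q by auto
  then show "degree q1 + 1 = m" "degree q2 + 1 = m"
    by (simp_all add: degree_mult_eq del: mult_pCons_left)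
qed

lemma shift_poly_phase:
  "shift_poly (map_poly of_int p) (phase s \<omega>) k = 0"
  "shift_poly (map_poly of_int p) (\<lambda>k. complex_of_real (phase s \<omega> k)) k = 0"
proof -
  have "shift_poly (map_poly of_int p) (\<lambda>k. \<Sum>j<m. (\<omega> * s j) * of_int (a j k)) k = 0"
    unfolding shift_poly_seq_sum by (simp add: of_int_hom.shift_poly_hom rec)
  then show 1: "shift_poly (map_poly of_int p) (phase s \<omega>) k = 0"
    by (simp add: phase_def[abs_def] sum_distrib_left mult.assoc)
  have "map_poly complex_of_int p = map_poly complex_of_real (map_poly of_int p)"
    by (subst map_poly_map_poly) (auto simp: o_def)
  then show "shift_poly (map_poly of_int p) (\<lambda>k. complex_of_real (phase s \<omega> k)) k = 0"
    using 1 by (simp add: of_real_hom.shift_poly_hom)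
qed

lemma shift_poly_phase_root:
  "shift_poly q1 (\<lambda>k. of_real (phase s \<omega> k)) k = z1 ^ k * (of_real \<omega> * lin w1 s)"
  "shift_poly q2 (\<lambda>k. of_real (phase s \<omega> k)) k = z2 ^ k * (of_real \<omega> * lin w2 s)"
proof -
  have eq: "(\<lambda>k. complex_of_real (phase s \<omega> k)) = (\<lambda>k. \<Sum>j<m. (of_real \<omega> * of_real (s j)) * of_int (a j k))"
    by (simp add: phase_def sum_distrib_left mult.assoc)
  have "shift_poly q1 (\<lambda>k. of_real (phase s \<omega> k)) 0 = of_real \<omega> * lin w1 s"
    "shift_poly q2 (\<lambda>k. of_real (phase s \<omega> k)) 0 = of_real \<omega> * lin w2 s"
    unfolding eq shift_poly_seq_sum lin_def w1_def w2_def by (simp_all add: sum_distrib_left mult.assoc)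
  moreover have "shift_poly q1 (\<lambda>k. of_real (phase s \<omega> k)) k = z1 ^ k * shift_poly q1 (\<lambda>k. of_real (phase s \<omega> k)) 0"
    by (rule shift_poly_root_power) (simp only: q shift_poly_phase)
  moreover have "shift_poly q2 (\<lambda>k. of_real (phase s \<omega> k)) k = z2 ^ k * shift_poly q2 (\<lambda>k. of_real (phase s \<omega> k)) 0"
    by (rule shift_poly_root_power) (simp only: q shift_poly_phase)
  ultimately show "shift_poly q1 (\<lambda>k. of_real (phase s \<omega> k)) k = z1 ^ k * (of_real \<omega> * lin w1 s)"
    "shift_poly q2 (\<lambda>k. of_real (phase s \<omega> k)) k = z2 ^ k * (of_real \<omega> * lin w2 s)"
    by simp_all
qed

lemma cmod_lin_le:
  assumes "s \<in> open_simplex m"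
  shows "cmod (lin w1 s) \<le> \<Lambda>" "cmod (lin w2 s) \<le> \<Lambda>"
proof -
  have *: "cmod (of_real (s j) * w) \<le> cmod w" if "j < m" for j w
    using open_simplex_bounds[OF assms that] by (simp add: norm_mult mult_left_le_one_le)
  show "cmod (lin w1 s) \<le> \<Lambda>"
    unfolding lin_def \<Lambda>_def
    by (rule sum_norm_le, rule order_trans[OF *]) auto
  show "cmod (lin w2 s) \<le> \<Lambda>"
    unfolding lin_def \<Lambda>_def
    by (rule sum_norm_le, rule order_trans[OF *]) auto
qed

text \<open>The restriction makes the sequence an element of the extensional function space in which
  sequences are counted.\<close>

definition nint :: "(nat \<Rightarrow> real) \<Rightarrow> real \<Rightarrow> nat \<Rightarrow> nat \<Rightarrow> int" where
  "nint s \<omega> n = restrict (\<lambda>k. round (phase s \<omega> k)) {..<n}"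

lemma nint_near: "k < n \<Longrightarrow> \<bar>phase s \<omega> k - of_int (nint s \<omega> n k)\<bar> \<le> 1 / 2"
  using of_int_round_abs_le[of "phase s \<omega> k"] by (simp add: nint_def abs_minus_commute)

text \<open>The phases satisfy the recurrence exactly, so the defect of their nearest integers is,
  up to sign, that of the rounding errors. Errors up to \<open>1 / 2\<close> bound it by
  \<open>H\<close>; errors below \<open>rho\<close> force it to vanish.\<close>

lemma shift_poly_nint:
  fixes s :: "nat \<Rightarrow> real" and \<omega> :: real
  assumes "k < N"
  defines "d \<equiv> shift_poly p (nint s \<omega> (N + m)) k"
  shows "\<bar>d\<bar> \<le> H" "d \<noteq> 0 \<Longrightarrow> \<exists>i\<le>m. bad s \<omega> (k + i)"
proof -
  let ?e = "\<lambda>k. phase s \<omega> k - of_int (nint s \<omega> (N + m) k)"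
  let ?pR = "map_poly real_of_int p"
  have "shift_poly ?pR ?e k = shift_poly ?pR (phase s \<omega>) k - shift_poly ?pR (\<lambda>k. of_int (nint s \<omega> (N + m) k)) k"
    by (rule shift_poly_seq_diff)
  then have d: "\<bar>of_int d\<bar> = \<bar>shift_poly ?pR ?e k\<bar>"
    by (simp add: shift_poly_phase of_int_hom.shift_poly_hom d_def)
  have sumH: "(\<Sum>i\<le>m. \<bar>real_of_int (coeff p i)\<bar>) = of_int H"
    by (simp add: H_def)
  have bound: "\<bar>of_int d\<bar> \<le> of_int H * c" if "\<And>i. i \<le> m \<Longrightarrow> \<bar>?e (k + i)\<bar> \<le> c" for c
  proof -
    have "norm (shift_poly ?pR ?e k) \<le> (\<Sum>i\<le>degree ?pR. norm (coeff ?pR i)) * c"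
      by (rule norm_shift_poly_le) (use that p in auto)
    then show ?thesis
      unfolding d using p sumH by simp
  qed
  have "\<bar>of_int d\<bar> \<le> of_int H * (1 / 2 :: real)"
    using assms(1) by (intro bound nint_near) auto
  then show "\<bar>d\<bar> \<le> H"
    using H_pos by linarith
  assume "d \<noteq> 0"
  show "\<exists>i\<le>m. bad s \<omega> (k + i)"
  proof (rule ccontr)
    assume "\<not> ?thesis"
    then have lt: "\<bar>?e (k + i)\<bar> < rho" if "i \<le> m" for i
      using that assms(1) by (auto simp: bad_def nint_def)
    \<comment> \<open>Passing to the maximum preserves the strict inequality with
      \<open>rho\<close>, which is what excludes a defect of modulus \<open>1\<close>.\<close>
    define c where "c = Max ((\<lambda>i. \<bar>?e (k + i)\<bar>) ` {..m})"
    have "c < rho"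
      unfolding c_def by (subst Max_less_iff) (use lt in auto)
    have "\<bar>of_int d\<bar> \<le> of_int H * c"
      by (rule bound) (auto simp: c_def)
    also have "\<dots> < of_int H * rho"
      using \<open>c < rho\<close> H_pos by simp
    also have "\<dots> = 1"
      using H_pos by (simp add: rho_H)
    finally show False
      using \<open>d \<noteq> 0\<close> by simp
  qed
qed

text \<open>Each bad level lies in the windows of at most \<open>m + 1\<close> defects.\<close>

lemma card_defects_le:
  "card {k. k < N \<and> shift_poly p (nint s \<omega> (N + m)) k \<noteq> 0} \<le> (m + 1) * card {k. k < N + m \<and> bad s \<omega> k}"
proof -
  let ?G = "{k. k < N + m \<and> bad s \<omega> k}"
  have "{k. k < N \<and> shift_poly p (nint s \<omega> (N + m)) k \<noteq> 0} \<subseteq> (\<lambda>(i, k). k - i) ` ({..m} \<times> ?G)"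
  proof
    fix k assume "k \<in> {k. k < N \<and> shift_poly p (nint s \<omega> (N + m)) k \<noteq> 0}"
    then obtain i where "i \<le> m" "bad s \<omega> (k + i)" "k < N"
      using shift_poly_nint(2) by blast
    then have "(i, k + i) \<in> {..m} \<times> ?G" by auto
    then show "k \<in> (\<lambda>(i, k). k - i) ` ({..m} \<times> ?G)"
      by (rule rev_image_eqI) simp
  qed
  then have "card {k. k < N \<and> shift_poly p (nint s \<omega> (N + m)) k \<noteq> 0} \<le> card ({..m} \<times> ?G)"
    by (intro surj_card_le) auto
  then show ?thesis by (simp add: card_cartesian_product)
qed

lemma nint_initial:
  assumes s: "s \<in> open_simplex m" and "i < m" "i < n"
  shows "\<bar>real_of_int (nint s \<omega> n i)\<bar> \<le> \<bar>\<omega>\<bar> * A0 + 1"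
proof -
  have "\<bar>\<Sum>j<m. s j * of_int (a j i)\<bar> \<le> A0"
    unfolding A0_def
  proof (rule order_trans[OF sum_abs], rule sum_mono)
    fix j assume "j \<in> {..<m}"
    then have j: "j < m" by simp
    have "\<bar>s j\<bar> \<le> 1"
      using open_simplex_bounds[OF s j] by simp
    then have "\<bar>s j * of_int (a j i)\<bar> \<le> \<bar>real_of_int (a j i)\<bar>"
      by (simp add: abs_mult mult_left_le_one_le)
    also have "\<dots> \<le> (\<Sum>k<m. \<bar>of_int (a j k)\<bar>)"
      by (rule member_le_sum) (use assms in auto)
    finally show "\<bar>s j * of_int (a j i)\<bar> \<le> (\<Sum>k<m. \<bar>real_of_int (a j k)\<bar>)" .
  qed
  then have "\<bar>phase s \<omega> i\<bar> \<le> \<bar>\<omega>\<bar> * A0"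
    unfolding phase_def abs_mult by (rule mult_left_mono) simp
  then show ?thesis
    using nint_near[OF assms(3), of s \<omega>] by linarith
qed

text \<open>\<open>X1\<close> and \<open>X2\<close> reconstruct \<open>\<omega> * lin w1 s\<close>
  and \<open>\<omega> * lin w2 s\<close> from an integer sequence alone.\<close>

definition X1 :: "(nat \<Rightarrow> int) \<Rightarrow> nat \<Rightarrow> complex" where
  "X1 L N = shift_poly q1 (\<lambda>k. of_int (L k)) N / z1 ^ N"
definition X2 :: "(nat \<Rightarrow> int) \<Rightarrow> nat \<Rightarrow> complex" where
  "X2 L N = shift_poly q2 (\<lambda>k. of_int (L k)) N / z2 ^ N"
text \<open>With exact values of \<open>X1\<close> and \<open>X2\<close> the form
  \<open>lin (normal L N)\<close> would vanish at \<open>s\<close> for every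
  \<open>\<omega>\<close>: this cross product eliminates the frequency.\<close>

definition normal :: "(nat \<Rightarrow> int) \<Rightarrow> nat \<Rightarrow> nat \<Rightarrow> complex" where
  "normal L N j = X1 L N * w2 j - X2 L N * w1 j"
definition D0 :: real where "D0 = cmod (w1 i1 * w2 i2 - w1 i2 * w2 i1)"

lemma c0_nonneg: "0 \<le> c0"
  unfolding c0_def by (intro add_nonneg_nonneg sum_nonneg) auto

lemma A0_nonneg: "0 \<le> A0"
  unfolding A0_def by (intro sum_nonneg) auto

lemma w_le: "j < m \<Longrightarrow> cmod (w1 j) \<le> \<Lambda>" "j < m \<Longrightarrow> cmod (w2 j) \<le> \<Lambda>"
proof -
  assume "j < m"
  then have "cmod (w1 j) + cmod (w2 j) \<le> \<Lambda>"
    unfolding \<Lambda>_def by (intro member_le_sum) auto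
  then show "cmod (w1 j) \<le> \<Lambda>" "cmod (w2 j) \<le> \<Lambda>"
    using norm_ge_zero[of "w1 j"] norm_ge_zero[of "w2 j"] by linarith+
qed

lemma D0_pos: "0 < D0"
  using i12(3) by (simp add: D0_def w1_def w2_def)

lemma exists_w1: "\<exists>j<m. w1 j \<noteq> 0"
  using D0_pos i12(1,2) by (metis D0_def mult_zero_left diff_self norm_zero less_irrefl)

lemma \<Lambda>_pos: "0 < \<Lambda>"
proof -
  obtain j where "j < m" "w1 j \<noteq> 0"
    using exists_w1 by blast
  then show ?thesis
    using w_le(1)[of j] by (metis less_le_trans zero_less_norm_iff)
qed

text \<open>Rounding changes each phase by at most \<open>1 / 2\<close>, whatever its size, while
  the projection appears multiplied by \<open>z ^ N\<close>. This is where both eigenvalues must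
  exceed \<open>1\<close> in modulus.\<close>

lemma X_near:
  "cmod (of_real \<omega> * lin w1 s - X1 (nint s \<omega> (N + m)) N) \<le> c0 / \<beta> ^ N"
  "cmod (of_real \<omega> * lin w2 s - X2 (nint s \<omega> (N + m)) N) \<le> c0 / \<beta> ^ N"
proof -
  have *: "cmod (of_real \<omega> * l - shift_poly q (\<lambda>k. of_int (nint s \<omega> (N + m) k)) N / z ^ N) \<le> c0 / \<beta> ^ N"
    if z: "\<beta> \<le> cmod z" and root: "shift_poly q (\<lambda>k. of_real (phase s \<omega> k)) N = z ^ N * (of_real \<omega> * l)"
      and deg: "degree q + 1 = m" and c: "(\<Sum>i\<le>degree q. cmod (coeff q i)) \<le> c0" for z l q
  proof -
    let ?L = "nint s \<omega> (N + m)"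
    have "cmod (shift_poly q (\<lambda>k. of_real (phase s \<omega> k) - of_int (?L k)) N)
        \<le> (\<Sum>i\<le>degree q. cmod (coeff q i)) * (1 / 2)"
    proof (rule norm_shift_poly_le)
      fix i assume "i \<le> degree q"
      then have "\<bar>phase s \<omega> (N + i) - of_int (?L (N + i))\<bar> \<le> 1 / 2"
        using deg by (intro nint_near) auto
      then show "cmod (of_real (phase s \<omega> (N + i)) - of_int (?L (N + i))) \<le> 1 / 2"
        by (metis norm_of_real of_real_diff of_real_of_int_eq)
    qed
    also have "\<dots> \<le> c0"
      using c c0_nonneg by linarith
    finally have "cmod (z ^ N * (of_real \<omega> * l) - shift_poly q (\<lambda>k. of_int (?L k)) N) \<le> c0"
      unfolding shift_poly_seq_diff root .
    moreover have z0: "0 < cmod z" "z \<noteq> 0"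
      using z beta_gt_1(1) by auto
    then have "of_real \<omega> * l - shift_poly q (\<lambda>k. of_int (?L k)) N / z ^ N
        = (z ^ N * (of_real \<omega> * l) - shift_poly q (\<lambda>k. of_int (?L k)) N) / z ^ N"
      by (simp add: diff_divide_distrib)
    ultimately have "cmod (of_real \<omega> * l - shift_poly q (\<lambda>k. of_int (?L k)) N / z ^ N) \<le> c0 / cmod z ^ N"
      by (simp add: norm_divide norm_power divide_right_mono)
    also have "\<dots> \<le> c0 / \<beta> ^ N"
      using z beta_gt_1(1) c0_nonneg z0 by (intro divide_left_mono power_mono mult_pos_pos zero_less_power) auto
    finally show ?thesis .
  qed
  have "0 \<le> (\<Sum>i\<le>degree q1. cmod (coeff q1 i))" "0 \<le> (\<Sum>i\<le>degree q2. cmod (coeff q2 i))"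
    by (simp_all add: sum_nonneg)
  then have c: "(\<Sum>i\<le>degree q1. cmod (coeff q1 i)) \<le> c0" "(\<Sum>i\<le>degree q2. cmod (coeff q2 i)) \<le> c0"
    by (simp_all add: c0_def)
  show "cmod (of_real \<omega> * lin w1 s - X1 (nint s \<omega> (N + m)) N) \<le> c0 / \<beta> ^ N"
    unfolding X1_def by (rule *[OF beta_gt_1(2) shift_poly_phase_root(1) degree_q(1) c(1)])
  show "cmod (of_real \<omega> * lin w2 s - X2 (nint s \<omega> (N + m)) N) \<le> c0 / \<beta> ^ N"
    unfolding X2_def by (rule *[OF beta_gt_1(3) shift_poly_phase_root(2) degree_q(2) c(2)])
qed

lemma lin_normal: "lin (normal L N) s = X1 L N * lin w2 s - X2 L N * lin w1 s"
  unfolding lin_def normal_def by (simp only: sum_distrib_left sum_subtractf[symmetric]) (simp add: algebra_simps)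

text \<open>The two terms with \<open>\<omega> * lin w1 s * lin w2 s\<close> cancel, so the width of
  the strip does not depend on \<open>\<omega>\<close>.\<close>

lemma cmod_lin_normal_le:
  assumes "s \<in> open_simplex m"
  shows "cmod (lin (normal (nint s \<omega> (N + m)) N) s) \<le> 2 * \<Lambda> * (c0 / \<beta> ^ N)"
proof -
  let ?X1 = "X1 (nint s \<omega> (N + m)) N" and ?X2 = "X2 (nint s \<omega> (N + m)) N"
  have eq: "lin (normal (nint s \<omega> (N + m)) N) s
      = lin w1 s * (of_real \<omega> * lin w2 s - ?X2) - lin w2 s * (of_real \<omega> * lin w1 s - ?X1)"
    unfolding lin_normal by (simp add: algebra_simps)
  have "cmod (lin (normal (nint s \<omega> (N + m)) N) s) \<le> cmod (lin w1 s) * cmod (of_real \<omega> * lin w2 s - ?X2)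
      + cmod (lin w2 s) * cmod (of_real \<omega> * lin w1 s - ?X1)"
    unfolding eq norm_mult[symmetric] by (rule norm_triangle_ineq4)
  also have "\<dots> \<le> \<Lambda> * (c0 / \<beta> ^ N) + \<Lambda> * (c0 / \<beta> ^ N)"
    by (intro add_mono mult_mono cmod_lin_le[OF assms] X_near less_imp_le[OF \<Lambda>_pos] norm_ge_zero)
  finally show ?thesis by (simp only: mult.assoc mult_2 distrib_right)
qed

text \<open>Cramer's rule: combining the entries \<open>i1\<close> and \<open>i2\<close> with
  coefficients from \<open>w1\<close> eliminates \<open>X2\<close> and leaves \<open>X1\<close>
  times the minor of modulus \<open>D0\<close>.\<close>

lemma normal_lower:
  "\<exists>j<m. cmod (X1 L N) * D0 / (2 * \<Lambda>) \<le> cmod (normal L N j)"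
proof (rule ccontr)
  assume "\<not> ?thesis"
  then have lt: "cmod (normal L N j) < cmod (X1 L N) * D0 / (2 * \<Lambda>)" if "j < m" for j
    using that by (simp add: not_le)
  have le: "cmod (normal L N j * w1 i) \<le> cmod (normal L N j) * \<Lambda>" if "i < m" for i j
    unfolding norm_mult by (intro mult_left_mono w_le that) auto
  have "X1 L N * (w1 i1 * w2 i2 - w1 i2 * w2 i1) = normal L N i2 * w1 i1 - normal L N i1 * w1 i2"
    by (simp add: normal_def algebra_simps)
  then have "cmod (X1 L N) * D0 \<le> cmod (normal L N i2 * w1 i1) + cmod (normal L N i1 * w1 i2)"
    unfolding D0_def norm_mult[symmetric] by (metis norm_triangle_ineq4)
  also have "\<dots> \<le> cmod (normal L N i2) * \<Lambda> + cmod (normal L N i1) * \<Lambda>"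
    using le i12 by (intro add_mono) auto
  also have "\<dots> < cmod (X1 L N) * D0 / (2 * \<Lambda>) * \<Lambda> + cmod (X1 L N) * D0 / (2 * \<Lambda>) * \<Lambda>"
    using lt i12 \<Lambda>_pos by (intro add_strict_mono mult_strict_right_mono) auto
  also have "\<dots> = cmod (X1 L N) * D0"
    using \<Lambda>_pos by (simp add: field_simps)
  finally show False by simp
qed

section \<open>Choice of the constants, and the exceptional sets\<close>

definition b :: real where "b = ln \<beta>"
text \<open>The budget of exponential rates: strips shrink like \<open>exp (- b * n)\<close>. The
  initial values of the candidates cost \<open>\<eta> * m\<close> and the lower bound for
  \<open>X1\<close> costs \<open>2 * \<eta>\<close>, together \<open>b / 4\<close>; the count of
  defects costs \<open>b / 4\<close> through \<open>\<delta>\<close> and another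
  \<open>b / 4\<close> through \<open>t0\<close>. What remains is \<open>exp (- b / 4 * n)\<close>.
  In \<open>\<delta>\<close> the term \<open>1 - ln t0\<close> replaces \<open>- ln t0\<close>,
  which is zero when \<open>t0 = 1\<close>.\<close>

definition \<eta> :: real where "\<eta> = b / (4 * (real m + 2))"
definition t0 :: real where "t0 = min 1 (b / (8 * of_int H))"
definition \<delta> :: real where "\<delta> = b / (4 * (real m + 1) * (1 - ln t0))"

text \<open>The domain keeps the form \<open>n - m + m\<close> of the counting lemma; it is
  \<open>{..<n}\<close> once \<open>m \<le> n\<close>.\<close>

definition candidates :: "nat \<Rightarrow> (nat \<Rightarrow> int) set" where
  "candidates n = {L \<in> {..<n - m + m} \<rightarrow>\<^sub>E UNIV. (\<forall>i<m. \<bar>L i\<bar> \<le> \<lceil>A0 * exp (\<eta> * n) + 1\<rceil>)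
    \<and> (\<forall>k<n - m. \<bar>shift_poly p L k\<bar> \<le> H)
    \<and> real (card {k. k < n - m \<and> shift_poly p L k \<noteq> 0}) \<le> (real m + 1) * (\<delta> * n)}"

text \<open>The first strip removes the \<open>s\<close> with small first projection, for which
  \<open>X1\<close> could be too small to keep the normal vector away from zero. The set does not
  involve \<open>\<omega>\<close>.\<close>

definition exceptional :: "nat \<Rightarrow> (nat \<Rightarrow> real) set" where
  "exceptional n = simplex_strip m w1 (exp (- \<eta> * n)) \<union>
    (\<Union>L\<in>{L \<in> candidates n. exp (- 2 * \<eta> * n) / 2 \<le> cmod (X1 L (n - m))}.
      simplex_strip m (normal L (n - m)) (2 * \<Lambda> * (c0 / \<beta> ^ (n - m))))"

lemma b_pos: "0 < b" and \<eta>_pos: "0 < \<eta>"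
  using beta_gt_1(1) by (simp_all add: b_def \<eta>_def)

lemma t0_bounds: "0 < t0" "t0 \<le> 1" "8 * of_int H * t0 \<le> b"
proof -
  have H: "0 < real_of_int H" using H_pos by linarith
  show "0 < t0" "t0 \<le> 1"
    using b_pos H by (auto simp: t0_def)
  have "t0 \<le> b / (8 * of_int H)" by (simp add: t0_def)
  then show "8 * of_int H * t0 \<le> b"
    using H by (simp add: field_simps)
qed

lemma delta_bounds: "0 < \<delta>" "(real m + 1) * \<delta> * (- ln t0) \<le> b / 4"
proof -
  have l: "0 \<le> - ln t0" using t0_bounds by (simp add: ln_le_zero_iff)
  then show "0 < \<delta>"
    using b_pos by (simp add: \<delta>_def)
  define u where "u = 1 - ln t0"
  have u: "0 < u" "- ln t0 \<le> u" using l by (auto simp: u_def)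
  have "(real m + 1) * \<delta> = b / (4 * u)"
  proof -
    define M where "M = real m + 1"
    have "0 < M" by (simp add: M_def)
    then have "M * (b / (4 * M * u)) = b / (4 * u)" by simp
    then show ?thesis by (simp only: \<delta>_def u_def M_def)
  qed
  then have "(real m + 1) * \<delta> * (- ln t0) \<le> b / (4 * u) * u"
    using l u b_pos by (simp only:) (intro mult_left_mono, auto)
  also have "\<dots> = b / 4"
    using u(1) by simp
  finally show "(real m + 1) * \<delta> * (- ln t0) \<le> b / 4" .
qed

lemma exp_b: "exp (b * real n) = \<beta> ^ n"
  using beta_gt_1(1) by (simp add: b_def exp_of_nat2_mult)

lemma few_bad_imp_exceptional:
  assumes s: "s \<in> open_simplex m" and n: "m \<le> n" "c0 / \<beta> ^ (n - m) \<le> exp (- 2 * \<eta> * n) / 2"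
    and \<omega>: "exp (- \<eta> * n) \<le> \<bar>\<omega>\<bar>" "\<bar>\<omega>\<bar> \<le> exp (\<eta> * n)"
    and few: "real (card {k. k < n \<and> bad s \<omega> k}) \<le> \<delta> * n"
  shows "s \<in> exceptional n"
proof (cases "cmod (lin w1 s) \<le> exp (- \<eta> * n)")
  case True
  then show ?thesis
    using s by (simp add: exceptional_def simplex_strip_def lin_def)
next
  case False
  define N where "N = n - m"
  have nN: "n = N + m" using n by (simp add: N_def)
  let ?L = "nint s \<omega> (N + m)"
  have "?L \<in> candidates n"
    unfolding candidates_def N_def[symmetric]
  proof (intro CollectI conjI allI impI)
    show "?L \<in> {..<N + m} \<rightarrow>\<^sub>E UNIV"
      by (auto simp: nint_def)
  next
    fix i assume i: "i < m"
    have "\<bar>real_of_int (?L i)\<bar> \<le> \<bar>\<omega>\<bar> * A0 + 1"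
      using s i by (intro nint_initial) auto
    also have "\<dots> \<le> exp (\<eta> * n) * A0 + 1"
      using \<omega>(2) A0_nonneg by (simp add: mult_right_mono)
    also have "\<dots> \<le> of_int \<lceil>A0 * exp (\<eta> * n) + 1\<rceil>"
      unfolding mult.commute[of A0] by (rule le_of_int_ceiling)
    finally show "\<bar>?L i\<bar> \<le> \<lceil>A0 * exp (\<eta> * n) + 1\<rceil>"
      by linarith
  next
    fix k assume "k < N"
    then show "\<bar>shift_poly p ?L k\<bar> \<le> H"
      by (rule shift_poly_nint)
  next
    have "real (card {k. k < N \<and> shift_poly p ?L k \<noteq> 0}) \<le> (real m + 1) * real (card {k. k < n \<and> bad s \<omega> k})"
      using of_nat_mono[OF card_defects_le[of N s \<omega>], where 'a = real] by (simp add: nN algebra_simps)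
    also have "\<dots> \<le> (real m + 1) * (\<delta> * n)"
      using few by (intro mult_left_mono) auto
    finally show "real (card {k. k < N \<and> shift_poly p ?L k \<noteq> 0}) \<le> (real m + 1) * (\<delta> * n)" .
  qed
  \<comment> \<open>One factor \<open>exp (- \<eta> * n)\<close> comes from \<open>\<omega>\<close>,
    the other from \<open>s\<close> being off the first strip; half of the product absorbs the
    rounding error.\<close>
  moreover have "exp (- 2 * \<eta> * n) / 2 \<le> cmod (X1 ?L N)"
  proof -
    have "exp (- 2 * \<eta> * n) = exp (- \<eta> * n) * exp (- \<eta> * n)"
      by (simp flip: exp_add)
    also have "\<dots> \<le> \<bar>\<omega>\<bar> * cmod (lin w1 s)"
      using \<omega>(1) False by (intro mult_mono) auto
    also have "\<dots> = cmod (of_real \<omega> * lin w1 s)"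
      by (simp add: norm_mult)
    also have "\<dots> \<le> cmod (X1 ?L N) + cmod (of_real \<omega> * lin w1 s - X1 ?L N)"
      by (metis add.commute norm_triangle_sub)
    also have "cmod (of_real \<omega> * lin w1 s - X1 ?L N) \<le> exp (- 2 * \<eta> * n) / 2"
      using order_trans[OF X_near(1)[of \<omega> s N]] n(2) by (simp only: N_def)
    finally show ?thesis by simp
  qed
  moreover have "s \<in> simplex_strip m (normal ?L N) (2 * \<Lambda> * (c0 / \<beta> ^ N))"
    using s cmod_lin_normal_le[OF s, of \<omega> N] by (simp add: simplex_strip_def lin_def)
  ultimately show ?thesis
    unfolding exceptional_def N_def[symmetric] by blast
qed

lemma candidates_card:
  "finite (candidates n)"
  "real (card (candidates n)) \<le> (2 * A0 + 5) ^ m * exp (\<eta> * m * n + b / 2 * n)"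
proof -
  let ?M = "\<lceil>A0 * exp (\<eta> * n) + 1\<rceil>"
  let ?j = "(real m + 1) * (\<delta> * n)"
  have M: "0 \<le> ?M"
  proof -
    have "0 \<le> A0 * exp (\<eta> * n)"
      using A0_nonneg by simp
    then show ?thesis by linarith
  qed
  have H: "0 \<le> H" using H_pos by simp
  note card = card_approximate_recurrences_le[OF p H M t0_bounds(1,2), of "n - m" ?j, folded candidates_def]
  show "finite (candidates n)"
    by (rule card(1))
  have "2 * real_of_int ?M + 1 \<le> 2 * (A0 * exp (\<eta> * n) + 2) + 1"
    using of_int_ceiling_le_add_one[of "A0 * exp (\<eta> * n) + 1"] by simp
  also have "\<dots> \<le> (2 * A0 + 5) * exp (\<eta> * n)"
    using \<eta>_pos by (simp add: algebra_simps)
  finally have "(2 * real_of_int ?M + 1) ^ m \<le> ((2 * A0 + 5) * exp (\<eta> * n)) ^ m"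
    using M by (intro power_mono) auto
  also have "\<dots> = (2 * A0 + 5) ^ m * exp (\<eta> * m * n)"
    by (simp add: power_mult_distrib exp_of_nat_mult[symmetric] mult_ac)
  finally have 1: "(2 * real_of_int ?M + 1) ^ m \<le> (2 * A0 + 5) ^ m * exp (\<eta> * m * n)" .
  have "t0 powr (- ?j) = exp ((real m + 1) * \<delta> * (- ln t0) * n)"
    using t0_bounds(1) by (simp add: powr_def mult_ac)
  also have "\<dots> \<le> exp (b / 4 * n)"
    using delta_bounds(2) by (simp only: exp_le_cancel_iff mult_right_mono of_nat_0_le_iff)
  finally have 2: "t0 powr (- ?j) \<le> exp (b / 4 * n)" .
  have "(1 + 2 * of_int H * t0) ^ (n - m) \<le> exp (2 * of_int H * t0) ^ (n - m)"
    using H t0_bounds by (intro power_mono exp_ge_add_one_self) auto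
  also have "\<dots> = exp (2 * of_int H * t0 * real (n - m))"
    by (simp add: exp_of_nat2_mult)
  also have "\<dots> \<le> exp (b / 4 * n)"
    unfolding exp_le_cancel_iff using t0_bounds H b_pos by (intro mult_mono) auto
  finally have 3: "(1 + 2 * of_int H * t0) ^ (n - m) \<le> exp (b / 4 * n)" .
  have "real (card (candidates n)) \<le> (2 * of_int ?M + 1) ^ m * (t0 powr (- ?j) * (1 + 2 * of_int H * t0) ^ (n - m))"
    by (rule card(2))
  also have "\<dots> \<le> ((2 * A0 + 5) ^ m * exp (\<eta> * m * n)) * (exp (b / 4 * n) * exp (b / 4 * n))"
    using 1 2 3 H t0_bounds M A0_nonneg by (intro mult_mono) auto
  also have "\<dots> = (2 * A0 + 5) ^ m * exp (\<eta> * m * n + b / 2 * n)"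
    by (simp add: exp_add[symmetric] algebra_simps)
  finally show "real (card (candidates n)) \<le> (2 * A0 + 5) ^ m * exp (\<eta> * m * n + b / 2 * n)" .
qed

text \<open>The factors come from the initial values of the candidates, from the measure of one
  strip, and from taking the strips at level \<open>n - m\<close> instead of
  \<open>n\<close>.\<close>

definition C2 :: real where
  "C2 = (2 * A0 + 5) ^ m * (128 * \<Lambda>\<^sup>2 * c0 / D0) * \<beta> ^ m"

lemma C2_nonneg: "0 \<le> C2"
  unfolding C2_def using A0_nonneg c0_nonneg D0_pos beta_gt_1(1) by simp

lemma exceptional_sets: "exceptional n \<in> sets (simplex_lebesgue m)"
  unfolding exceptional_def
  by (intro sets.Un sets.finite_UN simplex_strip_sets) (auto intro: finite_subset[OF _ candidates_card(1)])

lemma emeasure_normal_strip_le: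
  assumes "exp (- 2 * \<eta> * n) / 2 \<le> cmod (X1 L N)"
  shows "emeasure (simplex_lebesgue m) (simplex_strip m (normal L N) (2 * \<Lambda> * (c0 / \<beta> ^ N)))
    \<le> ennreal (128 * \<Lambda>\<^sup>2 * c0 / D0 / \<beta> ^ N * exp (2 * \<eta> * n))"
proof -
  obtain j where j: "j < m" "cmod (X1 L N) * D0 / (2 * \<Lambda>) \<le> cmod (normal L N j)"
    using normal_lower by blast
  let ?\<kappa> = "exp (- 2 * \<eta> * n) / 2 * D0 / (2 * \<Lambda>)"
  have "?\<kappa> \<le> cmod (X1 L N) * D0 / (2 * \<Lambda>)"
    using assms \<Lambda>_pos D0_pos by (intro divide_right_mono mult_right_mono) auto
  then have "emeasure (simplex_lebesgue m) (simplex_strip m (normal L N) (2 * \<Lambda> * (c0 / \<beta> ^ N)))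
    \<le> ennreal (16 * (2 * \<Lambda> * (c0 / \<beta> ^ N)) / ?\<kappa>)"
    using j \<Lambda>_pos D0_pos c0_nonneg beta_gt_1(1) by (intro emeasure_simplex_strip_le[of j]) auto
  also have "16 * (2 * \<Lambda> * (c0 / \<beta> ^ N)) / ?\<kappa> = 128 * \<Lambda>\<^sup>2 * c0 / D0 / \<beta> ^ N * exp (2 * \<eta> * n)"
    using \<Lambda>_pos D0_pos beta_gt_1(1) by (simp add: exp_minus field_simps power2_eq_square)
  finally show ?thesis .
qed

lemma emeasure_exceptional_le:
  obtains C1 where "0 \<le> C1"
    "\<And>n. m \<le> n \<Longrightarrow> emeasure (simplex_lebesgue m) (exceptional n)
      \<le> ennreal (C1 * exp (- \<eta> * n) + C2 * exp (- b / 4 * n))"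
proof -
  obtain j where j: "j < m" "w1 j \<noteq> 0"
    using exists_w1 by blast
  define C1 where "C1 = 16 / cmod (w1 j)"
  have "emeasure (simplex_lebesgue m) (exceptional n) \<le> ennreal (C1 * exp (- \<eta> * n) + C2 * exp (- b / 4 * n))"
    if n: "m \<le> n" for n
  proof -
    define N where "N = n - m"
    define r where "r = 128 * \<Lambda>\<^sup>2 * c0 / D0 / \<beta> ^ N * exp (2 * \<eta> * n)"
    have r0: "0 \<le> r"
      unfolding r_def using c0_nonneg D0_pos beta_gt_1(1) by simp
    let ?I = "{L \<in> candidates n. exp (- 2 * \<eta> * n) / 2 \<le> cmod (X1 L (n - m))}"
    let ?S = "\<lambda>L. simplex_strip m (normal L (n - m)) (2 * \<Lambda> * (c0 / \<beta> ^ (n - m)))"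
    have fin: "finite ?I"
      by (rule finite_subset[OF _ candidates_card(1)]) auto
    have "emeasure (simplex_lebesgue m) (\<Union>L\<in>?I. ?S L) \<le> (\<Sum>L\<in>?I. emeasure (simplex_lebesgue m) (?S L))"
      by (rule emeasure_subadditive_finite[OF fin]) (auto intro: simplex_strip_sets)
    also have "\<dots> \<le> (\<Sum>L\<in>?I. ennreal r)"
      unfolding r_def N_def by (rule sum_mono) (use emeasure_normal_strip_le in blast)
    also have "\<dots> = ennreal (real (card ?I) * r)"
      using r0 by (simp add: ennreal_mult' ennreal_of_nat_eq_real_of_nat)
    also have "\<dots> \<le> ennreal (C2 * exp (- b / 4 * n))"
    proof (rule ennreal_leI)
      have "real (card ?I) \<le> real (card (candidates n))"
        by (intro of_nat_mono card_mono candidates_card) auto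
      also have "\<dots> \<le> (2 * A0 + 5) ^ m * exp (\<eta> * m * n + b / 2 * n)"
        by (rule candidates_card)
      finally have "real (card ?I) * r \<le> (2 * A0 + 5) ^ m * exp (\<eta> * m * n + b / 2 * n) * r"
        using r0 by (rule mult_right_mono)
      also have "\<dots> = C2 * exp (- b / 4 * n)"
      proof -
        have "\<beta> ^ n = \<beta> ^ N * \<beta> ^ m"
          using n by (simp add: N_def flip: power_add)
        then have "1 / \<beta> ^ N = \<beta> ^ m * exp (- b * n)"
          using beta_gt_1(1) exp_b[of n] by (simp add: exp_minus field_simps)
        then have "r = 128 * \<Lambda>\<^sup>2 * c0 / D0 * (\<beta> ^ m * exp (- b * n)) * exp (2 * \<eta> * n)"
          unfolding r_def by (metis divide_inverse inverse_eq_divide)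
        then have "(2 * A0 + 5) ^ m * exp (\<eta> * m * n + b / 2 * n) * r
            = C2 * (exp (\<eta> * m * n + b / 2 * n) * (exp (- b * n) * exp (2 * \<eta> * n)))"
          by (simp only: C2_def mult_ac)
        also have "exp (\<eta> * m * n + b / 2 * n) * (exp (- b * n) * exp (2 * \<eta> * n))
            = exp ((\<eta> * (real m + 2) - b / 2) * n)"
          by (simp add: algebra_simps flip: exp_add)
        also have "\<eta> * (real m + 2) - b / 2 = - b / 4"
          by (simp add: \<eta>_def field_simps)
        finally show ?thesis .
      qed
      finally show "real (card ?I) * r \<le> C2 * exp (- b / 4 * n)" .
    qed
    finally have 1: "emeasure (simplex_lebesgue m) (\<Union>L\<in>?I. ?S L) \<le> ennreal (C2 * exp (- b / 4 * n))" .
    have "emeasure (simplex_lebesgue m) (simplex_strip m w1 (exp (- \<eta> * n))) \<le> ennreal (16 * exp (- \<eta> * n) / cmod (w1 j))"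
      using j by (intro emeasure_simplex_strip_le) auto
    then have 2: "emeasure (simplex_lebesgue m) (simplex_strip m w1 (exp (- \<eta> * n))) \<le> ennreal (C1 * exp (- \<eta> * n))"
      by (simp add: C1_def)
    have "emeasure (simplex_lebesgue m) (exceptional n)
        \<le> emeasure (simplex_lebesgue m) (simplex_strip m w1 (exp (- \<eta> * n))) + emeasure (simplex_lebesgue m) (\<Union>L\<in>?I. ?S L)"
      unfolding exceptional_def using fin by (intro emeasure_subadditive simplex_strip_sets sets.finite_UN)
    also have "\<dots> \<le> ennreal (C1 * exp (- \<eta> * n)) + ennreal (C2 * exp (- b / 4 * n))"
      by (intro add_mono 1 2)
    also have "\<dots> = ennreal (C1 * exp (- \<eta> * n) + C2 * exp (- b / 4 * n))"
      using C2_nonneg by (intro ennreal_plus[symmetric]) (auto simp: C1_def)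
    finally show ?thesis .
  qed
  then show thesis
    by (intro that[of C1]) (auto simp: C1_def)
qed

text \<open>Borel-Cantelli. As the exceptional sets are free of \<open>\<omega>\<close>, one null
  set of \<open>s\<close> serves all frequencies in the growing windows at once.\<close>

lemma AE_many_bad:
  "AE s in simplex_lebesgue m. \<exists>n0. \<forall>n::nat\<ge>n0. \<forall>\<omega>. exp (- \<eta> * n) \<le> \<bar>\<omega>\<bar> \<and> \<bar>\<omega>\<bar> \<le> exp (\<eta> * n) \<longrightarrow>
    \<delta> * n \<le> card {k. k < n \<and> bad s \<omega> k}"
proof -
  obtain C1 where C1: "0 \<le> C1" "\<And>n. m \<le> n \<Longrightarrow> emeasure (simplex_lebesgue m) (exceptional n)
      \<le> ennreal (C1 * exp (- \<eta> * n) + C2 * exp (- b / 4 * n))"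
    by (rule emeasure_exceptional_le) blast
  let ?f = "\<lambda>n::nat. C1 * exp (- \<eta> * n) + C2 * exp (- b / 4 * n)"
  have geo: "summable (\<lambda>n::nat. exp (- x * n))" if "0 < x" for x :: real
  proof -
    have "summable (\<lambda>n::nat. exp (- x) ^ n)"
      using that by (intro summable_geometric) auto
    then show ?thesis
      by (simp add: exp_of_nat2_mult[symmetric])
  qed
  have "summable ?f"
    using geo[OF \<eta>_pos] geo[of "b / 4"] b_pos by (intro summable_add summable_mult) auto
  \<comment> \<open>The bounds on the exceptional sets hold from \<open>n = m\<close> on, hence the
    shifted index.\<close>
  then have sum: "summable (\<lambda>n. measure (simplex_lebesgue m) (exceptional (n + m)))"
  proof (rule summable_comparison_test_ev[rotated, OF summable_ignore_initial_segment[of _ m]])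
    have "measure (simplex_lebesgue m) (exceptional (n + m)) \<le> ?f (n + m)" for n
      unfolding measure_def using C1(1) C2_nonneg by (intro enn2real_leI C1(2)) auto
    then show "\<forall>\<^sub>F n in sequentially. norm (measure (simplex_lebesgue m) (exceptional (n + m))) \<le> ?f (n + m)"
      by simp
  qed
  have "AE s in simplex_lebesgue m. \<forall>\<^sub>F n in sequentially. s \<in> space (simplex_lebesgue m) - exceptional (n + m)"
  proof (rule borel_cantelli_AE1[OF exceptional_sets _ sum])
    fix n
    have "emeasure (simplex_lebesgue m) (exceptional (n + m)) \<le> ennreal (?f (n + m))"
      by (rule C1(2)) simp
    also have "\<dots> < \<infinity>" by simp
    finally show "emeasure (simplex_lebesgue m) (exceptional (n + m)) < \<infinity>" .
  qed
  then show ?thesis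
  proof eventually_elim
    case (elim s)
    then obtain n1 where n1: "\<And>n. n1 \<le> n \<Longrightarrow> s \<in> open_simplex m - exceptional (n + m)"
      unfolding eventually_sequentially space_simplex_lebesgue by blast
    \<comment> \<open>Since \<open>2 * \<eta> < b\<close>, the rounding error
      \<open>c0 / \<beta> ^ (n - m)\<close> eventually falls below half of
      \<open>exp (- 2 * \<eta> * n)\<close>.\<close>
    have "(\<lambda>n::nat. c0 * \<beta> ^ m * 2 * exp ((2 * \<eta> - b) * n)) \<longlonglongrightarrow> c0 * \<beta> ^ m * 2 * 0"
    proof (intro tendsto_intros)
      have "2 * \<eta> - b < 0"
      proof -
        have "\<eta> \<le> b / 8"
          unfolding \<eta>_def using b_pos by (intro divide_left_mono) auto
        then show ?thesis using b_pos by linarith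
      qed
      then have "summable (\<lambda>n::nat. exp (- (b - 2 * \<eta>) * n))"
        by (intro geo) simp
      then show "(\<lambda>n::nat. exp ((2 * \<eta> - b) * n)) \<longlonglongrightarrow> 0"
        using summable_LIMSEQ_zero by (simp add: algebra_simps)
    qed
    then have "\<forall>\<^sub>F n::nat in sequentially. c0 * \<beta> ^ m * 2 * exp ((2 * \<eta> - b) * n) < 1"
      by (rule order_tendstoD) simp
    then obtain n2 :: nat where n2: "\<And>n::nat. n2 \<le> n \<Longrightarrow> c0 * \<beta> ^ m * 2 * exp ((2 * \<eta> - b) * n) < 1"
      unfolding eventually_sequentially by blast
    have large: "c0 / \<beta> ^ (n - m) \<le> exp (- 2 * \<eta> * n) / 2" if "n2 \<le> n" "m \<le> n" for n :: nat
    proof -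
      have "\<beta> ^ n = \<beta> ^ (n - m) * \<beta> ^ m"
        using that by (simp flip: power_add)
      then have "c0 / \<beta> ^ (n - m) = c0 * \<beta> ^ m / exp (b * n)"
        using beta_gt_1(1) exp_b[of n] by (simp add: field_simps)
      also have "\<dots> = c0 * \<beta> ^ m * 2 * exp ((2 * \<eta> - b) * n) * (exp (- 2 * \<eta> * n) / 2)"
        by (simp add: exp_minus left_diff_distrib exp_diff field_simps)
      also have "\<dots> \<le> 1 * (exp (- 2 * \<eta> * n) / 2)"
        using n2[OF that(1)] by (intro mult_right_mono) auto
      finally show ?thesis by simp
    qed
    show ?case
    proof (intro exI[of _ "n1 + n2 + m"] allI impI)
      fix n :: nat and \<omega> :: real
      assume n: "n1 + n2 + m \<le> n" and \<omega>: "exp (- \<eta> * n) \<le> \<bar>\<omega>\<bar> \<and> \<bar>\<omega>\<bar> \<le> exp (\<eta> * n)"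
      show "\<delta> * n \<le> card {k. k < n \<and> bad s \<omega> k}"
      proof (rule ccontr)
        assume few: "\<not> ?thesis"
        have "n1 \<le> n - m" "n - m + m = n" using n by linarith+
        then have s: "s \<in> open_simplex m - exceptional n"
          using n1[of "n - m"] by simp
        moreover have "s \<in> exceptional n"
          using s n \<omega> few large[of n] by (intro few_bad_imp_exceptional) auto
        ultimately show False
          by simp
      qed
    qed
  qed
qed

end

section \<open>Exponential sums over words\<close>

text \<open>Each letter is twisted by the length of the prefix before it. With the Fourier
  coefficients of the single letters as \<open>c\<close>, this is the twisted integral over the
  whole word.\<close>

fun wsum :: "(nat \<Rightarrow> real) \<Rightarrow> real \<Rightarrow> (nat \<Rightarrow> complex) \<Rightarrow> nat list \<Rightarrow> complex" where
  "wsum s \<omega> c [] = 0"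
| "wsum s \<omega> c (a # w) = c a + cis (- (2 * pi * (\<omega> * s a))) * wsum s \<omega> c w"

definition wlen :: "(nat \<Rightarrow> real) \<Rightarrow> nat list \<Rightarrow> real" where
  "wlen s w = sum_list (map s w)"

lemma wlen_simps [simp]: "wlen s [] = 0" "wlen s (a # w) = s a + wlen s w" "wlen s (u @ v) = wlen s u + wlen s v"
  by (simp_all add: wlen_def)

lemma wsum_append: "wsum s \<omega> c (u @ v) = wsum s \<omega> c u + cis (- (2 * pi * (\<omega> * wlen s u))) * wsum s \<omega> c v"
proof (induction u)
  case (Cons a u)
  have "cis (- (2 * pi * (\<omega> * wlen s (a # u)))) = cis (- (2 * pi * (\<omega> * s a))) * cis (- (2 * pi * (\<omega> * wlen s u)))"
    by (simp add: cis_mult algebra_simps)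
  then show ?case
    using Cons by (simp add: algebra_simps)
qed simp

lemma norm_wsum_append_le: "cmod (wsum s \<omega> c (u @ v)) \<le> cmod (wsum s \<omega> c u) + cmod (wsum s \<omega> c v)"
  unfolding wsum_append by (rule order_trans[OF norm_triangle_ineq]) (simp add: norm_mult)

lemma norm_wsum_le:
  assumes "\<And>a. a \<in> set w \<Longrightarrow> cmod (c a) \<le> K"
  shows "cmod (wsum s \<omega> c w) \<le> K * length w"
  using assms
proof (induction w)
  case (Cons a w)
  have "cmod (wsum s \<omega> c (a # w)) \<le> cmod (c a) + cmod (wsum s \<omega> c w)"
    using norm_wsum_append_le[of s \<omega> c "[a]" w] by simp
  also have "\<dots> \<le> K + K * length w"
    using Cons by (intro add_mono) auto
  finally show ?case by (simp add: algebra_simps)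
qed simp

lemma wsum_0_conv_sum_list: "wsum s 0 c w = sum_list (map c w)"
  by (induction w) auto

lemma norm_wsum_prefix_le:
  fixes E K M :: real
  assumes "w @ q = concat bs"
    and "\<And>b. b \<in> set bs \<Longrightarrow> real (length b) \<le> M \<and> cmod (wsum s \<omega> c b) \<le> E * length b"
    and "\<And>a. a \<in> set (concat bs) \<Longrightarrow> cmod (c a) \<le> K" and "0 \<le> K" "0 \<le> E" "0 \<le> M"
  shows "cmod (wsum s \<omega> c w) \<le> E * length w + K * M"
  using assms(1-3)
proof (induction bs arbitrary: w)
  case Nil
  then show ?case using assms(4-) by simp
next
  case (Cons b bs)
  from Cons.prems(1) consider u where "w = b @ u" "u @ q = concat bs" | u where "b = w @ u"
    by (auto simp: append_eq_append_conv2)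
  then show ?case
  proof cases
    case 1
    have "cmod (wsum s \<omega> c u) \<le> E * length u + K * M"
      using 1(2) Cons.prems(2,3) by (intro Cons.IH) auto
    moreover have "cmod (wsum s \<omega> c b) \<le> E * length b"
      using Cons.prems(2) by simp
    ultimately show ?thesis
      using norm_wsum_append_le[of s \<omega> c b u] by (simp add: 1 algebra_simps)
  next
    case 2
    have "cmod (wsum s \<omega> c w) \<le> K * length w"
      using Cons.prems(3) 2 by (intro norm_wsum_le) auto
    also have "\<dots> \<le> K * M"
      using Cons.prems(2)[of b] 2 assms(4) by (intro mult_left_mono) auto
    finally show ?thesis
      using assms(5) by (simp add: add_increasing)
  qed
qed

text \<open>A factor of a concatenation consists of complete blocks, where the block estimate
  applies, and at most one incomplete block at each end, estimated trivially.\<close>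

lemma norm_wsum_factor_le:
  fixes E K M :: real
  assumes "p @ w @ q = concat bs"
    and "\<And>b. b \<in> set bs \<Longrightarrow> real (length b) \<le> M \<and> cmod (wsum s \<omega> c b) \<le> E * length b"
    and "\<And>a. a \<in> set (concat bs) \<Longrightarrow> cmod (c a) \<le> K" and "0 \<le> K" "0 \<le> E" "0 \<le> M"
  shows "cmod (wsum s \<omega> c w) \<le> E * length w + 2 * K * M"
  using assms(1-3)
proof (induction bs arbitrary: p)
  case Nil
  then show ?case using assms(4-) by simp
next
  case (Cons b bs)
  from Cons.prems(1) consider u where "p = b @ u" "u @ w @ q = concat bs"
    | u where "b = p @ u" "w @ q = u @ concat bs"
    by (auto simp: append_eq_append_conv2)
  then show ?case
  proof cases
    case 1
    show ?thesis
      using Cons.prems(2,3) by (intro Cons.IH[OF 1(2)]) auto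
  next
    case 2
    have short: "cmod (wsum s \<omega> c v) \<le> K * M" if "set v \<subseteq> set b" "length v \<le> length b" for v
    proof -
      have "cmod (wsum s \<omega> c v) \<le> K * length v"
        using Cons.prems(3) that by (intro norm_wsum_le) auto
      also have "\<dots> \<le> K * M"
        using Cons.prems(2)[of b] that(2) assms(4) by (intro mult_left_mono) auto
      finally show ?thesis .
    qed
    have KM: "0 \<le> K * M" using assms(4,6) by simp
    from 2(2) consider v where "w = u @ v" "v @ q = concat bs" | v where "u = w @ v"
      by (auto simp: append_eq_append_conv2)
    then show ?thesis
    proof cases
      case a: 1
      have "cmod (wsum s \<omega> c v) \<le> E * length v + K * M"
        using Cons.prems(2,3) assms(4-) by (intro norm_wsum_prefix_le[OF a(2)]) auto
      moreover have "cmod (wsum s \<omega> c u) \<le> K * M"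
        by (rule short) (auto simp: 2)
      ultimately have "cmod (wsum s \<omega> c w) \<le> E * length v + 2 * K * M"
        using norm_wsum_append_le[of s \<omega> c u v] by (simp add: a(1))
      also have "\<dots> \<le> E * length w + 2 * K * M"
        using assms(5) by (simp add: a(1) mult_left_mono)
      finally show ?thesis .
    next
      case b: 2
      have "cmod (wsum s \<omega> c w) \<le> K * M"
        by (rule short) (auto simp: 2 b)
      then show ?thesis
        using KM mult_nonneg_nonneg[OF assms(5), of "length w"] by simp
    qed
  qed
qed

lemma norm_cis_diff_le: "cmod (cis x - 1) \<le> \<bar>x\<bar>"
proof -
  have "(cmod (cis x - 1))\<^sup>2 = (cos x - 1)\<^sup>2 + (sin x)\<^sup>2"
    by (simp add: cmod_power2)
  also have "\<dots> = 4 * (sin (x / 2))\<^sup>2"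
    using cos_double_sin[of "x / 2"] sin_cos_squared_add[of x] by (simp add: power2_eq_square algebra_simps)
  finally have "(cmod (cis x - 1))\<^sup>2 = (2 * \<bar>sin (x / 2)\<bar>)\<^sup>2"
    by (simp add: power_mult_distrib)
  then have "cmod (cis x - 1) = 2 * \<bar>sin (x / 2)\<bar>"
    by (rule power2_eq_imp_eq) auto
  also have "\<dots> \<le> \<bar>x\<bar>"
    using abs_sin_x_le_abs_x[of "x / 2"] by simp
  finally show ?thesis .
qed

text \<open>The twist of a letter differs from \<open>1\<close> by at most
  \<open>2 * pi * \<bar>\<omega>\<bar>\<close> times the preceding length, so the comparison with
  frequency \<open>0\<close> is useful for words much shorter than
  \<open>1 / \<bar>\<omega>\<bar>\<close>.\<close>

lemma norm_wsum_frequency_diff_le: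
  assumes "\<And>a. a \<in> set w \<Longrightarrow> cmod (c a) \<le> K \<and> cmod (c a - c' a) \<le> \<epsilon> \<and> 0 \<le> s a \<and> s a \<le> 1"
    and "0 \<le> K"
  shows "cmod (wsum s \<omega> c w - wsum s 0 c' w) \<le> length w * (\<epsilon> + 2 * pi * \<bar>\<omega>\<bar> * K * length w)"
  using assms(1)
proof (induction w)
  case (Cons a w)
  define r where "r = 2 * pi * \<bar>\<omega>\<bar> * K"
  have r: "0 \<le> r" using assms(2) by (simp add: r_def)
  let ?X = "(cis (- (2 * pi * (\<omega> * s a))) - 1) * wsum s \<omega> c w"
  let ?Y = "wsum s \<omega> c w - wsum s 0 c' w"
  have "wsum s \<omega> c (a # w) - wsum s 0 c' (a # w) = (c a - c' a) + (?X + ?Y)"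
    by (simp add: algebra_simps)
  then have "cmod (wsum s \<omega> c (a # w) - wsum s 0 c' (a # w)) \<le> cmod (c a - c' a)
      + (cmod (cis (- (2 * pi * (\<omega> * s a))) - 1) * cmod (wsum s \<omega> c w) + cmod ?Y)"
    using norm_triangle_ineq[of "c a - c' a" "?X + ?Y"] norm_triangle_ineq[of ?X ?Y]
    by (simp only: norm_mult[symmetric])
  also have "\<dots> \<le> \<epsilon> + ((2 * pi * \<bar>\<omega>\<bar>) * (K * length w) + length w * (\<epsilon> + r * length w))"
  proof (intro add_mono mult_mono)
    have "cmod (cis (- (2 * pi * (\<omega> * s a))) - 1) \<le> \<bar>2 * pi * (\<omega> * s a)\<bar>"
      using norm_cis_diff_le[of "- (2 * pi * (\<omega> * s a))"] by simp
    also have "\<dots> \<le> 2 * pi * \<bar>\<omega>\<bar>"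
      using Cons.prems[of a] by (simp add: abs_mult mult_left_le)
    finally show "cmod (cis (- (2 * pi * (\<omega> * s a))) - 1) \<le> 2 * pi * \<bar>\<omega>\<bar>" .
    show "cmod (wsum s \<omega> c w) \<le> K * length w"
      using Cons.prems by (intro norm_wsum_le) auto
  qed (use Cons in \<open>auto simp: r_def\<close>)
  also have "\<dots> = \<epsilon> + (r * length w + length w * (\<epsilon> + r * length w))"
    by (simp add: r_def)
  also have "\<dots> \<le> length (a # w) * (\<epsilon> + r * length (a # w))"
    using r mult_nonneg_nonneg[OF r, of "length w"] by (simp add: algebra_simps)
  finally show ?case by (simp add: r_def)
qed simp

section \<open>Substitution words\<close>

lemma subst_word_append [simp]: "subst_word \<zeta> (u @ v) = subst_word \<zeta> u @ subst_word \<zeta> v"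
  and subst_word_Nil [simp]: "subst_word \<zeta> [] = []"
  by (simp_all add: subst_word_def)

abbreviation iter_word :: "(nat \<Rightarrow> nat list) \<Rightarrow> nat \<Rightarrow> nat list \<Rightarrow> nat list" where
  "iter_word \<zeta> k \<equiv> subst_word \<zeta> ^^ k"

lemma iter_word_append [simp]: "iter_word \<zeta> k (u @ v) = iter_word \<zeta> k u @ iter_word \<zeta> k v"
  by (induction k) auto

lemma iter_word_Nil [simp]: "iter_word \<zeta> k [] = []"
  by (induction k) auto

lemma iter_word_Cons: "iter_word \<zeta> k (a # w) = iter_word \<zeta> k [a] @ iter_word \<zeta> k w"
  using iter_word_append[of k \<zeta> "[a]" w] by simp

lemma iter_word_conv_concat: "iter_word \<zeta> k w = concat (map (\<lambda>a. iter_word \<zeta> k [a]) w)"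
proof (induction w)
  case (Cons a w)
  then show ?case by (subst iter_word_Cons) simp
qed simp

lemma iter_word_add: "iter_word \<zeta> (j + k) w = iter_word \<zeta> j (iter_word \<zeta> k w)"
  by (simp add: funpow_add)

locale primitive_substitution =
  fixes m :: nat and \<zeta> :: "nat \<Rightarrow> nat list"
  assumes subst: "substitution m \<zeta>" and prim: "primitive_subst m \<zeta>" and m2: "2 \<le> m"
begin

abbreviation Z :: "nat \<Rightarrow> nat list \<Rightarrow> nat list" where "Z \<equiv> iter_word \<zeta>"

text \<open>The entry \<open>2\<close> makes \<open>ln B\<close> positive, so that the powers of
  \<open>B\<close> can serve as a scale.\<close>

definition B :: nat where "B = Max (insert 2 ((\<lambda>a. length (\<zeta> a)) ` {..<m}))"

lemma B_ge_2: "2 \<le> B" and length_image_le: "a < m \<Longrightarrow> length (\<zeta> a) \<le> B"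
  unfolding B_def by (auto intro!: Max_ge)

lemma Z_set: "set w \<subseteq> {..<m} \<Longrightarrow> set (Z k w) \<subseteq> {..<m}"
proof (induction k)
  case (Suc k)
  then show ?case
    using subst by (auto simp: subst_word_def substitution_def subset_iff)
qed simp

lemma length_subst_word:
  assumes "set w \<subseteq> {..<m}"
  shows "length (subst_word \<zeta> w) \<le> B * length w" "length w \<le> length (subst_word \<zeta> w)"
  using assms
proof (induction w)
  case (Cons a w)
  { case 1
    then show ?case using Cons.IH(1) length_image_le[of a] by (simp add: subst_word_def)
  next
    case 2
    then have "\<zeta> a \<noteq> []" using subst by (auto simp: substitution_def)
    then show ?case using 2 Cons.IH(2) by (cases "\<zeta> a") (auto simp: subst_word_def)
  }
qed simp_all

lemma length_Z:
  assumes "set w \<subseteq> {..<m}"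
  shows "length (Z k w) \<le> B ^ k * length w" "length w \<le> length (Z k w)"
proof (induction k)
  case (Suc k)
  { case 1
    have "length (Z (Suc k) w) \<le> B * length (Z k w)"
      using length_subst_word(1)[OF Z_set[OF assms]] by simp
    also have "\<dots> \<le> B * (B ^ k * length w)"
      using Suc.IH(1) by (rule mult_le_mono2)
    finally show ?case by (simp add: mult_ac)
  next
    case 2
    show ?case
      using length_subst_word(2)[OF Z_set[OF assms], of k] Suc.IH(2) by simp
  }
qed simp_all

lemma length_Z_pos: "a < m \<Longrightarrow> 0 < length (Z k [a])"
  using length_Z(2)[of "[a]" k] by (cases "Z k [a]") auto

lemma length_Z_letter_le: "a < m \<Longrightarrow> length (Z k [a]) \<le> B ^ k"
  using length_Z(1)[of "[a]" k] by simp

lemma count_list_subst_word: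
  assumes "set w \<subseteq> {..<m}"
  shows "count_list (subst_word \<zeta> w) i = (\<Sum>j<m. count_list (\<zeta> j) i * count_list w j)"
  using assms
proof (induction w)
  case (Cons a w)
  have "(\<Sum>j<m. count_list (\<zeta> j) i * count_list (a # w) j)
      = (\<Sum>j<m. count_list (\<zeta> j) i * count_list w j + (if j = a then count_list (\<zeta> a) i else 0))"
    by (rule sum.cong) auto
  also have "\<dots> = (\<Sum>j<m. count_list (\<zeta> j) i * count_list w j) + count_list (\<zeta> a) i"
    using Cons.prems by (simp add: sum.distrib)
  finally show ?case
    using Cons by (simp add: subst_word_def)
qed simp

lemma subst_mat_carrier: "subst_mat m \<zeta> \<in> carrier_mat m m"
  by (simp add: subst_mat_def)

lemma count_list_Z_Suc:
  assumes "set w \<subseteq> {..<m}" "i < m"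
  shows "int (count_list (Z (Suc k) w) i) = (\<Sum>j<m. subst_mat m \<zeta> $$ (i, j) * int (count_list (Z k w) j))"
  using assms by (simp add: count_list_subst_word[OF Z_set[OF assms(1)]] subst_mat_def)

lemma subst_mat_pow:
  assumes "i < m" "j < m"
  shows "(subst_mat m \<zeta> ^\<^sub>m k) $$ (i, j) = int (count_list (Z k [j]) i)"
proof -
  let ?S = "subst_mat m \<zeta>"
  have "\<forall>i<m. \<forall>j<m. (?S ^\<^sub>m k) $$ (i, j) = int (count_list (Z k [j]) i)"
  proof (induction k)
    case 0
    then show ?case by (simp add: subst_mat_def)
  next
    case (Suc k)
    have comm: "?S ^\<^sub>m Suc k = ?S * ?S ^\<^sub>m k"
    proof (induction k)
      case (Suc k)
      have "?S ^\<^sub>m Suc (Suc k) = (?S * ?S ^\<^sub>m k) * ?S"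
        using Suc by simp
      also have "\<dots> = ?S * ?S ^\<^sub>m Suc k"
        using assoc_mult_mat[OF subst_mat_carrier pow_carrier_mat[OF subst_mat_carrier] subst_mat_carrier]
        by simp
      finally show ?case .
    qed (use subst_mat_carrier in simp)
    show ?case
    proof (intro allI impI)
      fix i j assume ij: "i < m" "j < m"
      have "(?S ^\<^sub>m Suc k) $$ (i, j) = (\<Sum>l<m. ?S $$ (i, l) * (?S ^\<^sub>m k) $$ (l, j))"
        unfolding comm using ij subst_mat_carrier pow_carrier_mat[OF subst_mat_carrier, of k]
        by (simp add: scalar_prod_def atLeast0LessThan)
      also have "\<dots> = (\<Sum>l<m. ?S $$ (i, l) * int (count_list (Z k [j]) l))"
        using Suc ij by (intro sum.cong) auto
      also have "\<dots> = int (count_list (Z (Suc k) [j]) i)"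
        using ij by (subst count_list_Z_Suc) auto
      finally show "(?S ^\<^sub>m Suc k) $$ (i, j) = int (count_list (Z (Suc k) [j]) i)" .
    qed
  qed
  then show ?thesis using assms by blast
qed

lemma mem_Z_trans: "b \<in> set w \<Longrightarrow> \<exists>p r. Z k w = p @ Z k [b] @ r"
  by (metis split_list iter_word_append iter_word_Cons)

text \<open>The return word is \<open>c # v\<close>.\<close>

lemma exists_return_word:
  obtains c v q where "c < m" "set v \<subseteq> {..<m}" "0 < q"
    "\<And>a. a < m \<Longrightarrow> \<exists>p r. Z q [a] = p @ c # v @ c # r"
    "\<And>a b. a < m \<Longrightarrow> b < m \<Longrightarrow> b \<in> set (Z q [a])"
proof -
  obtain k where k: "0 < k" "\<And>i j. i < m \<Longrightarrow> j < m \<Longrightarrow> 0 < (subst_mat m \<zeta> ^\<^sub>m k) $$ (i, j)"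
    using prim by (auto simp: primitive_subst_def)
  have all: "b \<in> set (Z k [a])" if "a < m" "b < m" for a b
    using k(2)[OF that(2,1)] subst_mat_pow[OF that(2,1), of k] count_list_0_iff[of "Z k [a]" b] by force
  have all2: "b \<in> set (Z (2 * k) [a])" if ab: "a < m" "b < m" for a b
  proof -
    obtain p r where "Z k (Z k [a]) = p @ Z k [a] @ r"
      using mem_Z_trans[OF all[OF ab(1) ab(1)]] by blast
    then show ?thesis
      using all[OF ab] iter_word_add[of k k \<zeta> "[a]"] by (simp add: mult_2)
  qed
  define w where "w = Z (2 * k) [0]"
  have wset: "set w \<subseteq> {..<m}"
    unfolding w_def using m2 by (intro Z_set) auto
  have "card {..<m} \<le> card (set (Z k [0]))"
    by (rule card_mono) (use all m2 in auto)
  then have lk: "m \<le> length (Z k [0])"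
    using card_length[of "Z k [0]"] by simp
  \<comment> \<open>The block \<open>Z k [a]\<close> of the first letter of \<open>Z k [0]\<close>
    already has at least \<open>m\<close> letters, and the nonempty image of the remaining letters
    follows; so \<open>w\<close> is longer than the alphabet.\<close>
  have "\<not> distinct w"
  proof
    assume "distinct w"
    then have "length w = card (set w)" by (simp add: distinct_card)
    also have "\<dots> \<le> m"
      using card_mono[OF _ wset] by simp
    finally have le: "length w \<le> m" .
    obtain a u where au: "Z k [0] = a # u"
      using lk m2 by (cases "Z k [0]") auto
    have u: "u \<noteq> []" using lk m2 au by auto
    have a: "a < m" using Z_set[of "[0]" k] m2 au by simp
    have uset: "set u \<subseteq> {..<m}"
      using Z_set[of "[0]" k] m2 by (simp add: au)
    have "w = Z k [a] @ Z k u"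
      unfolding w_def mult_2 iter_word_add au by (rule iter_word_Cons)
    moreover have "m \<le> length (Z k [a])"
    proof -
      have "card {..<m} \<le> card (set (Z k [a]))"
        by (rule card_mono) (use all a in auto)
      then show ?thesis using card_length[of "Z k [a]"] by simp
    qed
    moreover have "0 < length (Z k u)"
      using length_Z(2)[OF uset, of k] u by (cases u) auto
    moreover have "length w = length (Z k [a]) + length (Z k u)"
      using calculation(1) by simp
    ultimately show False
      using le by linarith
  qed
  then obtain xs ys zs c where w: "w = xs @ [c] @ ys @ [c] @ zs"
    using not_distinct_decomp by blast
  show thesis
  \<comment> \<open>Level \<open>3 * k\<close> leaves \<open>k\<close> steps to reach the letter
    \<open>0\<close> from any letter and \<open>2 * k\<close> steps to develop \<open>w\<close> from
    it.\<close>
  proof (rule that[of c ys "3 * k"])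
    show "c < m" "set ys \<subseteq> {..<m}" "0 < 3 * k"
      using wset k(1) by (auto simp: w)
    fix a assume a: "a < m"
    have 3: "Z (3 * k) [a] = Z (2 * k) (Z k [a])" "Z (3 * k) [a] = Z k (Z (2 * k) [a])"
      by (simp_all flip: iter_word_add)
    obtain p r where "Z (2 * k) (Z k [a]) = p @ Z (2 * k) [0] @ r"
      using mem_Z_trans[of 0 "Z k [a]"] all[OF a, of 0] m2 by fastforce
    then have "Z (3 * k) [a] = (p @ xs) @ c # ys @ c # (zs @ r)"
      using w by (simp add: 3(1) w_def)
    then show "\<exists>p r. Z (3 * k) [a] = p @ c # ys @ c # r" by blast
    fix b assume b: "b < m"
    obtain p r where "Z k (Z (2 * k) [a]) = p @ Z k [a] @ r"
      using mem_Z_trans[OF all2[OF a a]] by blast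
    then show "b \<in> set (Z (3 * k) [a])"
      using all[OF a b] by (simp add: 3(2))
  qed
qed

text \<open>Both lengths are compared with blocks of level \<open>k - q\<close>: all of them occur
  in \<open>Z k [c]\<close>, because \<open>Z q [c]\<close> contains every letter, and
  \<open>Z (k + q) [a]\<close> is made of at most \<open>B ^ (2 * q)\<close> of them. For
  \<open>k < q\<close> the bound \<open>B ^ (k + q)\<close> is enough.\<close>

lemma length_Z_comparable:
  assumes q: "\<And>a b. a < m \<Longrightarrow> b < m \<Longrightarrow> b \<in> set (Z q [a])" and "a < m" "c < m"
  shows "length (Z (k + q) [a]) \<le> B ^ (2 * q) * length (Z k [c])"
proof (cases "q \<le> k")
  case True
  have le: "length (Z (k - q) [b]) \<le> length (Z k [c])" if b: "b < m" for b
  proof -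
    have "Z k [c] = Z (k - q) (Z q [c])"
      using True by (simp flip: iter_word_add)
    then show ?thesis
      using mem_Z_trans[OF q[OF \<open>c < m\<close> b], of "k - q"] by auto
  qed
  have eq: "Z (k + q) [a] = Z (k - q) (Z (2 * q) [a])"
    using True by (simp add: add.commute flip: iter_word_add)
  have len: "length (Z (k - q) w) \<le> length w * length (Z k [c])" if "set w \<subseteq> {..<m}" for w
    using that
  proof (induction w)
    case (Cons b w)
    then show ?case
      using le[of b] by (subst iter_word_Cons) simp
  qed simp
  have "length (Z (k + q) [a]) \<le> length (Z (2 * q) [a]) * length (Z k [c])"
    unfolding eq using \<open>a < m\<close> by (intro len Z_set) auto
  also have "\<dots> \<le> B ^ (2 * q) * length (Z k [c])"
    using length_Z_letter_le[OF \<open>a < m\<close>] by (rule mult_le_mono1)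
  finally show ?thesis .
next
  case False
  have "length (Z (k + q) [a]) \<le> B ^ (k + q)"
    using \<open>a < m\<close> by (rule length_Z_letter_le)
  also have "\<dots> \<le> B ^ (2 * q)"
    using False B_ge_2 by (intro power_increasing) auto
  also have "\<dots> \<le> B ^ (2 * q) * length (Z k [c])"
    using mult_le_mono2[of 1 "length (Z k [c])" "B ^ (2 * q)"] length_Z_pos[OF \<open>c < m\<close>, of k] by linarith
  finally show ?thesis .
qed

lemma subst_space_letters: "x \<in> subst_space m \<zeta> \<Longrightarrow> x i < m"
proof -
  assume x: "x \<in> subst_space m \<zeta>"
  obtain k a where ka: "a < m" "sublist (map x [- int (nat \<bar>i\<bar>)..int (nat \<bar>i\<bar>)]) (Z k [a])"
    using x unfolding subst_space_def mem_Collect_eq by blast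
  have "x i \<in> set (map x [- int (nat \<bar>i\<bar>)..int (nat \<bar>i\<bar>)])"
    unfolding set_map by (rule imageI) (simp, linarith)
  also have "\<dots> \<subseteq> set (Z k [a])"
    using ka(2) by (rule set_mono_sublist)
  also have "\<dots> \<subseteq> {..<m}"
    using ka(1) by (intro Z_set) auto
  finally show "x i < m" by simp
qed

text \<open>A window of \<open>x\<close> occurs in some \<open>Z k [a]\<close>. For
  \<open>n \<le> k\<close> this word is a concatenation of blocks of level \<open>n\<close>; for
  smaller \<open>k\<close> it is so short that the window is short, too.\<close>

lemma subst_space_factor:
  assumes x: "x \<in> subst_space m \<zeta>"
  shows "N \<le> B ^ n \<or> (\<exists>bs p r. set bs \<subseteq> {..<m} \<and>
    p @ map (\<lambda>i. x (int i)) [0..<N] @ r = concat (map (\<lambda>b. Z n [b]) bs))"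
proof -
  obtain k a where ka: "a < m" "sublist (map x [- int N..int N]) (Z k [a])"
    using x unfolding subst_space_def mem_Collect_eq by blast
  then obtain p r where pr: "Z k [a] = p @ map x [- int N..int N] @ r"
    by (auto simp: sublist_def)
  have split: "[- int N..int N] = [- int N..- 1] @ [0..int N - 1] @ [int N]"
    using upto_split1[of "- int N" 0 "int N"] upto_rec2[of 0 "int N"] by (cases "N = 0") auto
  have "map x [0..int N - 1] = map (\<lambda>i. x (int i)) [0..<N]"
    by (rule nth_equalityI) auto
  then have pr': "Z k [a] = (p @ map x [- int N..- 1]) @ map (\<lambda>i. x (int i)) [0..<N] @ ([x (int N)] @ r)"
    using pr by (simp add: split)
  show ?thesis
  proof (cases "n \<le> k")
    case True
    then have "Z k [a] = Z n (Z (k - n) [a])"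
      by (simp flip: iter_word_add)
    also have "\<dots> = concat (map (\<lambda>b. Z n [b]) (Z (k - n) [a]))"
      by (rule iter_word_conv_concat)
    finally have "concat (map (\<lambda>b. Z n [b]) (Z (k - n) [a])) = Z k [a]" ..
    moreover have "set (Z (k - n) [a]) \<subseteq> {..<m}"
      using ka(1) by (intro Z_set) auto
    ultimately show ?thesis
      using pr' by metis
  next
    case False
    have "N \<le> length (Z k [a])"
      by (simp add: pr')
    also have "\<dots> \<le> B ^ k"
      by (rule length_Z_letter_le[OF ka(1)])
    also have "\<dots> \<le> B ^ n"
      using False B_ge_2 by (intro power_increasing) auto
    finally show ?thesis ..
  qed
qed

lemma wlen_conv_count_list:
  assumes "set w \<subseteq> {..<m}"
  shows "wlen s w = (\<Sum>j<m. s j * real (count_list w j))"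
  using assms
proof (induction w)
  case (Cons a w)
  have "(\<Sum>j<m. s j * real (count_list (a # w) j)) = (\<Sum>j<m. s j * real (count_list w j) + (if j = a then s a else 0))"
    by (rule sum.cong) (auto simp: algebra_simps)
  also have "\<dots> = (\<Sum>j<m. s j * real (count_list w j)) + s a"
    using Cons.prems by (simp add: sum.distrib)
  finally show ?case
    using Cons by simp
qed simp

end

section \<open>Decay of the exponential sums over blocks\<close>

lemma cmod_1_plus_cis: "cmod (1 + cis (2 * x)) = 2 * \<bar>cos x\<bar>"
proof -
  have "1 + cis (2 * x) = cis x * of_real (2 * cos x)"
    by (rule complex_eqI) (simp_all add: cos_double_cos sin_double power2_eq_square)
  then show ?thesis by (simp add: norm_mult)
qed

lemma abs_cos_pi_le:
  assumes "0 \<le> \<rho>" "\<rho> \<le> \<bar>x - of_int (round x)\<bar>"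
  shows "\<bar>cos (pi * x)\<bar> \<le> cos (pi * \<rho>)"
proof -
  define d where "d = \<bar>x - of_int (round x)\<bar>"
  have d: "\<rho> \<le> d" "d \<le> 1 / 2"
    using assms of_int_round_abs_le[of x] by (auto simp: d_def abs_minus_commute)
  let ?r = "real_of_int (round x)"
  have r: "sin (pi * ?r) = 0" by simp
  then have "\<bar>cos (pi * ?r)\<bar> = 1"
    using sin_cos_squared_add[of "pi * ?r"] by (simp add: power2_eq_1_iff)
  moreover have "pi * x = pi * (x - ?r) + pi * ?r"
    by (simp add: algebra_simps)
  then have "cos (pi * x) = cos (pi * (x - ?r)) * cos (pi * ?r)"
    using r by (metis cos_add mult_zero_right diff_zero)
  ultimately have "\<bar>cos (pi * x)\<bar> = \<bar>cos (pi * (x - ?r))\<bar>"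
    by (simp add: abs_mult)
  also have "\<dots> = \<bar>cos (pi * d)\<bar>"
    using cos_abs_real[of "pi * (x - ?r)"] by (simp add: d_def abs_mult)
  also have "\<dots> = cos (pi * d)"
  proof -
    have "0 \<le> pi * d" "pi * d \<le> pi * (1 / 2)"
      using d assms by (auto intro!: mult_left_mono)
    then have "0 \<le> cos (pi * d)"
      using pi_gt_zero by (intro cos_ge_zero) linarith+
    then show ?thesis by simp
  qed
  also have "\<dots> \<le> cos (pi * \<rho>)"
  proof (rule cos_monotone_0_pi_le)
    show "pi * d \<le> pi"
      using d(2) mult_left_mono[of d 1 pi] by simp
  qed (use d assms in auto)
  finally show ?thesis .
qed

context primitive_substitution
begin

lemma norm_wsum_Z_word_le:
  fixes E :: real
  assumes "\<And>b. b < m \<Longrightarrow> cmod (wsum s \<omega> c (Z k [b])) \<le> E * length (Z k [b])"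
    and "set w \<subseteq> {..<m}"
  shows "cmod (wsum s \<omega> c (Z k w)) \<le> E * length (Z k w)"
  using assms(2)
proof (induction w)
  case (Cons a w)
  have "cmod (wsum s \<omega> c (Z k [a] @ Z k w)) \<le> cmod (wsum s \<omega> c (Z k [a])) + cmod (wsum s \<omega> c (Z k w))"
    by (rule norm_wsum_append_le)
  also have "\<dots> \<le> E * length (Z k [a]) + E * length (Z k w)"
    using Cons assms(1) by (intro add_mono) auto
  finally show ?case
    by (subst (1 2) iter_word_Cons) (simp add: distrib_left)
qed simp

text \<open>At a level where the phase of the return word \<open>l # v\<close> is far from an integer, the two
  occurrences of \<open>Z k [l]\<close> partly cancel.\<close>

lemma norm_wsum_return_le:
  fixes E \<kappa> T :: real
  assumes bound: "\<And>b. b < m \<Longrightarrow> cmod (wsum s \<omega> c (Z k [b])) \<le> E * length (Z k [b])"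
    and q: "Z q [a] = p @ l # v @ l # r" "a < m"
    and comp: "real (length (Z (k + q) [a])) \<le> T * length (Z k [l])" "0 < T"
    and \<kappa>: "cmod (1 + cis (- (2 * pi * (\<omega> * wlen s (Z k (l # v)))))) \<le> 2 - \<kappa>" "0 \<le> \<kappa>" and E: "0 \<le> E"
  shows "cmod (wsum s \<omega> c (Z (k + q) [a])) \<le> E * (1 - \<kappa> / T) * length (Z (k + q) [a])"
proof -
  let ?F = "wsum s \<omega> c"
  let ?l = "Z k [l]"
  have letters: "set p \<subseteq> {..<m}" "set v \<subseteq> {..<m}" "set r \<subseteq> {..<m}" "l < m"
    using Z_set[of "[a]" q] q by auto
  have "Z (k + q) [a] = Z k (Z q [a])"
    by (rule iter_word_add)
  also have "\<dots> = Z k p @ (?l @ Z k v @ ?l) @ Z k r"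
    unfolding q by (subst iter_word_append, subst iter_word_Cons, subst iter_word_append, subst (2) iter_word_Cons) simp
  finally have eq: "Z (k + q) [a] = Z k p @ (?l @ Z k v @ ?l) @ Z k r" .
  have eqv: "Z k (l # v) = ?l @ Z k v" by (rule iter_word_Cons)
  let ?c = "\<lambda>w. cis (- (2 * pi * (\<omega> * wlen s w)))"
  have "?F (?l @ Z k v @ ?l) = ?F ((?l @ Z k v) @ ?l)" by simp
  also have "\<dots> = ?F ?l + ?c ?l * ?F (Z k v) + ?c (Z k (l # v)) * ?F ?l"
    unfolding wsum_append[of s \<omega> c "?l @ Z k v" ?l] eqv by (simp only: wsum_append)
  also have "\<dots> = (1 + ?c (Z k (l # v))) * ?F ?l + ?c ?l * ?F (Z k v)"
    by (simp add: algebra_simps)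
  finally have "cmod (?F (?l @ Z k v @ ?l)) \<le> cmod ((1 + ?c (Z k (l # v))) * ?F ?l) + cmod (?c ?l * ?F (Z k v))"
    by (simp only: norm_triangle_ineq)
  also have "\<dots> = cmod (1 + ?c (Z k (l # v))) * cmod (?F ?l) + cmod (?F (Z k v))"
    by (simp only: norm_mult norm_cis mult_1_left)
  also have "\<dots> \<le> (2 - \<kappa>) * (E * length ?l) + E * length (Z k v)"
    using \<kappa> order_trans[OF norm_ge_zero \<kappa>(1)]
    by (intro add_mono mult_mono bound norm_wsum_Z_word_le letters) auto
  finally have mid: "cmod (?F (?l @ Z k v @ ?l)) \<le> (2 - \<kappa>) * (E * length ?l) + E * length (Z k v)" .
  have "cmod (?F (Z (k + q) [a])) \<le> cmod (?F (Z k p)) + (cmod (?F (?l @ Z k v @ ?l)) + cmod (?F (Z k r)))"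
    unfolding eq by (intro order_trans[OF norm_wsum_append_le] add_left_mono norm_wsum_append_le)
  also have "\<dots> \<le> E * length (Z k p) + ((2 - \<kappa>) * (E * length ?l) + E * length (Z k v) + E * length (Z k r))"
    using mid norm_wsum_Z_word_le[OF bound letters(1)] norm_wsum_Z_word_le[OF bound letters(3)] by linarith
  also have "\<dots> = E * length (Z (k + q) [a]) - E * (\<kappa> * length ?l)"
    unfolding eq by (simp add: algebra_simps)
  \<comment> \<open>The block \<open>Z k [l]\<close> makes up at least the fraction
    \<open>1 / T\<close> of the whole word, which turns the saving on this block into a
    factor.\<close>
  also have "\<dots> \<le> E * length (Z (k + q) [a]) - E * (\<kappa> * (length (Z (k + q) [a]) / T))"
  proof -
    have "real (length (Z (k + q) [a])) \<le> T * real (length ?l)"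
      using comp(1) by linarith
    then have "length (Z (k + q) [a]) / T \<le> length ?l"
      using comp(2) by (simp add: divide_le_eq mult.commute)
    then show ?thesis
      using E \<kappa>(2) by (intro diff_left_mono mult_left_mono) auto
  qed
  also have "\<dots> = E * (1 - \<kappa> / T) * length (Z (k + q) [a])"
    by (simp add: algebra_simps)
  finally show ?thesis .
qed

text \<open>A gain from level \<open>k\<close> to level \<open>k + q\<close> skips the levels
  between, so up to \<open>q\<close> levels of \<open>G\<close> share one gain; since it is
  \<open>g powr q\<close>, each of them still receives a factor \<open>g\<close>. The loss of
  \<open>2 * q\<close> in the exponent accounts for the levels at the two ends.\<close>

lemma norm_wsum_Z_decay:
  fixes G :: "nat \<Rightarrow> bool" and g K :: real
  assumes q: "0 < q" and g: "0 < g" "g \<le> 1"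
    and K: "\<And>a. a < m \<Longrightarrow> cmod (c a) \<le> K" "0 \<le> K"
    and gain: "\<And>k (E::real) a. G k \<Longrightarrow> a < m \<Longrightarrow> 0 \<le> E \<Longrightarrow>
      (\<And>b. b < m \<Longrightarrow> cmod (wsum s \<omega> c (Z k [b])) \<le> E * length (Z k [b])) \<Longrightarrow>
      cmod (wsum s \<omega> c (Z (k + q) [a])) \<le> E * g powr q * length (Z (k + q) [a])"
    and a: "a < m"
  shows "cmod (wsum s \<omega> c (Z n [a])) \<le> K * g powr (real (card {k. k < n \<and> G k}) - 2 * real q) * length (Z n [a])"
proof -
  define A where "A n = real (card {k. k + q \<le> n \<and> G k})" for n
  have fin: "finite {k. k + q \<le> n \<and> P k}" for n P
    by (rule finite_subset[of _ "{..n}"]) auto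
  have "cmod (wsum s \<omega> c (Z n [a])) \<le> K * g powr (A n - q) * length (Z n [a])"
    using a
  proof (induction n arbitrary: a rule: less_induct)
    case (less n)
    show ?case
    proof (cases "n < q")
      case True
      have "cmod (wsum s \<omega> c (Z n [a])) \<le> K * length (Z n [a])"
        using Z_set[of "[a]" n] less.prems K by (intro norm_wsum_le) auto
      also have "\<dots> \<le> K * g powr (A n - q) * length (Z n [a])"
      proof -
        have "A n = 0" using True by (auto simp: A_def)
        then have "1 \<le> g powr (A n - q)"
          using powr_mono'[of "- real q" 0 g] g by simp
        then show ?thesis
          using K(2) by (intro mult_right_mono) (auto simp: mult_le_cancel_left1)
      qed
      finally show ?thesis .
    next
      case False
      have E0: "0 \<le> K * g powr x" for x using K(2) by simp
      show ?thesis
      proof (cases "G (n - q)")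
        case True
        \<comment> \<open>The levels counted at \<open>n\<close> but not at \<open>n - q\<close> lie
          in a range of at most \<open>q\<close> levels, and the single gain at \<open>n - q\<close>
          pays for all of them.\<close>
        have "{k. k + q \<le> n \<and> G k} \<subseteq> {k. k + q \<le> n - q \<and> G k} \<union> {Suc (n - q) - q .. n - q}"
        proof
          fix k assume "k \<in> {k. k + q \<le> n \<and> G k}"
          then show "k \<in> {k. k + q \<le> n - q \<and> G k} \<union> {Suc (n - q) - q .. n - q}"
            by (cases "k + q \<le> n - q") auto
        qed
        then have "card {k. k + q \<le> n \<and> G k} \<le> card ({k. k + q \<le> n - q \<and> G k} \<union> {Suc (n - q) - q .. n - q})"
          using fin by (intro card_mono) auto
        also have "\<dots> \<le> card {k. k + q \<le> n - q \<and> G k} + card {Suc (n - q) - q .. n - q}"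
          by (rule card_Un_le)
        finally have A: "A n \<le> A (n - q) + q"
          by (simp add: A_def)
        have "cmod (wsum s \<omega> c (Z (n - q + q) [a])) \<le> K * g powr (A (n - q) - q) * g powr q * length (Z (n - q + q) [a])"
          using less True False q by (intro gain E0) auto
        also have "K * g powr (A (n - q) - q) * g powr q = K * g powr A (n - q)"
          by (simp add: powr_add[symmetric])
        also have "n - q + q = n" using False by simp
        also have "K * g powr A (n - q) * length (Z n [a]) \<le> K * g powr (A n - q) * length (Z n [a])"
          using A g K(2) by (intro mult_right_mono mult_left_mono powr_mono') auto
        finally show ?thesis .
      next
        case NG: False
        \<comment> \<open>Without a gain at \<open>n - q\<close> the recursion descends by one level
          only, and loses nothing.\<close>
        have "{k. k + q \<le> n \<and> G k} = {k. k + q \<le> n - 1 \<and> G k}"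
        proof -
          have "k + q \<le> n - 1" if "k + q \<le> n" "G k" for k
          proof -
            have "k \<noteq> n - q" using NG that(2) by auto
            then show ?thesis using that(1) by linarith
          qed
          then show ?thesis by auto
        qed
        then have A: "A n = A (n - 1)" by (simp add: A_def)
        have n: "n = (n - 1) + 1" using False q by simp
        have "Z n [a] = Z (n - 1) (Z 1 [a])"
          by (subst n, rule iter_word_add)
        moreover have "cmod (wsum s \<omega> c (Z (n - 1) (Z 1 [a]))) \<le> K * g powr (A (n - 1) - q) * length (Z (n - 1) (Z 1 [a]))"
        proof (rule norm_wsum_Z_word_le)
          show "cmod (wsum s \<omega> c (Z (n - 1) [b])) \<le> K * g powr (A (n - 1) - q) * length (Z (n - 1) [b])" if "b < m" for b
            using that n by (intro less.IH) auto
          show "set (Z 1 [a]) \<subseteq> {..<m}"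
            using less.prems by (intro Z_set) simp
        qed
        ultimately show ?thesis using A by simp
      qed
    qed
  qed
  also have "\<dots> \<le> K * g powr (real (card {k. k < n \<and> G k}) - 2 * real q) * length (Z n [a])"
  proof -
    have "{k. k < n \<and> G k} \<subseteq> {k. k + q \<le> n \<and> G k} \<union> {n - q..<n}"
      by auto
    then have "card {k. k < n \<and> G k} \<le> card ({k. k + q \<le> n \<and> G k} \<union> {n - q..<n})"
      using fin by (intro card_mono) auto
    also have "\<dots> \<le> card {k. k + q \<le> n \<and> G k} + card {n - q..<n}"
      by (rule card_Un_le)
    finally have "real (card {k. k < n \<and> G k}) \<le> A n + q"
      by (simp add: A_def)
    then show ?thesis
      using g K(2) by (intro mult_right_mono mult_left_mono powr_mono') auto
  qed
  finally show ?thesis .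
qed

end

section \<open>Sums of mean-zero functions\<close>

lemma convex_combination_contract:
  fixes Q :: "'i \<Rightarrow> complex" and R t :: real
  assumes I: "finite I" "i0 \<in> I"
    and \<pi>: "\<And>i. i \<in> I \<Longrightarrow> 0 \<le> \<pi> i" "sum \<pi> I = 1" "t \<le> \<pi> i0"
    and \<pi>': "\<And>i. i \<in> I \<Longrightarrow> 0 \<le> \<pi>' i" "sum \<pi>' I = 1" "t \<le> \<pi>' i0"
    and t: "0 \<le> t" and R: "0 \<le> R" "\<And>i j. i \<in> I \<Longrightarrow> j \<in> I \<Longrightarrow> cmod (Q i - Q j) \<le> R"
  shows "cmod ((\<Sum>i\<in>I. of_real (\<pi> i) * Q i) - (\<Sum>i\<in>I. of_real (\<pi>' i) * Q i)) \<le> (1 - t\<^sup>2) * R"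
proof -
  let ?w = "\<lambda>z. \<pi> (fst z) * \<pi>' (snd z)"
  have w: "0 \<le> ?w z" if "z \<in> I \<times> I" for z
    using that \<pi>(1) \<pi>'(1) by auto
  have sum1: "(\<Sum>z\<in>I \<times> I. ?w z) = 1"
    using \<pi>(2) \<pi>'(2) by (simp add: sum.cartesian_product' sum_product[symmetric] flip: sum_distrib_left sum_distrib_right)
  have "(\<Sum>j\<in>I. of_real (\<pi> i * \<pi>' j) * z) = of_real (\<pi> i) * z" for i and z :: complex
    unfolding sum_distrib_right[symmetric] of_real_sum[symmetric] sum_distrib_left[symmetric] \<pi>'(2) by simp
  then have 1: "(\<Sum>i\<in>I. of_real (\<pi> i) * Q i) = (\<Sum>i\<in>I. \<Sum>j\<in>I. of_real (\<pi> i * \<pi>' j) * Q i)"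
    by simp
  have "(\<Sum>i\<in>I. of_real (\<pi> i * \<pi>' j) * z) = of_real (\<pi>' j) * z" for j and z :: complex
    unfolding sum_distrib_right[symmetric] of_real_sum[symmetric] \<pi>(2) by simp
  then have 2: "(\<Sum>j\<in>I. of_real (\<pi>' j) * Q j) = (\<Sum>i\<in>I. \<Sum>j\<in>I. of_real (\<pi> i * \<pi>' j) * Q j)"
    by (subst sum.swap) simp
  have "(\<Sum>i\<in>I. of_real (\<pi> i) * Q i) - (\<Sum>i\<in>I. of_real (\<pi>' i) * Q i)
      = (\<Sum>i\<in>I. \<Sum>j\<in>I. of_real (\<pi> i * \<pi>' j) * (Q i - Q j))"
    unfolding 1 2 by (simp only: sum_subtractf right_diff_distrib)
  also have "\<dots> = (\<Sum>z\<in>I \<times> I. of_real (?w z) * (Q (fst z) - Q (snd z)))"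
    by (simp add: sum.cartesian_product')
  \<comment> \<open>Doeblin's argument: under the product of the two distributions the pair
    \<open>(i0, i0)\<close> has mass at least \<open>t\<^sup>2\<close>, and it contributes
    nothing.\<close>
  also have "\<dots> = (\<Sum>z\<in>I \<times> I - {(i0, i0)}. of_real (?w z) * (Q (fst z) - Q (snd z)))"
    using I by (subst sum.remove[of _ "(i0, i0)"]) auto
  also have "cmod \<dots> \<le> (\<Sum>z\<in>I \<times> I - {(i0, i0)}. ?w z * R)"
  proof (rule sum_norm_le)
    fix z assume z: "z \<in> I \<times> I - {(i0, i0)}"
    then show "cmod (of_real (?w z) * (Q (fst z) - Q (snd z))) \<le> ?w z * R"
      using w[of z] R(2)[of "fst z" "snd z"] unfolding norm_mult norm_of_real
      by (intro mult_mono) auto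
  qed
  also have "\<dots> = ((\<Sum>z\<in>I \<times> I. ?w z) - ?w (i0, i0)) * R"
    using I by (subst (2) sum.remove[of _ "(i0, i0)"]) (auto simp: sum_distrib_right)
  also have "\<dots> \<le> (1 - t\<^sup>2) * R"
    using sum1 mult_mono[OF \<pi>(3) \<pi>'(3)] t \<pi>(1) I R(1)
    by (intro mult_right_mono) (auto simp: power2_eq_square)
  finally show ?thesis .
qed

lemma measurable_coordinate:
  fixes X :: "(int \<Rightarrow> nat) set"
  assumes "sets \<mu> = sets (restrict_space borel X)" "space \<mu> = X"
  shows "(\<lambda>x. x i) \<in> measurable \<mu> (count_space (UNIV :: nat set))"
proof -
  have "(\<lambda>x::int \<Rightarrow> nat. x i) \<in> borel_measurable borel"
    by (intro borel_measurable_continuous_onI continuous_on_product_coordinates)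
  then have m: "(\<lambda>x::int \<Rightarrow> nat. x i) \<in> borel_measurable (restrict_space borel X)"
    by (rule measurable_restrict_space1)
  have "(\<lambda>x. x i) -` {a} \<inter> space \<mu> \<in> sets \<mu>" for a
    using measurable_sets[OF m, of "{a}"] assms by (simp add: space_restrict_space)
  then show ?thesis
    by (simp add: measurable_count_space_eq2_countable)
qed

context primitive_substitution
begin

lemma wsum_0_Z:
  assumes "set w \<subseteq> {..<m}"
  shows "wsum s 0 c (Z k w) = (\<Sum>b<m. of_nat (count_list w b) * wsum s 0 c (Z k [b]))"
    "real (length (Z k w)) = (\<Sum>b<m. real (count_list w b) * real (length (Z k [b])))"
  using assms
proof (induction w)
  case (Cons a w)
  have *: "(\<Sum>b<m. of_nat (count_list (a # w) b) * f b) = f a + (\<Sum>b<m. of_nat (count_list w b) * f b)"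
    if "a < m" for f :: "nat \<Rightarrow> 'a::comm_ring_1"
  proof -
    have "(\<Sum>b<m. of_nat (count_list (a # w) b) * f b) = (\<Sum>b<m. (if b = a then f b else 0) + of_nat (count_list w b) * f b)"
      by (rule sum.cong) (auto simp: algebra_simps)
    then show ?thesis using that by (simp add: sum.distrib)
  qed
  have eq: "Z k (a # w) = Z k [a] @ Z k w" by (rule iter_word_Cons)
  { case 1
    then show ?case using Cons.IH(1) unfolding eq by (subst *) (auto simp: wsum_0_conv_sum_list)
  next
    case 2
    then show ?case using Cons.IH(2) unfolding eq by (subst *) auto
  }
qed (simp_all)

text \<open>At frequency \<open>0\<close> the roof does not enter the sum, so the zero roof serves
  for all \<open>s\<close>.\<close>

definition avg :: "(nat \<Rightarrow> complex) \<Rightarrow> nat \<Rightarrow> nat \<Rightarrow> complex" where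
  "avg c n a = wsum (\<lambda>_. 0) 0 c (Z n [a]) / of_nat (length (Z n [a]))"

lemma wsum_0_cong: "wsum s 0 c w = wsum s' 0 c w"
  by (simp add: wsum_0_conv_sum_list)

lemma wsum_0_avg: "a < m \<Longrightarrow> wsum s 0 c (Z n [a]) = avg c n a * of_nat (length (Z n [a]))"
  using length_Z_pos[of a n] wsum_0_cong[of s c _ "\<lambda>_. 0"] by (simp add: avg_def)

lemma norm_avg_le:
  assumes "\<And>a. a < m \<Longrightarrow> cmod (c a) \<le> K" "a < m"
  shows "cmod (avg c n a) \<le> K"
proof -
  have "cmod (wsum (\<lambda>_. 0) 0 c (Z n [a])) \<le> K * length (Z n [a])"
    using Z_set[of "[a]" n] assms by (intro norm_wsum_le) auto
  then show ?thesis
    using length_Z_pos[OF assms(2), of n] by (simp add: avg_def norm_divide divide_le_eq)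
qed

text \<open>The average over \<open>Z n [a]\<close> is a convex combination of averages over blocks
  of level \<open>n - q\<close>. As every letter occurs in \<open>Z q [a]\<close> and block lengths
  are comparable, the letter \<open>0\<close> has weight at least \<open>1 / T\<close> whatever
  \<open>a\<close> is, so the oscillation contracts once every \<open>q\<close> levels.\<close>

lemma avg_oscillation:
  fixes K T :: real
  assumes c: "\<And>a. a < m \<Longrightarrow> cmod (c a) \<le> K"
    and q: "0 < q" "\<And>a b. a < m \<Longrightarrow> b < m \<Longrightarrow> b \<in> set (Z q [a])"
    and T: "1 \<le> T" "\<And>k a b. a < m \<Longrightarrow> b < m \<Longrightarrow> real (length (Z (k + q) [a])) \<le> T * real (length (Z k [b]))"
    and ab: "a < m" "a' < m"
  shows "cmod (avg c n a - avg c n a') \<le> 2 * K * (1 - (1 / T)\<^sup>2) ^ (n div q)"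
  using ab
proof (induction n arbitrary: a a' rule: less_induct)
  case (less n)
  have K: "0 \<le> K" using c[of 0] m2 norm_ge_zero[of "c 0"] by linarith
  show ?case
  proof (cases "n < q")
    case True
    have "cmod (avg c n a - avg c n a') \<le> K + K"
      using norm_triangle_ineq4[of "avg c n a" "avg c n a'"] norm_avg_le[of c K, OF c less.prems(1), of n]
        norm_avg_le[of c K, OF c less.prems(2), of n] by linarith
    then show ?thesis using True by simp
  next
    case False
    define k where "k = n - q"
    have n: "n = k + q" using False by (simp add: k_def)
    define \<pi> where "\<pi> a b = real (count_list (Z q [a]) b) * real (length (Z k [b])) / real (length (Z n [a]))" for a b
    have Zn: "Z n [a] = Z k (Z q [a])" for a
      unfolding n by (rule iter_word_add)
    have letters: "set (Z q [a]) \<subseteq> {..<m}" if "a < m" for a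
      using that by (intro Z_set) auto
    have sum1: "sum (\<pi> a) {..<m} = 1" if "a < m" for a
    proof -
      have "(\<Sum>b<m. real (count_list (Z q [a]) b) * real (length (Z k [b]))) = real (length (Z n [a]))"
        using wsum_0_Z(2)[OF letters[OF that], of k] by (simp only: Zn)
      then have "sum (\<pi> a) {..<m} = real (length (Z n [a])) / real (length (Z n [a]))"
        unfolding \<pi>_def sum_divide_distrib[symmetric] by (simp only:)
      then show ?thesis
        using length_Z_pos[OF that, of n] by simp
    qed
    have lower: "1 / T \<le> \<pi> a 0" if "a < m" for a
    proof -
      have 0: "0 < m" using m2 by simp
      have "0 < count_list (Z q [a]) 0"
        using q(2)[OF that 0] count_list_0_iff[of "Z q [a]" 0] by auto
      then have "1 * real (length (Z k [0])) \<le> real (count_list (Z q [a]) 0) * real (length (Z k [0]))"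
        by (intro mult_right_mono) auto
      then have "real (length (Z n [a])) \<le> T * (real (count_list (Z q [a]) 0) * real (length (Z k [0])))"
        using T(1) unfolding n
        by (intro order_trans[OF T(2)[OF that 0, of k]] mult_left_mono) auto
      then show ?thesis
        unfolding \<pi>_def using T(1) length_Z_pos[OF that, of n] by (simp add: field_simps)
    qed
    have avg: "avg c n a = (\<Sum>b<m. of_real (\<pi> a b) * avg c k b)" if "a < m" for a
    proof -
      have "wsum (\<lambda>_. 0) 0 c (Z n [a]) = (\<Sum>b<m. of_nat (count_list (Z q [a]) b) * wsum (\<lambda>_. 0) 0 c (Z k [b]))"
        unfolding Zn by (rule wsum_0_Z) (rule letters[OF that])
      also have "\<dots> = (\<Sum>b<m. of_nat (count_list (Z q [a]) b) * (avg c k b * of_nat (length (Z k [b]))))"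
        by (rule sum.cong) (auto simp: wsum_0_avg)
      finally show ?thesis
        by (simp add: avg_def[of c n] \<pi>_def sum_divide_distrib mult_ac)
    qed
    have t2: "0 \<le> 1 - (1 / T)\<^sup>2"
      using T(1) by (simp add: power_le_one)
    have "cmod (avg c n a - avg c n a') \<le> (1 - (1 / T)\<^sup>2) * (2 * K * (1 - (1 / T)\<^sup>2) ^ (k div q))"
      unfolding avg[OF less.prems(1)] avg[OF less.prems(2)]
    proof (rule convex_combination_contract)
      show "0 \<in> {..<m}" using m2 by simp
      show "0 \<le> 2 * K * (1 - (1 / T)\<^sup>2) ^ (k div q)" using K t2 by simp
      show "cmod (avg c k i - avg c k j) \<le> 2 * K * (1 - (1 / T)\<^sup>2) ^ (k div q)" if "i \<in> {..<m}" "j \<in> {..<m}" for i j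
        using that n q(1) by (intro less.IH) auto
      show "0 \<le> 1 / T" using T(1) by simp
    qed (use less.prems sum1 lower in \<open>auto simp: \<pi>_def\<close>)
    also have "\<dots> = 2 * K * (1 - (1 / T)\<^sup>2) ^ (n div q)"
      using q(1) by (simp add: n)
    finally show ?thesis .
  qed
qed

lemma subst_measure_integral:
  fixes c :: "nat \<Rightarrow> complex"
  assumes \<mu>: "subst_measure m \<zeta> \<mu>" and K: "\<And>a. a < m \<Longrightarrow> cmod (c a) \<le> K"
  shows "integrable \<mu> (\<lambda>x. c (x i))" "(\<integral>x. c (x (int i')) \<partial>\<mu>) = (\<integral>x. c (x 0) \<partial>\<mu>)"
proof -
  have sp: "space \<mu> = subst_space m \<zeta>" and se: "sets \<mu> = sets (restrict_space borel (subst_space m \<zeta>))"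
    and one: "emeasure \<mu> (space \<mu>) = 1"
    and sh: "shift 1 \<in> measurable \<mu> \<mu>" "distr \<mu> \<mu> (shift 1) = \<mu>"
    using \<mu> by (auto simp: subst_measure_def)
  interpret prob_space \<mu> by (rule prob_spaceI) (rule one)
  have meas: "(\<lambda>x. c (x i)) \<in> borel_measurable \<mu>" for i
    by (rule measurable_compose[OF measurable_coordinate[OF se sp]]) simp
  show "integrable \<mu> (\<lambda>x. c (x i))"
    by (rule integrable_const_bound[where B = K]) (auto simp: sp meas intro!: K subst_space_letters AE_I2)
  show "(\<integral>x. c (x (int i')) \<partial>\<mu>) = (\<integral>x. c (x 0) \<partial>\<mu>)"
  proof (induction i')
    case (Suc i)
    have "(\<integral>x. c (x (int i)) \<partial>\<mu>) = (\<integral>x. c (x (int i)) \<partial>distr \<mu> \<mu> (shift 1))"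
      by (simp only: sh(2))
    also have "\<dots> = (\<integral>x. c (shift 1 x (int i)) \<partial>\<mu>)"
      by (rule integral_distr[OF sh(1) meas])
    also have "\<dots> = (\<integral>x. c (x (int (Suc i))) \<partial>\<mu>)"
      by (simp add: shift_def add.commute)
    finally show ?case using Suc by simp
  qed simp
qed

lemma norm_wsum_orbit_le:
  fixes E K :: real
  assumes x: "x \<in> subst_space m \<zeta>"
    and block: "\<And>b. b < m \<Longrightarrow> cmod (wsum s \<omega> c (Z n [b])) \<le> E * length (Z n [b])"
    and c: "\<And>a. a < m \<Longrightarrow> cmod (c a) \<le> K" and E: "0 \<le> E" and K: "0 \<le> K"
  shows "cmod (wsum s \<omega> c (map (\<lambda>i. x (int i)) [0..<N])) \<le> E * N + 2 * K * real B ^ n"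
proof -
  let ?w = "map (\<lambda>i. x (int i)) [0..<N]"
  show ?thesis
    using subst_space_factor[OF x, of N n]
  proof
    assume le: "N \<le> B ^ n"
    have "cmod (wsum s \<omega> c ?w) \<le> K * length ?w"
      by (rule norm_wsum_le) (use c subst_space_letters[OF x] in auto)
    also have "\<dots> \<le> K * real B ^ n"
      using le K by (intro mult_left_mono) (auto simp flip: of_nat_power)
    also have "\<dots> \<le> E * N + 2 * K * real B ^ n"
      using E K by (simp add: add_increasing mult_right_mono)
    finally show ?thesis .
  next
    assume "\<exists>bs p r. set bs \<subseteq> {..<m} \<and> p @ ?w @ r = concat (map (\<lambda>b. Z n [b]) bs)"
    then obtain bs p r where bs: "set bs \<subseteq> {..<m}" "p @ ?w @ r = concat (map (\<lambda>b. Z n [b]) bs)"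
      by blast
    have "cmod (wsum s \<omega> c ?w) \<le> E * length ?w + 2 * K * real B ^ n"
    proof (rule norm_wsum_factor_le[OF bs(2)])
      fix b assume "b \<in> set (map (\<lambda>b. Z n [b]) bs)"
      then obtain d where "d < m" "b = Z n [d]" using bs(1) by auto
      then show "real (length b) \<le> real B ^ n \<and> cmod (wsum s \<omega> c b) \<le> E * length b"
        using block[of d] length_Z_letter_le[of d n] by (simp flip: of_nat_power)
    next
      fix d assume "d \<in> set (concat (map (\<lambda>b. Z n [b]) bs))"
      then obtain b where "b < m" "d \<in> set (Z n [b])" using bs(1) by auto
      then have "d < m" using Z_set[of "[b]" n] by auto
      then show "cmod (c d) \<le> K" by (rule c)
    qed (use K E in auto)
    then show ?thesis by simp
  qed
qed

text \<open>After subtracting the block average \<open>Q\<close>, all block sums of level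
  \<open>n\<close> are at most \<open>R\<close> per letter, so Birkhoff sums over \<open>N\<close>
  letters are at most \<open>R * N\<close> plus a constant. Their integral is \<open>- N * Q\<close>
  by invariance and mean zero; large \<open>N\<close> gives the claim.\<close>

lemma norm_avg_mean_zero_le:
  fixes K T :: real
  assumes \<mu>: "subst_measure m \<zeta> \<mu>" and zero: "(\<integral>x. c (x 0) \<partial>\<mu>) = 0"
    and c: "\<And>a. a < m \<Longrightarrow> cmod (c a) \<le> K"
    and osc: "\<And>b. b < m \<Longrightarrow> cmod (avg c n b - avg c n a) \<le> R"
    and a: "a < m"
  shows "cmod (avg c n a) \<le> R"
proof -
  have K: "0 \<le> K" using c[of 0] m2 norm_ge_zero[of "c 0"] by linarith
  have R: "0 \<le> R" using osc[OF a] by simp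
  define Q where "Q = avg c n a"
  define c' where "c' b = c b - Q" for b
  have cQ: "cmod (c' b) \<le> 2 * K" if "b < m" for b
    using norm_triangle_ineq4[of "c b" Q] c[OF that] norm_avg_le[of c K a n, OF c a] by (simp add: c'_def Q_def)
  have wc': "wsum s 0 c' w = wsum s 0 c w - Q * of_nat (length w)" for s w
    by (induction w) (auto simp: c'_def algebra_simps)
  have block: "cmod (wsum s 0 c' (Z n [b])) \<le> R * length (Z n [b])" if "b < m" for b s
  proof -
    have "wsum s 0 c' (Z n [b]) = wsum s 0 c (Z n [b]) - Q * of_nat (length (Z n [b]))"
      by (rule wc')
    also have "\<dots> = (avg c n b - Q) * of_nat (length (Z n [b]))"
      by (simp only: wsum_0_avg[OF that] left_diff_distrib)
    finally have "wsum s 0 c' (Z n [b]) = (avg c n b - Q) * of_nat (length (Z n [b]))" .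
    then show ?thesis
      using osc[OF that] by (simp add: norm_mult Q_def mult_right_mono)
  qed
  have bound: "cmod (\<Sum>i<N. c' (x (int i))) \<le> R * N + 2 * (2 * K) * real B ^ n" if x: "x \<in> subst_space m \<zeta>" for x N
  proof -
    let ?w = "map (\<lambda>i. x (int i)) [0..<N]"
    have "wsum (\<lambda>_. 0) 0 c' ?w = (\<Sum>i<N. c' (x (int i)))"
      by (simp add: wsum_0_conv_sum_list o_def interv_sum_list_conv_sum_set_nat atLeast0LessThan)
    moreover have "cmod (wsum (\<lambda>_. 0) 0 c' ?w) \<le> R * N + 2 * (2 * K) * real B ^ n"
      using K by (intro norm_wsum_orbit_le[OF x block cQ R]) auto
    ultimately show ?thesis by simp
  qed
  have sp: "space \<mu> = subst_space m \<zeta>" and one: "emeasure \<mu> (space \<mu>) = 1"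
    using \<mu> by (auto simp: subst_measure_def)
  interpret prob_space \<mu> by (rule prob_spaceI) (rule one)
  note int = subst_measure_integral[OF \<mu>, of c K, OF c]
  have intc': "integrable \<mu> (\<lambda>x. c' (x i))" "(\<integral>x. c' (x (int i')) \<partial>\<mu>) = - Q" for i i'
    unfolding c'_def using int(1)[of i] int(1)[of "int i'"] int(2)[of i'] zero by (simp_all add: prob_space)
  have NQ: "real N * cmod Q \<le> R * N + 4 * K * real B ^ n" for N
  proof -
    have "(\<integral>x. (\<Sum>i<N. c' (x (int i))) \<partial>\<mu>) = (\<Sum>i<N. - Q)"
      using intc' by (subst Bochner_Integration.integral_sum) auto
    then have "real N * cmod Q = cmod (\<integral>x. (\<Sum>i<N. c' (x (int i))) \<partial>\<mu>)"
      by (simp add: norm_mult)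
    also have "\<dots> \<le> (\<integral>x. cmod (\<Sum>i<N. c' (x (int i))) \<partial>\<mu>)"
      by (rule integral_norm_bound)
    also have "\<dots> \<le> (\<integral>x. R * N + 2 * (2 * K) * real B ^ n \<partial>\<mu>)"
      using intc' bound by (intro integral_mono integrable_norm Bochner_Integration.integrable_sum) (auto simp: sp)
    also have "\<dots> = R * N + 4 * K * real B ^ n"
      by (simp add: prob_space)
    finally show ?thesis .
  qed
  show ?thesis
  proof (rule ccontr)
    assume "\<not> ?thesis"
    then have d: "0 < cmod Q - R" by (simp add: Q_def)
    obtain N :: nat where "4 * K * real B ^ n < real N * (cmod Q - R)"
      using reals_Archimedean3[OF d] by blast
    then show False using NQ[of N] by (simp add: algebra_simps)
  qed
qed

end

section \<open>The bound for word sums\<close>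

text \<open>The three bounds are those of the Fourier coefficients
  \<open>\<integral>\<^sub>0\<^bsup>s j\<^esup> exp (- 2 \<pi> \<i> \<omega> t) \<psi>\<^sub>j(t) dt\<close> of \<open>L\<close>-Lipschitz functions bounded by \<open>L\<close>.\<close>

definition admissible :: "nat \<Rightarrow> (int \<Rightarrow> nat) measure \<Rightarrow> real \<Rightarrow> (real \<Rightarrow> nat \<Rightarrow> complex) \<Rightarrow> bool" where
  "admissible m \<mu> L c \<longleftrightarrow>
    (\<forall>\<omega>. \<forall>j<m. cmod (c \<omega> j) \<le> L \<and> \<bar>\<omega>\<bar> * cmod (c \<omega> j) \<le> 3 * L \<and> cmod (c \<omega> j - c 0 j) \<le> 2 * pi * \<bar>\<omega>\<bar> * L)
    \<and> (\<integral>x. c 0 (x 0) \<partial>\<mu>) = 0"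

text \<open>Rounding down the quotient costs at most one factor \<open>1 / r\<close>.\<close>

lemma powr_div_le:
  assumes "0 < r" "r \<le> 1" "0 < d"
  shows "r ^ (n div d) \<le> (1 / r) * (r powr (1 / d)) ^ n"
proof -
  have "real n / d < real (n div d) + 1"
  proof -
    have "n < (n div d + 1) * d"
      using dividend_less_div_times[OF assms(3), of n] by simp
    then have "real n < real ((n div d + 1) * d)"
      by (simp only: of_nat_less_iff)
    then show ?thesis
      using assms(3) by (simp add: pos_divide_less_eq distrib_right)
  qed
  then have "r powr real (n div d) \<le> r powr (real n / d - 1)"
    using assms by (intro powr_mono') auto
  also have "\<dots> = (1 / r) * (r powr (1 / d)) ^ n"
    using assms by (simp add: powr_diff powr_powr[symmetric] powr_realpow[symmetric] powr_powr)
  finally show ?thesis using assms by (simp add: powr_realpow)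
qed

context primitive_substitution
begin

text \<open>The constants \<open>\<xi>\<close> and \<open>C\<close> are the same for almost all
  \<open>s\<close>, and only the threshold \<open>n0\<close> varies; this makes the final exponent
  independent of \<open>s\<close>.\<close>

theorem exists_word_sum_bound:
  assumes irr: "irreducible (char_poly (map_mat rat_of_int (subst_mat m \<zeta>)))"
    and ev: "eigenvalues_by_modulus (map_mat complex_of_int (subst_mat m \<zeta>)) \<theta>"
    and len: "2 \<le> length \<theta>" and big: "cmod (\<theta> ! 1) > 1"
  obtains \<xi> C :: real where "0 < \<xi>" "\<xi> < 1" "0 < C"
    "AE s in simplex_lebesgue m. \<exists>n0. \<forall>n\<ge>n0. \<forall>\<mu> L c \<omega> x N.
       subst_measure m \<zeta> \<mu> \<longrightarrow> admissible m \<mu> L c \<longrightarrow> x \<in> subst_space m \<zeta> \<longrightarrow>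
       cmod (wsum s \<omega> (c \<omega>) (map (\<lambda>i. x (int i)) [0..<N])) \<le> L * C * (real N * \<xi> ^ n + real B ^ n)"
proof -
  let ?S = "subst_mat m \<zeta>"
  obtain l v q where lv: "l < m" "set v \<subseteq> {..<m}" and q: "0 < q"
    and ret: "\<And>a. a < m \<Longrightarrow> \<exists>p r. Z q [a] = p @ l # v @ l # r"
    and all: "\<And>a b. a < m \<Longrightarrow> b < m \<Longrightarrow> b \<in> set (Z q [a])"
    by (rule exists_return_word) blast
  have lvset: "set (l # v) \<subseteq> {..<m}" using lv by simp
  define a where "a j k = int (count_list (Z k (l # v)) j)" for j k
  have rec: "a i (Suc k) = (\<Sum>j<m. ?S $$ (i, j) * a j k)" if "i < m" for i k
    unfolding a_def by (rule count_list_Z_Suc[OF lvset that])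
  have a0: "a l 0 \<noteq> 0" by (simp add: a_def)
  obtain z1 z2 q1 q2 where z: "cmod z1 > 1" "cmod z2 > 1"
    "[:- z1, 1:] * q1 = map_poly of_int (char_poly ?S)" "[:- z2, 1:] * q2 = map_poly of_int (char_poly ?S)"
    "\<exists>i<m. \<exists>j<m. shift_poly q1 (\<lambda>k. of_int (a i k)) 0 * shift_poly q2 (\<lambda>k. of_int (a j k)) 0
               \<noteq> shift_poly q1 (\<lambda>k. of_int (a j k)) 0 * shift_poly q2 (\<lambda>k. of_int (a i k)) 0"
    using irreducible_char_poly_spectral_data[OF subst_mat_carrier irr ev len big rec lv(1) a0] by blast
  then obtain i1 i2 where i12: "i1 < m" "i2 < m"
    "shift_poly q1 (\<lambda>k. of_int (a i1 k)) 0 * shift_poly q2 (\<lambda>k. of_int (a i2 k)) 0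
        \<noteq> shift_poly q1 (\<lambda>k. of_int (a i2 k)) 0 * shift_poly q2 (\<lambda>k. of_int (a i1 k)) 0"
    by blast
  interpret R: integer_recurrence m "char_poly ?S" a z1 z2 q1 q2 i1 i2
  proof
    show "degree (char_poly ?S) = m" "lead_coeff (char_poly ?S) = 1"
      using degree_monic_char_poly[OF subst_mat_carrier] by auto
    show "shift_poly (char_poly ?S) (a j) k = 0" if "j < m" for j k
      by (rule shift_poly_char_poly[OF subst_mat_carrier _ that]) (rule rec)
  qed (use z i12 in auto)
  have phase: "R.phase s \<omega> k = \<omega> * wlen s (Z k (l # v))" for s \<omega> k
    unfolding R.phase_def wlen_conv_count_list[OF Z_set[OF lvset]] by (simp add: a_def)

  \<comment> \<open>\<open>\<kappa>\<close> is the saving at a bad level, \<open>T\<close> the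
    comparability constant of block lengths, \<open>g\<close> the resulting factor per level, and
    \<open>r0\<close> the contraction of block averages over \<open>q\<close> levels.
    \<open>D\<close> is so large that blocks of level \<open>n div D\<close> have length at most
    \<open>exp (R.\<eta> / 2 * n)\<close>. \<open>\<xi>\<close> is the slowest of the rates in the
    three frequency ranges, and \<open>C\<close> adds up their constants, with \<open>2\<close> for
    the incomplete blocks.\<close>
  define \<kappa> where "\<kappa> = min 1 (2 - 2 * cos (pi * R.rho))"
  define T where "T = real (B ^ (2 * q))"
  define g where "g = (1 - \<kappa> / T) powr (1 / q)"
  define D where "D = nat \<lceil>2 * ln B / R.\<eta>\<rceil> + 1"
  define r0 where "r0 = 1 - (1 / T)\<^sup>2"
  define \<xi> where "\<xi> = max (g powr R.\<delta>) (max (exp (- R.\<eta> / 2)) (r0 powr (1 / (D * q))))"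
  define C where "C = g powr (- 2 * real q) + 3 + 2 / r0 + 4 * pi + 2"

  have "cos (pi * R.rho) < cos 0"
    using R.rho_pos by (intro cos_monotone_0_pi) auto
  then have \<kappa>: "0 < \<kappa>" "\<kappa> \<le> 1" by (auto simp: \<kappa>_def)
  have "2 \<le> B ^ (2 * q)"
    using self_le_power[of B "2 * q"] B_ge_2 q by linarith
  then have "real 2 \<le> real (B ^ (2 * q))"
    by (simp only: of_nat_le_iff)
  then have T: "2 \<le> T" by (simp only: T_def of_nat_numeral)
  have lt1: "y powr e < 1" if "0 < y" "y < 1" "0 < e" for y e :: real
    using powr_less_mono2[of e y 1] that by simp
  have \<kappa>T: "0 < 1 - \<kappa> / T" "1 - \<kappa> / T < 1"
    using \<kappa> T by (auto simp: field_simps)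
  have g: "0 < g" "g < 1" "g powr q = 1 - \<kappa> / T"
  proof -
    show "0 < g"
      unfolding g_def powr_gt_zero using \<kappa>T(1) by linarith
    show "g < 1"
      unfolding g_def using \<kappa>T q by (intro lt1) auto
    show "g powr q = 1 - \<kappa> / T"
      unfolding g_def powr_powr using \<kappa>T(1) q by simp
  qed
  have r0: "0 < r0" "r0 < 1"
  proof -
    have "0 < 1 / T" "1 / T < 1" using T by auto
    then have "(1 / T) * (1 / T) < 1 * 1" "0 < (1 / T) * (1 / T)"
      by (intro mult_strict_mono mult_pos_pos; simp)+
    then have "(1 / T)\<^sup>2 < 1" "0 < (1 / T)\<^sup>2"
      by (simp_all only: power2_eq_square mult_1_right)
    then show "0 < r0" "r0 < 1" by (auto simp: r0_def)
  qed
  have \<xi>: "0 < \<xi>" "\<xi> < 1"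
  proof -
    show "0 < \<xi>" by (simp add: \<xi>_def less_max_iff_disj)
    have "g powr R.\<delta> < 1" "exp (- R.\<eta> / 2) < 1" "r0 powr (1 / (D * q)) < 1"
      using g R.delta_bounds(1) R.\<eta>_pos r0 q by (auto intro!: lt1 simp: D_def simp del: of_nat_add)
    then show "\<xi> < 1" by (simp add: \<xi>_def)
  qed
  have C: "0 < C"
  proof -
    have "0 \<le> g powr (- 2 * real q)" "0 \<le> 2 / r0" using r0 by auto
    then show ?thesis unfolding C_def using pi_gt_zero by linarith
  qed
  have \<xi>_ge: "g powr R.\<delta> \<le> \<xi>" "exp (- R.\<eta> / 2) \<le> \<xi>" "r0 powr (1 / (D * q)) \<le> \<xi>"
    by (auto simp: \<xi>_def)
  have exp_le: "exp (- R.\<eta> / 2 * n) \<le> \<xi> ^ n" for n :: nat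
  proof -
    have "exp (- R.\<eta> / 2 * n) = exp (- R.\<eta> / 2) ^ n"
      by (rule exp_of_nat2_mult)
    then show ?thesis using \<xi>_ge(2) by (simp only: power_mono exp_ge_zero)
  qed
  have gain: "cmod (wsum s \<omega> c (Z (k + q) [a])) \<le> E * g powr q * length (Z (k + q) [a])"
    if "R.bad s \<omega> k" "a < m" "0 \<le> E" and bound: "\<And>b. b < m \<Longrightarrow> cmod (wsum s \<omega> c (Z k [b])) \<le> E * length (Z k [b])"
    for s \<omega> c k a and E :: real
  proof -
    obtain p r where pr: "Z q [a] = p @ l # v @ l # r"
      using ret[OF \<open>a < m\<close>] by blast
    let ?y = "\<omega> * wlen s (Z k (l # v))"
    have "cmod (1 + cis (- (2 * pi * ?y))) = 2 * \<bar>cos (pi * ?y)\<bar>"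
      using cmod_1_plus_cis[of "- (pi * ?y)"] by (simp add: mult.assoc)
    also have "\<dots> \<le> 2 * cos (pi * R.rho)"
      using abs_cos_pi_le[of R.rho ?y] that(1) R.rho_pos by (simp add: R.bad_def phase)
    also have "\<dots> \<le> 2 - \<kappa>" by (simp add: \<kappa>_def)
    finally have "cmod (1 + cis (- (2 * pi * ?y))) \<le> 2 - \<kappa>" .
    moreover have "real (length (Z (k + q) [a])) \<le> T * length (Z k [l])"
      using length_Z_comparable[OF all \<open>a < m\<close> lv(1), of k] by (simp add: T_def flip: of_nat_mult of_nat_power)
    ultimately show ?thesis
      unfolding g(3) using T \<kappa> \<open>0 \<le> E\<close>
      by (intro norm_wsum_return_le[OF bound pr \<open>a < m\<close>, of T \<kappa>]) auto
  qed
  have "AE s in simplex_lebesgue m. \<exists>n0. \<forall>n\<ge>n0. \<forall>\<mu> L c \<omega> x N.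
       subst_measure m \<zeta> \<mu> \<longrightarrow> admissible m \<mu> L c \<longrightarrow> x \<in> subst_space m \<zeta> \<longrightarrow>
       cmod (wsum s \<omega> (c \<omega>) (map (\<lambda>i. x (int i)) [0..<N])) \<le> L * C * (real N * \<xi> ^ n + real B ^ n)"
    using R.AE_many_bad AE_space
  proof eventually_elim
    case (elim s)
    then obtain n0 where n0: "\<And>(n::nat) \<omega>. n0 \<le> n \<Longrightarrow> exp (- R.\<eta> * n) \<le> \<bar>\<omega>\<bar> \<Longrightarrow> \<bar>\<omega>\<bar> \<le> exp (R.\<eta> * n) \<Longrightarrow>
        R.\<delta> * n \<le> card {k. k < n \<and> R.bad s \<omega> k}" and s: "s \<in> open_simplex m"
      unfolding space_simplex_lebesgue by blast
    have s01: "0 \<le> s j \<and> s j \<le> 1" if "j < m" for j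
      using open_simplex_bounds[OF s that] by simp
    show ?case
    proof (intro exI[of _ n0] allI impI)
      fix n :: nat and \<mu> :: "(int \<Rightarrow> nat) measure" and L :: real and c :: "real \<Rightarrow> nat \<Rightarrow> complex"
        and \<omega> :: real and x :: "int \<Rightarrow> nat" and N :: nat
      assume n: "n0 \<le> n" and \<mu>: "subst_measure m \<zeta> \<mu>" and adm: "admissible m \<mu> L c" and x: "x \<in> subst_space m \<zeta>"
      have cL: "cmod (c \<omega> j) \<le> L" and cdecay: "\<bar>\<omega>\<bar> * cmod (c \<omega> j) \<le> 3 * L"
        and cdiff: "cmod (c \<omega> j - c 0 j) \<le> 2 * pi * \<bar>\<omega>\<bar> * L" if "j < m" for j \<omega>
        using adm that by (auto simp: admissible_def)
      have L: "0 \<le> L"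
        using cL[of 0 0] m2 norm_ge_zero[of "c 0 0"] by linarith
      let ?W = "wsum s \<omega> (c \<omega>) (map (\<lambda>i. x (int i)) [0..<N])"
      have Bn: "0 \<le> real B ^ n" and NX: "0 \<le> real N * \<xi> ^ n"
        using \<xi> by auto
      have final: "cmod ?W \<le> L * C * (real N * \<xi> ^ n + real B ^ n)"
        if "cmod ?W \<le> L * C1 * (real N * \<xi> ^ n) + L * 2 * real B ^ n" "C1 \<le> C" for C1
      proof -
        have "2 \<le> C" using r0 by (simp add: C_def add_nonneg_nonneg)
        then have "L * C1 * (real N * \<xi> ^ n) + L * 2 * real B ^ n \<le> L * C * (real N * \<xi> ^ n) + L * C * real B ^ n"
          using that(2) L Bn NX by (intro add_mono mult_right_mono mult_left_mono) auto
        then show ?thesis using that(1) by (simp add: distrib_left)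
      qed
      consider (mid) "exp (- R.\<eta> * n) \<le> \<bar>\<omega>\<bar>" "\<bar>\<omega>\<bar> \<le> exp (R.\<eta> * n)"
        | (large) "exp (R.\<eta> * n) < \<bar>\<omega>\<bar>" | (small) "\<bar>\<omega>\<bar> < exp (- R.\<eta> * n)"
        by linarith
      then show "cmod ?W \<le> L * C * (real N * \<xi> ^ n + real B ^ n)"
      proof cases
        case mid
        have few: "R.\<delta> * n \<le> card {k. k < n \<and> R.bad s \<omega> k}"
          by (rule n0[OF n mid])
        have "cmod (wsum s \<omega> (c \<omega>) (Z n [b])) \<le> L * (g powr (- 2 * real q) * \<xi> ^ n) * length (Z n [b])" if "b < m" for b
        proof -
          have "cmod (wsum s \<omega> (c \<omega>) (Z n [b]))
              \<le> L * g powr (real (card {k. k < n \<and> R.bad s \<omega> k}) - 2 * real q) * length (Z n [b])"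
            using g q L cL by (intro norm_wsum_Z_decay gain that) auto
          also have "\<dots> \<le> L * (g powr (- 2 * real q) * \<xi> ^ n) * length (Z n [b])"
          proof (intro mult_right_mono mult_left_mono L)
            have "g powr (real (card {k. k < n \<and> R.bad s \<omega> k}) - 2 * real q) \<le> g powr (R.\<delta> * n - 2 * real q)"
              using g few by (intro powr_mono') auto
            also have "\<dots> = g powr (- 2 * real q) * (g powr R.\<delta>) ^ n"
            proof -
              have "(g powr R.\<delta>) ^ n = g powr (R.\<delta> * n)"
                using powr_realpow[of "g powr R.\<delta>" n] g by (simp add: powr_powr)
              then show ?thesis
                by (simp add: algebra_simps flip: powr_add)
            qed
            also have "\<dots> \<le> g powr (- 2 * real q) * \<xi> ^ n"
              using \<xi>_ge(1) by (intro mult_left_mono power_mono) auto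
            finally show "g powr (real (card {k. k < n \<and> R.bad s \<omega> k}) - 2 * real q) \<le> g powr (- 2 * real q) * \<xi> ^ n" .
          qed simp
          finally show ?thesis .
        qed
        then have "cmod ?W \<le> L * (g powr (- 2 * real q) * \<xi> ^ n) * N + 2 * L * real B ^ n"
          using L \<xi> cL by (intro norm_wsum_orbit_le x) auto
        also have "\<dots> = L * g powr (- 2 * real q) * (real N * \<xi> ^ n) + L * 2 * real B ^ n"
          by (simp only: mult_ac)
        finally show ?thesis
          by (rule final) (use r0 in \<open>simp add: C_def\<close>)
      next
        case large
        have pos: "0 < \<bar>\<omega>\<bar>"
          by (rule less_trans[OF exp_gt_zero large])
        have "cmod (c \<omega> j) \<le> L * 3 * \<xi> ^ n" if "j < m" for j
        proof -
          have "cmod (c \<omega> j) \<le> 3 * L / \<bar>\<omega>\<bar>"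
            using cdecay[OF that, of \<omega>] pos by (simp add: field_simps)
          also have "\<dots> \<le> 3 * L / exp (R.\<eta> * n)"
            using large L pos by (intro divide_left_mono) auto
          also have "\<dots> = L * 3 * exp (- R.\<eta> * n)"
            by (simp add: exp_minus divide_inverse)
          also have "\<dots> \<le> L * 3 * exp (- R.\<eta> / 2 * n)"
            using L R.\<eta>_pos by (intro mult_left_mono) auto
          also have "\<dots> \<le> L * 3 * \<xi> ^ n"
            using L exp_le by (intro mult_left_mono) auto
          finally show ?thesis .
        qed
        then have "cmod ?W \<le> L * 3 * \<xi> ^ n * length (map (\<lambda>i. x (int i)) [0..<N])"
          by (intro norm_wsum_le) (auto simp: subst_space_letters[OF x])
        also have "\<dots> = L * 3 * (real N * \<xi> ^ n)" by simp
        also have "\<dots> \<le> L * 3 * (real N * \<xi> ^ n) + L * 2 * real B ^ n"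
          using L Bn by simp
        finally show ?thesis
          by (rule final) (use r0 in \<open>simp add: C_def\<close>)
      next
        case small
        \<comment> \<open>Blocks of level \<open>n'\<close> are so short that
          \<open>\<bar>\<omega>\<bar>\<close> times their length is still at most
          \<open>\<xi> ^ n\<close>, and long enough for their averages to decay like
          \<open>\<xi> ^ n\<close>.\<close>
        define n' where "n' = n div D"
        have n': "n' \<le> n" by (simp add: n'_def)
        have Bn': "real B ^ n' \<le> exp (R.\<eta> / 2 * n)"
        proof -
          have lB: "0 < ln (real B)" using B_ge_2 by (intro ln_gt_zero) auto
          have "2 * ln B / R.\<eta> \<le> D"
            unfolding D_def by linarith
          then have "2 * ln B \<le> R.\<eta> * D"
            using R.\<eta>_pos by (simp add: field_simps)
          then have "2 * ln B * n' \<le> R.\<eta> * D * n'"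
            by (intro mult_right_mono) auto
          also have "\<dots> \<le> R.\<eta> * n"
          proof -
            have "real (D * n') \<le> real n"
              unfolding n'_def of_nat_le_iff by (rule times_div_less_eq_dividend)
            then show ?thesis
              using R.\<eta>_pos by (simp add: mult.assoc)
          qed
          finally have "ln B * n' \<le> R.\<eta> / 2 * n" by simp
          moreover have "real B ^ n' = exp (ln B * n')"
            using B_ge_2 by (simp add: exp_of_nat2_mult)
          ultimately show ?thesis by simp
        qed
        have \<omega>B: "\<bar>\<omega>\<bar> * real B ^ n' \<le> \<xi> ^ n"
        proof -
          have "\<bar>\<omega>\<bar> * real B ^ n' \<le> exp (- R.\<eta> * n) * exp (R.\<eta> / 2 * n)"
            using small Bn' by (intro mult_mono) auto
          also have "\<dots> = exp (- R.\<eta> / 2 * n)"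
            by (simp flip: exp_add)
          finally show ?thesis using exp_le[of n] by linarith
        qed
        have B1: "1 \<le> real B ^ n'"
          using B_ge_2 by (intro one_le_power) auto
        have "cmod (wsum s \<omega> (c \<omega>) (Z n' [b])) \<le> L * ((2 / r0 + 4 * pi) * \<xi> ^ n) * length (Z n' [b])" if b: "b < m" for b
        proof -
          let ?w = "Z n' [b]"
          have wset: "set ?w \<subseteq> {..<m}" using b by (intro Z_set) simp
          have len: "real (length ?w) \<le> real B ^ n'"
            using length_Z_letter_le[OF b, of n'] by (simp flip: of_nat_power)
          have "cmod (avg (c 0) n' b) \<le> 2 * L * r0 ^ (n' div q)"
          proof (rule norm_avg_mean_zero_le[OF \<mu> _ cL _ b])
            show "(\<integral>x. c 0 (x 0) \<partial>\<mu>) = 0" using adm by (simp add: admissible_def)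
            fix d assume "d < m"
            show "cmod (avg (c 0) n' d - avg (c 0) n' b) \<le> 2 * L * r0 ^ (n' div q)"
              unfolding r0_def
            proof (rule avg_oscillation[OF cL q all])
              show "real (length (Z (k + q) [a])) \<le> T * real (length (Z k [b]))" if "a < m" "b < m" for k a b
                using length_Z_comparable[OF all that, of k] by (simp add: T_def flip: of_nat_mult of_nat_power)
            qed (use T b \<open>d < m\<close> in auto)
          qed
          also have "r0 ^ (n' div q) \<le> (1 / r0) * \<xi> ^ n"
          proof -
            have "r0 ^ (n' div q) \<le> (1 / r0) * (r0 powr (1 / (D * q))) ^ n"
              unfolding n'_def div_mult2_eq[symmetric]
              by (rule powr_div_le) (use r0 q in \<open>simp_all add: D_def\<close>)
            also have "\<dots> \<le> (1 / r0) * \<xi> ^ n"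
              using \<xi>_ge(3) r0 by (intro mult_left_mono power_mono) auto
            finally show ?thesis .
          qed
          finally have avg: "cmod (avg (c 0) n' b) \<le> 2 * L * ((1 / r0) * \<xi> ^ n)"
            using L by (simp add: mult_left_mono)
          have "cmod (wsum s \<omega> (c \<omega>) ?w - wsum s 0 (c 0) ?w)
              \<le> length ?w * (2 * pi * \<bar>\<omega>\<bar> * L + 2 * pi * \<bar>\<omega>\<bar> * L * length ?w)"
            using wset cL cdiff s01 L by (intro norm_wsum_frequency_diff_le) (auto simp: subset_iff)
          also have "\<dots> \<le> length ?w * (2 * pi * \<bar>\<omega>\<bar> * L * real B ^ n' + 2 * pi * \<bar>\<omega>\<bar> * L * real B ^ n')"
          proof -
            have a: "0 \<le> 2 * pi * \<bar>\<omega>\<bar> * L" using L by simp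
            have "2 * pi * \<bar>\<omega>\<bar> * L \<le> 2 * pi * \<bar>\<omega>\<bar> * L * real B ^ n'"
              using mult_left_mono[OF B1 a] by (simp only: mult_1_right)
            then show ?thesis
              by (intro mult_left_mono add_mono len a of_nat_0_le_iff)
          qed
          also have "\<dots> = length ?w * (4 * pi * L * (\<bar>\<omega>\<bar> * real B ^ n'))"
            by (simp add: algebra_simps)
          also have "\<dots> \<le> length ?w * (4 * pi * L * \<xi> ^ n)"
            using \<omega>B L by (intro mult_left_mono) auto
          finally have "cmod (wsum s \<omega> (c \<omega>) ?w - wsum s 0 (c 0) ?w) \<le> length ?w * (4 * pi * L * \<xi> ^ n)" .
          moreover have "cmod (wsum s 0 (c 0) ?w) \<le> 2 * L * ((1 / r0) * \<xi> ^ n) * length ?w"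
            unfolding wsum_0_avg[OF b] norm_mult norm_of_nat by (rule mult_right_mono[OF avg]) simp
          ultimately have "cmod (wsum s \<omega> (c \<omega>) ?w) \<le> 2 * L * ((1 / r0) * \<xi> ^ n) * length ?w + length ?w * (4 * pi * L * \<xi> ^ n)"
            using norm_triangle_sub[of "wsum s \<omega> (c \<omega>) ?w" "wsum s 0 (c 0) ?w"] by linarith
          then show ?thesis by (simp add: algebra_simps)
        qed
        then have "cmod ?W \<le> L * ((2 / r0 + 4 * pi) * \<xi> ^ n) * N + 2 * L * real B ^ n'"
          using L \<xi> r0 cL by (intro norm_wsum_orbit_le x) auto
        also have "\<dots> \<le> L * ((2 / r0 + 4 * pi) * \<xi> ^ n) * N + 2 * L * real B ^ n"
          using n' B_ge_2 L by (intro add_left_mono mult_left_mono power_increasing) auto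
        also have "\<dots> = L * (2 / r0 + 4 * pi) * (real N * \<xi> ^ n) + L * 2 * real B ^ n"
          by (simp only: mult_ac)
        finally show ?thesis
          by (rule final) (simp add: C_def)
      qed
    qed
  qed
  then show thesis
    using that \<xi> C by blast
qed

end

section \<open>Fourier coefficients and tent kernels\<close>

definition fcoef :: "real \<Rightarrow> (real \<Rightarrow> complex) \<Rightarrow> real \<Rightarrow> complex" where
  "fcoef b \<phi> \<omega> = integral {0..b} (\<lambda>t. cis (- (2 * pi * (\<omega> * t))) * \<phi> t)"

lemma norm_integral_le:
  fixes f :: "real \<Rightarrow> complex"
  assumes "a \<le> b" "f integrable_on {a..b}" "\<And>t. t \<in> {a..b} \<Longrightarrow> cmod (f t) \<le> B"
  shows "cmod (integral {a..b} f) \<le> B * (b - a)"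
proof -
  have "0 \<le> B"
    by (rule order_trans[OF norm_ge_zero assms(3)[of a]]) (use assms(1) in simp)
  then show ?thesis
    using has_integral_bound_real[of B "{}" f "integral {a..b} f" a b] assms
    by (auto simp: integrable_integral)
qed

context
  fixes \<phi> :: "real \<Rightarrow> complex" and L :: real
  assumes lip: "L-lipschitz_on UNIV \<phi>" and bd: "\<And>t. cmod (\<phi> t) \<le> L"
begin

lemma L_nonneg: "0 \<le> L"
  using lip by (rule lipschitz_on_nonneg)

lemma cont_\<phi>: "continuous_on A \<phi>"
  using lipschitz_on_continuous_on[OF lip] by (rule continuous_on_subset) simp

lemma cont_modulated: "continuous_on A (\<lambda>t. cis (- (2 * pi * (\<omega> * t))) * \<phi> t)"
  unfolding cis_conv_exp by (intro continuous_intros cont_\<phi>)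

lemma norm_fcoef_le:
  assumes "0 \<le> b"
  shows "cmod (fcoef b \<phi> \<omega>) \<le> L * b"
  unfolding fcoef_def
  using norm_integral_le[of 0 b "\<lambda>t. cis (- (2 * pi * (\<omega> * t))) * \<phi> t" L] assms bd
  by (simp add: norm_mult integrable_continuous_real cont_modulated)

lemma norm_fcoef_diff_le:
  assumes "0 \<le> b" "b \<le> 1"
  shows "cmod (fcoef b \<phi> \<omega> - fcoef b \<phi> 0) \<le> 2 * pi * \<bar>\<omega>\<bar> * L"
proof -
  let ?f = "\<lambda>\<omega> t. cis (- (2 * pi * (\<omega> * t))) * \<phi> t"
  have int: "?f \<omega> integrable_on {0..b}" for \<omega>
    by (intro integrable_continuous_real cont_modulated)
  have "fcoef b \<phi> \<omega> - fcoef b \<phi> 0 = integral {0..b} (\<lambda>t. ?f \<omega> t - ?f 0 t)"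
    unfolding fcoef_def by (rule integral_diff[symmetric]) (rule int)+
  also have "cmod \<dots> \<le> (2 * pi * \<bar>\<omega>\<bar> * L) * (b - 0)"
  proof (rule norm_integral_le[OF assms(1) Henstock_Kurzweil_Integration.integrable_diff[OF int int]])
    fix t assume t: "t \<in> {0..b}"
    have "?f \<omega> t - ?f 0 t = (cis (- (2 * pi * (\<omega> * t))) - 1) * \<phi> t"
      by (simp add: algebra_simps)
    then have "cmod (?f \<omega> t - ?f 0 t) = cmod (cis (- (2 * pi * (\<omega> * t))) - 1) * cmod (\<phi> t)"
      by (simp only: norm_mult)
    also have "\<dots> \<le> (2 * pi * \<bar>\<omega>\<bar>) * L"
    proof (intro mult_mono bd)
      have "cmod (cis (- (2 * pi * (\<omega> * t))) - 1) \<le> 2 * pi * \<bar>\<omega>\<bar> * \<bar>t\<bar>"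
        using norm_cis_diff_le[of "- (2 * pi * (\<omega> * t))"] by (simp add: abs_mult mult.assoc)
      also have "\<dots> \<le> 2 * pi * \<bar>\<omega>\<bar> * 1"
        using t assms(2) by (intro mult_left_mono) auto
      finally show "cmod (cis (- (2 * pi * (\<omega> * t))) - 1) \<le> 2 * pi * \<bar>\<omega>\<bar>" by simp
    qed auto
    finally show "cmod (?f \<omega> t - ?f 0 t) \<le> 2 * pi * \<bar>\<omega>\<bar> * L" .
  qed
  also have "\<dots> \<le> (2 * pi * \<bar>\<omega>\<bar> * L) * 1"
    using assms L_nonneg by (intro mult_left_mono) auto
  finally show ?thesis by simp
qed

text \<open>Translating by half a period changes the sign of the exponential factor, so the Lipschitz
  condition gives the decay without any differentiability.\<close>

lemma norm_fcoef_decay: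
  assumes "0 \<le> b" "b \<le> 1"
  shows "\<bar>\<omega>\<bar> * cmod (fcoef b \<phi> \<omega>) \<le> 3 * L"
proof (cases "\<omega> = 0 \<or> b \<le> 1 / (2 * \<bar>\<omega>\<bar>)")
  case True
  have "\<bar>\<omega>\<bar> * cmod (fcoef b \<phi> \<omega>) \<le> \<bar>\<omega>\<bar> * (L * b)"
    by (intro mult_left_mono norm_fcoef_le assms) auto
  also have "\<dots> = L * (\<bar>\<omega>\<bar> * b)" by simp
  also have "\<dots> \<le> L * 1"
  proof (intro mult_left_mono L_nonneg)
    show "\<bar>\<omega>\<bar> * b \<le> 1"
    proof (cases "\<omega> = 0")
      case False
      then have "\<bar>\<omega>\<bar> * b \<le> \<bar>\<omega>\<bar> * (1 / (2 * \<bar>\<omega>\<bar>))"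
        using True by (intro mult_left_mono) auto
      then show ?thesis using False by simp
    qed simp
  qed
  finally show ?thesis using L_nonneg by simp
next
  case False
  define h where "h = 1 / (2 * \<bar>\<omega>\<bar>)"
  have h: "0 < h" "h < b" and \<omega>h: "\<bar>\<omega>\<bar> * h = 1 / 2"
    using False by (auto simp: h_def)
  let ?e = "\<lambda>t. cis (- (2 * pi * (\<omega> * t)))"
  let ?f = "\<lambda>t. ?e t * \<phi> t"
  have int: "?f integrable_on {u..v}" for u v
    by (intro integrable_continuous_real cont_modulated)
  have half: "?e (t + h) = - ?e t" for t
  proof -
    have "?e (t + h) = ?e t * ?e h"
      by (simp add: cis_mult algebra_simps)
    moreover have "?e h = - 1"
    proof -
      have "\<omega> * h = 1 / 2 \<or> \<omega> * h = - (1 / 2)"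
        using \<omega>h by (cases "0 \<le> \<omega>") auto
      then show ?thesis
      proof
        assume *: "\<omega> * h = 1 / 2"
        show ?thesis unfolding * by (simp add: complex_eq_iff)
      next
        assume *: "\<omega> * h = - (1 / 2)"
        show ?thesis unfolding * by (simp add: complex_eq_iff)
      qed
    qed
    ultimately show ?thesis by simp
  qed
  have "integral {0..b} ?f = integral {0..h} ?f + integral {h..b} ?f"
    using h int by (intro Henstock_Kurzweil_Integration.integral_combine[symmetric]) auto
  moreover have "integral {h..b} ?f = integral {0..b - h} (\<lambda>t. - (?e t * \<phi> (t + h)))"
    using integral_shift_Icc_real[of 0 "b - h" ?f h] half by (simp add: o_def add.commute)
  moreover have "integral {0..b} ?f = integral {0..b - h} ?f + integral {b - h..b} ?f"
    using h int by (intro Henstock_Kurzweil_Integration.integral_combine[symmetric]) auto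
  moreover have int2: "(\<lambda>t. - (?e t * \<phi> (t + h))) integrable_on {0..b - h}"
    unfolding cis_conv_exp
    by (intro integrable_continuous_real continuous_intros continuous_on_compose2[OF cont_\<phi>[of UNIV]]) auto
  have "integral {0..b - h} ?f + integral {0..b - h} (\<lambda>t. - (?e t * \<phi> (t + h)))
      = integral {0..b - h} (\<lambda>t. ?f t + - (?e t * \<phi> (t + h)))"
    by (rule Henstock_Kurzweil_Integration.integral_add[symmetric]) (rule int int2)+
  \<comment> \<open>Adding the two forms of the integral leaves two boundary pieces of length
    \<open>h\<close> and the increments of \<open>\<phi>\<close> over \<open>h\<close>: three terms
    of size \<open>L * h\<close>, whence the factor \<open>3\<close>.\<close>
  ultimately have eq: "2 * integral {0..b} ?f = integral {0..h} ?f + integral {b - h..b} ?f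
      + integral {0..b - h} (\<lambda>t. ?f t + - (?e t * \<phi> (t + h)))"
    by (simp only: mult_2) (simp add: algebra_simps)
  have 1: "cmod (integral {0..h} ?f) \<le> L * (h - 0)" "cmod (integral {b - h..b} ?f) \<le> L * (b - (b - h))"
    using h by (intro norm_integral_le int; simp add: norm_mult bd)+
  have bh: "0 \<le> b - h" using h by simp
  have 2: "cmod (integral {0..b - h} (\<lambda>t. ?f t + - (?e t * \<phi> (t + h)))) \<le> L * h * (b - h - 0)"
  proof (rule norm_integral_le[OF bh Henstock_Kurzweil_Integration.integrable_add[OF int int2]])
    fix t
    have "?f t + - (?e t * \<phi> (t + h)) = ?e t * (\<phi> t - \<phi> (t + h))"
      by (simp add: algebra_simps)
    then have "cmod (?f t + - (?e t * \<phi> (t + h))) = dist (\<phi> t) (\<phi> (t + h))"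
      by (simp only: norm_mult norm_cis mult_1_left dist_norm)
    also have "\<dots> \<le> L * dist t (t + h)"
      by (rule lipschitz_onD[OF lip]) auto
    finally show "cmod (?f t + - (?e t * \<phi> (t + h))) \<le> L * h"
      using h by (simp add: dist_norm)
  qed
  have "L * h * (b - h - 0) \<le> L * h * 1"
    using h assms L_nonneg by (intro mult_left_mono) auto
  then have "cmod (integral {0..b - h} (\<lambda>t. ?f t + - (?e t * \<phi> (t + h)))) \<le> L * h"
    using 2 by simp
  moreover have "cmod (integral {0..h} ?f) \<le> L * h" "cmod (integral {b - h..b} ?f) \<le> L * h"
    using 1 by simp_all
  ultimately have "cmod (2 * integral {0..b} ?f) \<le> L * h + L * h + L * h"
    unfolding eq by (intro norm_triangle_le add_mono order_trans[OF norm_triangle_ineq])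
  then have "cmod (fcoef b \<phi> \<omega>) \<le> 3 * L * h / 2"
    by (simp add: fcoef_def norm_mult)
  then have "\<bar>\<omega>\<bar> * cmod (fcoef b \<phi> \<omega>) \<le> \<bar>\<omega>\<bar> * (3 * L * h / 2)"
    by (intro mult_left_mono) auto
  also have "\<dots> = 3 * L / 2 * (\<bar>\<omega>\<bar> * h)" by simp
  finally show ?thesis
    unfolding \<omega>h using L_nonneg by linarith
qed

end

text \<open>The second mean value theorem replaces integration by parts, so only integrability of \<open>k\<close> is needed.\<close>

lemma norm_integral_tent_le:
  fixes k :: "real \<Rightarrow> complex"
  assumes R: "0 \<le> R" and k: "k integrable_on {0..R}"
    and bound: "\<And>T. T \<in> {0..R} \<Longrightarrow> cmod (integral {0..T} k) \<le> M"
  shows "cmod (integral {0..R} (\<lambda>t. of_real (R - t) * k t)) \<le> 2 * R * M"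
proof -
  \<comment> \<open>\<open>p\<close> will be \<open>Re\<close> or \<open>Im\<close>, since the mean
    value theorem is about real functions; recombining the two parts gives the factor
    \<open>2\<close>.\<close>
  have *: "((\<lambda>t. (R - t) * p (k t)) integrable_on {0..R}) \<and> \<bar>integral {0..R} (\<lambda>t. (R - t) * p (k t))\<bar> \<le> R * M"
    if p: "bounded_linear p" "\<And>z. \<bar>p z\<bar> \<le> cmod z" for p :: "complex \<Rightarrow> real"
  proof -
    have pk: "(\<lambda>t. p (k t)) integrable_on {0..R}"
      using integrable_linear[OF k p(1)] by (simp add: o_def)
    \<comment> \<open>The weight is taken as \<open>t - R\<close>, which is increasing and vanishes
      at \<open>R\<close>, so that only the integral up to \<open>c\<close> survives.\<close>
    obtain c where c: "c \<in> {0..R}"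
      "((\<lambda>t. (t - R) * p (k t)) has_integral ((0 - R) * integral {0..c} (\<lambda>t. p (k t)) + (R - R) * integral {c..R} (\<lambda>t. p (k t)))) {0..R}"
      by (rule second_mean_value_theorem_full[OF pk R, of "\<lambda>t. t - R"]) auto
    have "((\<lambda>t. - ((t - R) * p (k t))) has_integral - ((0 - R) * integral {0..c} (\<lambda>t. p (k t)) + (R - R) * integral {c..R} (\<lambda>t. p (k t)))) {0..R}"
      by (rule has_integral_neg[OF c(2)])
    then have hi: "((\<lambda>t. (R - t) * p (k t)) has_integral (R * integral {0..c} (\<lambda>t. p (k t)))) {0..R}"
      by (simp add: algebra_simps)
    have "k integrable_on {0..c}"
      using k c(1) by (auto intro: integrable_subinterval_real)
    then have "integral {0..c} (\<lambda>t. p (k t)) = p (integral {0..c} k)"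
      using integral_linear[of k "{0..c}" p] p(1) by (simp add: o_def)
    then have "\<bar>R * integral {0..c} (\<lambda>t. p (k t))\<bar> \<le> R * M"
      using bound[OF c(1)] p(2)[of "integral {0..c} k"] R by (simp add: abs_mult mult_left_mono)
    then show ?thesis
      using hi by (auto simp: has_integral_iff)
  qed
  have Re: "(\<lambda>t. (R - t) * Re (k t)) integrable_on {0..R}" "\<bar>integral {0..R} (\<lambda>t. (R - t) * Re (k t))\<bar> \<le> R * M"
    using *[OF bounded_linear_Re abs_Re_le_cmod] by auto
  have Im: "(\<lambda>t. (R - t) * Im (k t)) integrable_on {0..R}" "\<bar>integral {0..R} (\<lambda>t. (R - t) * Im (k t))\<bar> \<le> R * M"
    using *[OF bounded_linear_Im abs_Im_le_cmod] by auto
  let ?re = "integral {0..R} (\<lambda>t. (R - t) * Re (k t))" and ?im = "integral {0..R} (\<lambda>t. (R - t) * Im (k t))"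
  have "((\<lambda>t. of_real ((R - t) * Re (k t)) + \<i> * of_real ((R - t) * Im (k t))) has_integral (of_real ?re + \<i> * of_real ?im)) {0..R}"
    by (intro has_integral_add has_integral_mult_right has_integral_of_real integrable_integral Re Im)
  moreover have "(\<lambda>t. of_real ((R - t) * Re (k t)) + \<i> * of_real ((R - t) * Im (k t))) = (\<lambda>t. of_real (R - t) * k t)"
    by (rule ext, rule complex_eqI) simp_all
  ultimately have "integral {0..R} (\<lambda>t. of_real (R - t) * k t) = of_real ?re + \<i> * of_real ?im"
    by (simp add: integral_unique)
  then have "cmod (integral {0..R} (\<lambda>t. of_real (R - t) * k t)) \<le> \<bar>?re\<bar> + \<bar>?im\<bar>"
    using norm_triangle_ineq[of "of_real ?re" "\<i> * of_real ?im"] by (simp add: norm_mult)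
  then show ?thesis
    using Re(2) Im(2) by linarith
qed

text \<open>The real part of the transform of the one-sided tent is a Fejer kernel,
  \<open>(1 - cos (\<alpha> * R)) / \<alpha>\<^sup>2\<close> for \<open>\<alpha> \<noteq> 0\<close>,
  hence nonnegative. For \<open>\<bar>\<alpha>\<bar> * R \<le> 1\<close> the cosine is at least
  \<open>1 / 2\<close> on the whole interval, because \<open>1 < pi / 3\<close>.\<close>

lemma tent_cos_integral:
  fixes \<alpha> R :: real
  assumes R: "0 \<le> R"
  shows "0 \<le> integral {0..R} (\<lambda>t. (R - t) * cos (\<alpha> * t))"
    and "\<bar>\<alpha>\<bar> * R \<le> 1 \<Longrightarrow> R\<^sup>2 / 4 \<le> integral {0..R} (\<lambda>t. (R - t) * cos (\<alpha> * t))"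
proof -
  have int: "(\<lambda>t. (R - t) * cos (\<alpha> * t)) integrable_on {0..R}"
    by (intro integrable_continuous_real continuous_intros)
  have lin: "((\<lambda>t. (R - t) / 2) has_integral (R\<^sup>2 / 4)) {0..R}"
  proof -
    have "((\<lambda>t. (R - t) / 2) has_integral (- (R - R)\<^sup>2 / 4 - (- (R - 0)\<^sup>2 / 4))) {0..R}"
      by (rule fundamental_theorem_of_calculus[OF R])
        (auto intro!: derivative_eq_intros simp flip: has_real_derivative_iff_has_vector_derivative)
    then show ?thesis by simp
  qed
  show lower: "R\<^sup>2 / 4 \<le> integral {0..R} (\<lambda>t. (R - t) * cos (\<alpha> * t))" if "\<bar>\<alpha>\<bar> * R \<le> 1"
  proof -
    have "integral {0..R} (\<lambda>t. (R - t) / 2) \<le> integral {0..R} (\<lambda>t. (R - t) * cos (\<alpha> * t))"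
    proof (rule integral_le)
      show "(\<lambda>t. (R - t) / 2) integrable_on {0..R}" using lin by blast
      fix t assume t: "t \<in> {0..R}"
      have "\<bar>\<alpha> * t\<bar> \<le> \<bar>\<alpha>\<bar> * R"
        using t by (simp add: abs_mult mult_left_mono)
      also have "\<dots> \<le> pi / 3"
        using that pi_gt3 by linarith
      finally have "cos (pi / 3) \<le> cos \<bar>\<alpha> * t\<bar>"
        by (intro cos_monotone_0_pi_le) auto
      then have "1 / 2 \<le> cos (\<alpha> * t)"
        by (simp add: cos_60)
      then show "(R - t) / 2 \<le> (R - t) * cos (\<alpha> * t)"
        using mult_left_mono[of "1 / 2" "cos (\<alpha> * t)" "R - t"] t by simp
    qed (rule int)
    then show ?thesis unfolding integral_unique[OF lin] .
  qed
  show "0 \<le> integral {0..R} (\<lambda>t. (R - t) * cos (\<alpha> * t))"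
  proof (cases "\<alpha> = 0")
    case True
    then have "R\<^sup>2 / 4 \<le> integral {0..R} (\<lambda>t. (R - t) * cos (\<alpha> * t))"
      by (intro lower) simp
    then show ?thesis
      by (rule order_trans[rotated]) simp
  next
    case False
    let ?F = "\<lambda>t. (R - t) * sin (\<alpha> * t) / \<alpha> - cos (\<alpha> * t) / \<alpha>\<^sup>2"
    have "((\<lambda>t. (R - t) * cos (\<alpha> * t)) has_integral (?F R - ?F 0)) {0..R}"
      by (rule fundamental_theorem_of_calculus[OF R])
        (use False in \<open>auto intro!: derivative_eq_intros simp: power2_eq_square field_simps
          simp flip: has_real_derivative_iff_has_vector_derivative\<close>)
    then have "integral {0..R} (\<lambda>t. (R - t) * cos (\<alpha> * t)) = (1 - cos (\<alpha> * R)) / \<alpha>\<^sup>2"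
      by (simp add: integral_unique diff_divide_distrib)
    then show ?thesis by simp
  qed
qed

section \<open>Integrals along orbits\<close>

definition orb_sum :: "(nat \<Rightarrow> real) \<Rightarrow> (nat \<Rightarrow> nat) \<Rightarrow> nat \<Rightarrow> real" where
  "orb_sum s y n = (\<Sum>i<n. s (y i))"
text \<open>Only nonnegative times occur, so the index of the current letter is a natural number,
  found as a least one; it exists by the lower bound on the roof in
  \<open>roof_orbit\<close>.\<close>

definition orb_idx :: "(nat \<Rightarrow> real) \<Rightarrow> (nat \<Rightarrow> nat) \<Rightarrow> real \<Rightarrow> nat" where
  "orb_idx s y w = (LEAST n. w < orb_sum s y (Suc n))"
definition orb_fun :: "(nat \<Rightarrow> real \<Rightarrow> complex) \<Rightarrow> (nat \<Rightarrow> real) \<Rightarrow> (nat \<Rightarrow> nat) \<Rightarrow> real \<Rightarrow> complex" where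
  "orb_fun \<phi> s y w = \<phi> (y (orb_idx s y w)) (w - orb_sum s y (orb_idx s y w))"

locale roof_orbit =
  fixes s :: "nat \<Rightarrow> real" and y :: "nat \<Rightarrow> nat" and \<sigma> :: real
  assumes \<sigma>: "0 < \<sigma>" and s: "\<And>i. \<sigma> \<le> s (y i)"
begin

abbreviation "S \<equiv> orb_sum s y"

lemma orb_sum_Suc: "S (Suc n) = S n + s (y n)"
  by (simp add: orb_sum_def)

lemma orb_sum_0 [simp]: "S 0 = 0"
  by (simp add: orb_sum_def)

lemma orb_sum_less: "S n < S (Suc n)"
  using s[of n] \<sigma> by (simp add: orb_sum_Suc)

lemma orb_sum_mono: "i \<le> j \<Longrightarrow> S i \<le> S j"
  by (rule lift_Suc_mono_le[of S]) (rule less_imp_le[OF orb_sum_less])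

lemma orb_sum_ge: "real n * \<sigma> \<le> S n"
proof (induction n)
  case (Suc n)
  then show ?case using s[of n] by (simp add: orb_sum_Suc algebra_simps)
qed simp

lemma orb_idx_eqI:
  assumes "S n \<le> w" "w < S (Suc n)"
  shows "orb_idx s y w = n"
  unfolding orb_idx_def
proof (rule Least_equality)
  fix k assume "w < S (Suc k)"
  show "n \<le> k"
  proof (rule ccontr)
    assume "\<not> n \<le> k"
    then have "S (Suc k) \<le> S n" by (intro orb_sum_mono) simp
    then show False using assms(1) \<open>w < S (Suc k)\<close> by simp
  qed
qed (rule assms)

lemma orb_idx_bounds:
  assumes "0 \<le> w"
  shows "S (orb_idx s y w) \<le> w" "w < S (Suc (orb_idx s y w))"
proof -
  obtain n :: nat where "w < real n * \<sigma>"
    using reals_Archimedean3[OF \<sigma>] by blast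
  then have "w < S (Suc n)"
    using orb_sum_ge[of n] orb_sum_less[of n] by linarith
  then show 1: "w < S (Suc (orb_idx s y w))"
    unfolding orb_idx_def by (rule LeastI)
  show "S (orb_idx s y w) \<le> w"
  proof (cases "orb_idx s y w")
    case (Suc k)
    then have "\<not> w < S (Suc k)"
      unfolding orb_idx_def using not_less_Least by (metis lessI)
    then show ?thesis using Suc by simp
  qed (use assms in simp)
qed

lemma orb_fun_eq:
  assumes "S n \<le> w" "w < S (Suc n)"
  shows "orb_fun \<phi> s y w = \<phi> (y n) (w - S n)"
  by (simp add: orb_fun_def orb_idx_eqI[OF assms])

end

locale lip_orbit = roof_orbit +
  fixes \<phi> :: "nat \<Rightarrow> real \<Rightarrow> complex" and L :: real
  assumes s1: "\<And>i. s (y i) \<le> 1"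
    and lip: "\<And>j. L-lipschitz_on UNIV (\<phi> j)" and bd: "\<And>j t. cmod (\<phi> j t) \<le> L"
begin

abbreviation F :: "real \<Rightarrow> real \<Rightarrow> complex" where
  "F \<omega> w \<equiv> cis (- (2 * pi * (\<omega> * w))) * orb_fun \<phi> s y w"

lemma has_integral_piece:
  assumes "0 \<le> c" "c \<le> s (y n)"
  shows "(F \<omega> has_integral cis (- (2 * pi * (\<omega> * S n))) * fcoef c (\<phi> (y n)) \<omega>) {S n..S n + c}"
proof -
  let ?f = "\<lambda>t. cis (- (2 * pi * (\<omega> * t))) * \<phi> (y n) t"
  have "(?f has_integral fcoef c (\<phi> (y n)) \<omega>) {0..c}"
    unfolding fcoef_def
    by (intro integrable_integral integrable_continuous_real cont_modulated[OF lip bd])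
  then have "((\<lambda>t. cis (- (2 * pi * (\<omega> * S n))) * ?f t) has_integral cis (- (2 * pi * (\<omega> * S n))) * fcoef c (\<phi> (y n)) \<omega>) {0..c}"
    by (rule has_integral_mult_right)
  then have "(F \<omega> \<circ> (+) (S n) has_integral cis (- (2 * pi * (\<omega> * S n))) * fcoef c (\<phi> (y n)) \<omega>) {0..c}"
  \<comment> \<open>At height \<open>s (y n)\<close> the orbit already belongs to the next letter;
    this single point is discarded.\<close>
  proof (rule has_integral_spike_finite[rotated 2])
    show "finite {s (y n)}" by simp
    fix t assume "t \<in> {0..c} - {s (y n)}"
    then have "orb_fun \<phi> s y (S n + t) = \<phi> (y n) t"
      using assms by (subst orb_fun_eq[of n]) (auto simp: orb_sum_Suc)
    moreover have "cis (- (2 * pi * (\<omega> * (S n + t)))) = cis (- (2 * pi * (\<omega> * S n))) * cis (- (2 * pi * (\<omega> * t)))"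
      by (simp add: cis_mult algebra_simps)
    ultimately show "(F \<omega> \<circ> (+) (S n)) t = cis (- (2 * pi * (\<omega> * S n))) * ?f t"
      by (simp add: mult.assoc)
  qed
  then show ?thesis
    unfolding has_integral_shift_Icc_real by (simp add: add.commute)
qed

lemma wlen_orbit: "wlen s (map y [0..<n]) = S n"
  by (induction n) (simp_all add: orb_sum_Suc)

lemma has_integral_orbit:
  "(F \<omega> has_integral wsum s \<omega> (\<lambda>j. fcoef (s j) (\<phi> j) \<omega>) (map y [0..<n])) {0..S n}"
proof (induction n)
  case (Suc n)
  have "(F \<omega> has_integral cis (- (2 * pi * (\<omega> * S n))) * fcoef (s (y n)) (\<phi> (y n)) \<omega>) {S n..S n + s (y n)}"
    using s[of n] \<sigma> by (intro has_integral_piece) auto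
  then have "(F \<omega> has_integral wsum s \<omega> (\<lambda>j. fcoef (s j) (\<phi> j) \<omega>) (map y [0..<n])
      + cis (- (2 * pi * (\<omega> * S n))) * fcoef (s (y n)) (\<phi> (y n)) \<omega>) {0..S (Suc n)}"
    using Suc orb_sum_mono[of 0 n] s[of n] \<sigma> unfolding orb_sum_Suc
    by (intro has_integral_combine[of 0 "S n"]) auto
  then show ?case
    by (simp add: wsum_append wlen_orbit)
qed (simp add: has_integral_refl)

text \<open>The complete letters give the word sum; the incomplete last letter costs at most
  \<open>L\<close>, as its roof is at most \<open>1\<close>.\<close>

lemma integral_orbit_bound:
  assumes T: "0 \<le> T"
  obtains n where "real n * \<sigma> \<le> T" "F \<omega> integrable_on {0..T}"
    "cmod (integral {0..T} (F \<omega>)) \<le> cmod (wsum s \<omega> (\<lambda>j. fcoef (s j) (\<phi> j) \<omega>) (map y [0..<n])) + L"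
proof -
  define n where "n = orb_idx s y T"
  have n: "S n \<le> T" "T < S (Suc n)"
    using orb_idx_bounds[OF T] by (auto simp: n_def)
  have L: "0 \<le> L" using lip by (rule lipschitz_on_nonneg)
  have c: "0 \<le> T - S n" "T - S n \<le> s (y n)"
    using n by (auto simp: orb_sum_Suc)
  have *: "(F \<omega> has_integral wsum s \<omega> (\<lambda>j. fcoef (s j) (\<phi> j) \<omega>) (map y [0..<n])
      + cis (- (2 * pi * (\<omega> * S n))) * fcoef (T - S n) (\<phi> (y n)) \<omega>) {0..T}"
  proof (rule has_integral_combine[of 0 "S n"])
    show "0 \<le> S n" using orb_sum_mono[of 0 n] by simp
    show "(F \<omega> has_integral cis (- (2 * pi * (\<omega> * S n))) * fcoef (T - S n) (\<phi> (y n)) \<omega>) {S n..T}"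
      using has_integral_piece[OF c, of \<omega>] by simp
  qed (use n has_integral_orbit in auto)
  have le: "cmod (fcoef (T - S n) (\<phi> (y n)) \<omega>) \<le> L"
  proof -
    have "cmod (fcoef (T - S n) (\<phi> (y n)) \<omega>) \<le> L * (T - S n)"
      by (rule norm_fcoef_le[OF lip bd c(1)])
    also have "\<dots> \<le> L * 1"
      using c(2) s1[of n] L by (intro mult_left_mono) auto
    finally show ?thesis by simp
  qed
  show thesis
  proof (rule that[of n])
    show "real n * \<sigma> \<le> T" using orb_sum_ge[of n] n(1) by linarith
    show "F \<omega> integrable_on {0..T}" using * by blast
    show "cmod (integral {0..T} (F \<omega>)) \<le> cmod (wsum s \<omega> (\<lambda>j. fcoef (s j) (\<phi> j) \<omega>) (map y [0..<n])) + L"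
      unfolding integral_unique[OF *] by (rule order_trans[OF norm_triangle_ineq]) (use le in \<open>simp add: norm_mult\<close>)
  qed
qed

text \<open>A piece starting at height \<open>u\<close> is the difference of two pieces starting at
  height \<open>0\<close>, so word sums from the origin suffice, at the price of a factor
  \<open>2\<close>.\<close>

lemma integral_orbit_translate:
  assumes u: "0 \<le> u" and T: "0 \<le> T"
    and bound: "\<And>T'. 0 \<le> T' \<Longrightarrow> T' \<le> u + T \<Longrightarrow> cmod (integral {0..T'} (F \<omega>)) \<le> M"
  shows "(\<lambda>t. cis (- (2 * pi * (\<omega> * t))) * orb_fun \<phi> s y (u + t)) integrable_on {0..T}"
    and "cmod (integral {0..T} (\<lambda>t. cis (- (2 * pi * (\<omega> * t))) * orb_fun \<phi> s y (u + t))) \<le> 2 * M"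
proof -
  have int: "F \<omega> integrable_on {0..T'}" if "0 \<le> T'" for T'
    using integral_orbit_bound[OF that, of \<omega>] by blast
  have int': "F \<omega> integrable_on {u..u + T}"
    by (rule integrable_subinterval_real[OF int[of "u + T"]]) (use u T in auto)
  let ?I = "integral {u..u + T} (F \<omega>)"
  have "(F \<omega> has_integral ?I) {u..u + T}"
    using int' by (rule integrable_integral)
  then have "(F \<omega> \<circ> (+) u has_integral ?I) {0..T}"
    unfolding has_integral_shift_Icc_real by (simp add: add.commute)
  then have "((\<lambda>t. cis (2 * pi * (\<omega> * u)) * (F \<omega> \<circ> (+) u) t) has_integral cis (2 * pi * (\<omega> * u)) * ?I) {0..T}"
    by (rule has_integral_mult_right)
  moreover have "cis (2 * pi * (\<omega> * u)) * (F \<omega> \<circ> (+) u) t = cis (- (2 * pi * (\<omega> * t))) * orb_fun \<phi> s y (u + t)" for t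
  proof -
    have "cis (2 * pi * (\<omega> * u)) * cis (- (2 * pi * (\<omega> * (u + t)))) = cis (- (2 * pi * (\<omega> * t)))"
      by (simp add: cis_mult algebra_simps)
    then show ?thesis by (simp add: mult.assoc[symmetric])
  qed
  ultimately have *: "((\<lambda>t. cis (- (2 * pi * (\<omega> * t))) * orb_fun \<phi> s y (u + t)) has_integral cis (2 * pi * (\<omega> * u)) * ?I) {0..T}"
    by (simp only:)
  then show "(\<lambda>t. cis (- (2 * pi * (\<omega> * t))) * orb_fun \<phi> s y (u + t)) integrable_on {0..T}"
    by blast
  have "integral {0..u} (F \<omega>) + ?I = integral {0..u + T} (F \<omega>)"
    by (rule Henstock_Kurzweil_Integration.integral_combine) (use u T int in auto)
  then have "?I = integral {0..u + T} (F \<omega>) - integral {0..u} (F \<omega>)"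
    by (simp add: algebra_simps)
  then have "cmod ?I \<le> M + M"
    using norm_triangle_ineq4[of "integral {0..u + T} (F \<omega>)" "integral {0..u} (F \<omega>)"] bound[of "u + T"] bound[of u] u T
    by simp
  then show "cmod (integral {0..T} (\<lambda>t. cis (- (2 * pi * (\<omega> * t))) * orb_fun \<phi> s y (u + t))) \<le> 2 * M"
    unfolding integral_unique[OF *] by (simp add: norm_mult)
qed

end

section \<open>Spectral measures of intervals\<close>

text \<open>Orbit integrals are gauge integrals, whereas the order of integration is exchanged for
  Lebesgue integrals; a bounded measurable function supported in \<open>{0..R}\<close> allows
  both.\<close>

lemma Fubini_compact:
  fixes f :: "'a \<Rightarrow> real \<Rightarrow> complex"
  assumes M: "finite_measure M"
    and meas: "(\<lambda>(x, t). f x t) \<in> borel_measurable (M \<Otimes>\<^sub>M lborel)"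
    and bound: "\<And>x t. x \<in> space M \<Longrightarrow> cmod (f x t) \<le> C"
    and zero: "\<And>x t. x \<in> space M \<Longrightarrow> t \<notin> {0..R} \<Longrightarrow> f x t = 0"
  shows "(\<integral>t. (\<integral>x. f x t \<partial>M) \<partial>lborel) = (\<integral>x. integral {0..R} (f x) \<partial>M)"
    and "integrable M (\<lambda>x. integral {0..R} (f x))"
    and "x \<in> space M \<Longrightarrow> f x integrable_on {0..R}"
    and "(\<integral>z. f (fst z) (snd z) \<partial>(M \<Otimes>\<^sub>M lborel)) = (\<integral>x. integral {0..R} (f x) \<partial>M)"
proof -
  interpret M: finite_measure M by fact
  interpret pair_sigma_finite M "lborel :: real measure" ..
  have lb: "emeasure lborel {0..R} < \<infinity>"
    by (simp add: emeasure_lborel_Icc_eq)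
  have int: "integrable (M \<Otimes>\<^sub>M lborel) (\<lambda>(x, t). f x t)"
  proof (rule integrableI_bounded_set[where A = "space M \<times> {0..R}" and B = C])
    show "space M \<times> {0..R} \<in> sets (M \<Otimes>\<^sub>M lborel)" by simp
    have "emeasure (M \<Otimes>\<^sub>M lborel) (space M \<times> {0..R}) = emeasure M (space M) * emeasure lborel {0..R}"
      by (rule lborel.emeasure_pair_measure_Times) auto
    also have "\<dots> < \<infinity>"
      using lb M.emeasure_finite[of "space M", unfolded less_top] by (simp add: ennreal_mult_less_top)
    finally show "emeasure (M \<Otimes>\<^sub>M lborel) (space M \<times> {0..R}) < \<infinity>" .
    show "AE z in M \<Otimes>\<^sub>M lborel. z \<notin> space M \<times> {0..R} \<longrightarrow> (case z of (x, t) \<Rightarrow> f x t) = 0"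
    proof (rule AE_I2, rule impI)
      fix z assume "z \<in> space (M \<Otimes>\<^sub>M lborel)" "z \<notin> space M \<times> {0..R}"
      then have "fst z \<in> space M" "snd z \<notin> {0..R}"
        by (auto simp: space_pair_measure)
      then show "(case z of (x, t) \<Rightarrow> f x t) = 0"
        using zero by (simp add: case_prod_beta)
    qed
    show "AE z\<in>space M \<times> {0..R} in M \<Otimes>\<^sub>M lborel. cmod (case z of (x, t) \<Rightarrow> f x t) \<le> C"
      using bound by (auto intro!: AE_I2)
  qed (rule meas)
  have fx: "(\<integral>t. f x t \<partial>lborel) = integral {0..R} (f x)" "f x integrable_on {0..R}" if x: "x \<in> space M" for x
  proof -
    have "f x \<in> borel_measurable lborel"
      using measurable_compose[OF measurable_Pair1'[OF x] meas] by simp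
    then have i: "set_integrable lborel {0..R} (f x)"
      unfolding set_integrable_def
      by (intro integrableI_bounded_set[where A = "{0..R}" and B = C])
        (use lb in \<open>auto simp: bound x indicator_def intro!: AE_I2\<close>)
    show "f x integrable_on {0..R}"
      by (rule set_borel_integral_eq_integral[OF i])
    have "(\<integral>t. f x t \<partial>lborel) = (LINT t:{0..R}|lborel. f x t)"
      unfolding set_lebesgue_integral_def
      by (rule Bochner_Integration.integral_cong) (use zero[OF x] in \<open>auto simp: indicator_def\<close>)
    also have "\<dots> = integral {0..R} (f x)"
      by (rule set_borel_integral_eq_integral[OF i])
    finally show "(\<integral>t. f x t \<partial>lborel) = integral {0..R} (f x)" .
  qed
  show "(\<integral>t. (\<integral>x. f x t \<partial>M) \<partial>lborel) = (\<integral>x. integral {0..R} (f x) \<partial>M)"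
    using Fubini_integral[OF int] fx by (simp cong: Bochner_Integration.integral_cong)
  show "integrable M (\<lambda>x. integral {0..R} (f x))"
    using integrable_fst'[OF int] fx by (simp cong: Bochner_Integration.integrable_cong)
  show "x \<in> space M \<Longrightarrow> f x integrable_on {0..R}"
    by (rule fx)
  show "(\<integral>z. f (fst z) (snd z) \<partial>(M \<Otimes>\<^sub>M lborel)) = (\<integral>x. integral {0..R} (f x) \<partial>M)"
    using integral_fst'[OF int] fx by (simp add: case_prod_beta cong: Bochner_Integration.integral_cong)
qed

text \<open>Testing the correlation function against the tent \<open>(R - t) e\<^bsup>- 2 \<pi> \<i> \<omega> t\<^esup>\<close> on \<open>[0, R]\<close>
  only involves \<open>t \<ge> 0\<close>, and needs neither the group law nor the invariance of the flow.\<close>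

lemma spectral_measure_interval_le:
  fixes f :: "'a \<Rightarrow> complex" and H :: "'a \<Rightarrow> real \<Rightarrow> complex" and L K R \<omega> :: real
  assumes spec: "spectral_measure M h f \<sigma>" and M: "prob_space M"
    and f: "f \<in> borel_measurable M" "\<And>p. p \<in> space M \<Longrightarrow> cmod (f p) \<le> L"
    and H: "(\<lambda>(p, t). H p t) \<in> borel_measurable (M \<Otimes>\<^sub>M lborel)" "\<And>p t. cmod (H p t) \<le> L"
    and fh: "\<And>p t. p \<in> space M \<Longrightarrow> t \<in> {0..R} \<Longrightarrow> f (h t p) = H p t"
    and R: "0 < R"
    and int: "\<And>p. p \<in> space M \<Longrightarrow> (\<lambda>t. cis (- (2 * pi * (\<omega> * t))) * H p t) integrable_on {0..R}"
    and K: "\<And>p T. p \<in> space M \<Longrightarrow> T \<in> {0..R} \<Longrightarrow>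
      cmod (integral {0..T} (\<lambda>t. cis (- (2 * pi * (\<omega> * t))) * H p t)) \<le> K"
  shows "measure \<sigma> {\<omega> - 1 / (2 * pi * R)..\<omega> + 1 / (2 * pi * R)} \<le> 8 * L * K / R"
proof -
  interpret M: prob_space M by fact
  have \<sigma>: "sets \<sigma> = sets borel" "finite_measure \<sigma>"
    and four: "\<And>t. (\<integral>\<xi>. exp (2 * complex_of_real pi * \<i> * complex_of_real (\<xi> * t)) \<partial>\<sigma>) = (\<integral>p. f (h t p) * cnj (f p) \<partial>M)"
    using spec by (auto simp: spectral_measure_def)
  interpret \<sigma>: finite_measure \<sigma> by fact
  have cis: "exp (2 * complex_of_real pi * \<i> * complex_of_real x) = cis (2 * pi * x)" for x
    by (simp add: cis_conv_exp mult_ac)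
  have L: "0 \<le> L"
    using f(2) M.not_empty order_trans[OF norm_ge_zero] by blast
  let ?w = "\<lambda>t. indicator {0..R} t * (of_real (R - t) * cis (- (2 * pi * (\<omega> * t)))) :: complex"
  have w: "cmod (?w t) \<le> R" for t
    using R by (auto simp: norm_mult indicator_def simp del: of_real_diff)
  have wm: "?w \<in> borel_measurable borel"
    unfolding cis_conv_exp by measurable
  define f1 where "f1 \<xi> t = ?w t * cis (2 * pi * (\<xi> * t))" for \<xi> t
  \<comment> \<open>The product uses \<open>H\<close> in place of \<open>f (h t p)\<close>: joint
    measurability is assumed for \<open>H\<close>, and the two agree on the support of the
    weight.\<close>
  define f2 where "f2 p t = ?w t * (H p t * cnj (f p))" for p t
  have m1: "(\<lambda>(\<xi>, t). f1 \<xi> t) \<in> borel_measurable (\<sigma> \<Otimes>\<^sub>M lborel)"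
  proof -
    have "(\<lambda>z. f1 (fst z) (snd z)) \<in> borel_measurable (borel \<Otimes>\<^sub>M borel)"
      unfolding f1_def cis_conv_exp by measurable
    moreover have "sets (\<sigma> \<Otimes>\<^sub>M lborel) = sets (borel \<Otimes>\<^sub>M borel :: (real \<times> real) measure)"
      by (intro sets_pair_measure_cong \<sigma>) simp
    ultimately show ?thesis
      by (simp add: case_prod_beta cong: measurable_cong_sets)
  qed
  have m2: "(\<lambda>(p, t). f2 p t) \<in> borel_measurable (M \<Otimes>\<^sub>M lborel)"
  proof -
    have [measurable]: "(\<lambda>z. H (fst z) (snd z)) \<in> borel_measurable (M \<Otimes>\<^sub>M lborel)"
      using H(1) by (simp add: case_prod_beta)
    have "(\<lambda>p. cnj (f p)) \<in> borel_measurable M"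
      by (rule borel_measurable_continuous_on[OF _ f(1)]) (intro continuous_intros)
    note [measurable] = this
    have "(\<lambda>z. cnj (f (fst z))) \<in> borel_measurable (M \<Otimes>\<^sub>M lborel)"
      by measurable
    note [measurable] = this
    have "(\<lambda>z. ?w (snd z)) \<in> borel_measurable (M \<Otimes>\<^sub>M lborel)"
      by (rule measurable_compose[OF _ wm]) simp
    then have "(\<lambda>z. ?w (snd z) * (H (fst z) (snd z) * cnj (f (fst z)))) \<in> borel_measurable (M \<Otimes>\<^sub>M lborel)"
      by measurable
    then show ?thesis by (simp add: f2_def case_prod_beta)
  qed
  have b1: "cmod (f1 \<xi> t) \<le> R" for \<xi> t
    unfolding f1_def norm_mult[of "?w t"] using w[of t] by simp
  have b2: "cmod (f2 p t) \<le> R * (L * L)" if "p \<in> space M" for p t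
    unfolding f2_def norm_mult[of "?w t"] norm_mult[of "H p t"] complex_mod_cnj
    using w[of t] H(2)[of p t] f(2)[OF that] L R by (intro mult_mono) auto
  note F1 = Fubini_compact[OF \<sigma>(2) m1 b1, of R]
  note F2 = Fubini_compact[OF M.finite_measure_axioms m2 b2, of R]
  have z: "f1 \<xi> t = 0" "f2 p t = 0" if "t \<notin> {0..R}" for \<xi> p t
    using that by (auto simp: f1_def f2_def)
  have "(\<integral>\<xi>. integral {0..R} (f1 \<xi>) \<partial>\<sigma>) = (\<integral>t. (\<integral>\<xi>. f1 \<xi> t \<partial>\<sigma>) \<partial>lborel)"
    by (rule F1(1)[symmetric]) (auto intro: z)
  also have "\<dots> = (\<integral>t. (\<integral>p. f2 p t \<partial>M) \<partial>lborel)"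
  proof (rule Bochner_Integration.integral_cong[OF refl])
    fix t
    have "(\<integral>\<xi>. f1 \<xi> t \<partial>\<sigma>) = ?w t * (\<integral>\<xi>. cis (2 * pi * (\<xi> * t)) \<partial>\<sigma>)"
      unfolding f1_def by simp
    also have "\<dots> = ?w t * (\<integral>p. f (h t p) * cnj (f p) \<partial>M)"
      using four[of t] by (simp only: cis)
    also have "\<dots> = ?w t * (\<integral>p. H p t * cnj (f p) \<partial>M)"
    proof (cases "t \<in> {0..R}")
      case True
      have "(\<integral>p. f (h t p) * cnj (f p) \<partial>M) = (\<integral>p. H p t * cnj (f p) \<partial>M)"
        by (rule Bochner_Integration.integral_cong) (use fh True in auto)
      then show ?thesis by simp
    qed simp
    also have "\<dots> = (\<integral>p. f2 p t \<partial>M)"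
      unfolding f2_def by simp
    finally show "(\<integral>\<xi>. f1 \<xi> t \<partial>\<sigma>) = (\<integral>p. f2 p t \<partial>M)" .
  qed
  also have "\<dots> = (\<integral>p. integral {0..R} (f2 p) \<partial>M)"
    by (rule F2(1)) (auto intro: z)
  finally have eq: "(\<integral>\<xi>. integral {0..R} (f1 \<xi>) \<partial>\<sigma>) = (\<integral>p. integral {0..R} (f2 p) \<partial>M)" .
  have i1: "integrable \<sigma> (\<lambda>\<xi>. integral {0..R} (f1 \<xi>))"
    by (rule F1(2)) (auto intro: z)
  have i2: "integrable M (\<lambda>p. integral {0..R} (f2 p))"
    by (rule F2(2)) (auto intro: z)
  let ?I = "{\<omega> - 1 / (2 * pi * R)..\<omega> + 1 / (2 * pi * R)}"
  have re: "Re (integral {0..R} (f1 \<xi>)) = integral {0..R} (\<lambda>t. (R - t) * cos (2 * pi * (\<xi> - \<omega>) * t))" for \<xi>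
  proof -
    have "space \<sigma> = UNIV"
      using sets_eq_imp_space_eq[OF \<sigma>(1)] by simp
    then have "f1 \<xi> integrable_on {0..R}"
      by (intro F1(3)) (auto intro: z)
    then have "Re (integral {0..R} (f1 \<xi>)) = integral {0..R} (Re \<circ> f1 \<xi>)"
      by (rule integral_linear[symmetric]) (rule bounded_linear_Re)
    also have "\<dots> = integral {0..R} (\<lambda>t. (R - t) * cos (2 * pi * (\<xi> - \<omega>) * t))"
    proof (rule Henstock_Kurzweil_Integration.integral_cong)
      fix t assume "t \<in> {0..R}"
      then have "f1 \<xi> t = of_real (R - t) * cis (2 * pi * (\<xi> - \<omega>) * t)"
        by (simp add: f1_def mult.assoc cis_mult algebra_simps)
      then show "(Re \<circ> f1 \<xi>) t = (R - t) * cos (2 * pi * (\<xi> - \<omega>) * t)"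
        by simp
    qed
    finally show ?thesis .
  qed
  \<comment> \<open>The radius \<open>1 / (2 * pi * R)\<close> is the one for which the argument of
    the cosine stays at most \<open>1\<close> in modulus on \<open>{0..R}\<close>. Off the interval
    the nonnegativity of the kernel is enough.\<close>
  have low: "R\<^sup>2 / 4 * indicator ?I \<xi> \<le> Re (integral {0..R} (f1 \<xi>))" for \<xi>
  proof (cases "\<xi> \<in> ?I")
    case True
    then have "\<bar>\<xi> - \<omega>\<bar> \<le> 1 / (2 * pi * R)" by auto
    then have "2 * pi * R * \<bar>\<xi> - \<omega>\<bar> \<le> 2 * pi * R * (1 / (2 * pi * R))"
      using R by (intro mult_left_mono) auto
    also have "\<dots> = 1" using R by simp
    finally have "\<bar>2 * pi * (\<xi> - \<omega>)\<bar> * R \<le> 1"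
      by (simp only: abs_mult abs_numeral abs_of_pos[OF pi_gt_zero] mult_ac)
    then show ?thesis
      unfolding re using tent_cos_integral(2)[of R "2 * pi * (\<xi> - \<omega>)"] R True by simp
  qed (use tent_cos_integral(1) R re in simp)
  have "measure \<sigma> ?I * (R\<^sup>2 / 4) = (\<integral>\<xi>. R\<^sup>2 / 4 * indicator ?I \<xi> \<partial>\<sigma>)"
    using \<sigma>(1) sets_eq_imp_space_eq[OF \<sigma>(1)] by simp
  also have "\<dots> \<le> (\<integral>\<xi>. Re (integral {0..R} (f1 \<xi>)) \<partial>\<sigma>)"
    using \<sigma>(1) i1 low by (intro integral_mono) (auto simp: less_top[symmetric] \<sigma>.emeasure_finite)
  also have "\<dots> = Re (\<integral>\<xi>. integral {0..R} (f1 \<xi>) \<partial>\<sigma>)"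
    using i1 by simp
  also have "\<dots> \<le> cmod (\<integral>p. integral {0..R} (f2 p) \<partial>M)"
    unfolding eq by (rule complex_Re_le_cmod)
  also have "\<dots> \<le> (\<integral>p. cmod (integral {0..R} (f2 p)) \<partial>M)"
    by (rule integral_norm_bound)
  also have "\<dots> \<le> (\<integral>p. 2 * R * K * L \<partial>M)"
  proof (rule integral_mono)
    fix p assume p: "p \<in> space M"
    have "integral {0..R} (f2 p) = integral {0..R} (\<lambda>t. (of_real (R - t) * (cis (- (2 * pi * (\<omega> * t))) * H p t)) * cnj (f p))"
      by (rule Henstock_Kurzweil_Integration.integral_cong) (simp add: f2_def)
    also have "\<dots> = integral {0..R} (\<lambda>t. of_real (R - t) * (cis (- (2 * pi * (\<omega> * t))) * H p t)) * cnj (f p)"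
      by (rule integral_mult_left)
    finally have "cmod (integral {0..R} (f2 p))
        = cmod (integral {0..R} (\<lambda>t. of_real (R - t) * (cis (- (2 * pi * (\<omega> * t))) * H p t))) * cmod (f p)"
      by (simp only: norm_mult complex_mod_cnj)
    also have "\<dots> \<le> (2 * R * K) * L"
    proof -
      have tent: "cmod (integral {0..R} (\<lambda>t. of_real (R - t) * (cis (- (2 * pi * (\<omega> * t))) * H p t))) \<le> 2 * R * K"
        by (rule norm_integral_tent_le[OF _ int[OF p] K[OF p]]) (use R in simp_all)
      show ?thesis
        by (rule mult_mono[OF tent f(2)[OF p] order_trans[OF norm_ge_zero tent] norm_ge_zero])
    qed
    finally show "cmod (integral {0..R} (f2 p)) \<le> 2 * R * K * L" .
  qed (use i2 in auto)
  also have "\<dots> = 2 * R * K * L"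
    by (simp add: M.prob_space)
  finally have "measure \<sigma> ?I * (R\<^sup>2 / 4) \<le> 2 * R * K * L" .
  then show ?thesis
    using R by (simp add: field_simps power2_eq_square)
qed

section \<open>Lip-cylindrical functions\<close>

text \<open>The extension by boundary values keeps the Lipschitz constant and the supremum, so that
  later integrals can use bounds on the whole line.\<close>

definition clamp_fun :: "real \<Rightarrow> (real \<Rightarrow> complex) \<Rightarrow> real \<Rightarrow> complex" where
  "clamp_fun b g t = g (max 0 (min b t))"

lemma clamp_fun_lipschitz:
  assumes "0 \<le> b" "K-lipschitz_on {0..b} g"
  shows "K-lipschitz_on UNIV (clamp_fun b g)"
proof (rule lipschitz_onI)
  show "0 \<le> K" using assms(2) by (rule lipschitz_on_nonneg)
  fix t u :: real
  have "dist (clamp_fun b g t) (clamp_fun b g u) \<le> K * dist (max 0 (min b t)) (max 0 (min b u))"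
    unfolding clamp_fun_def by (rule lipschitz_onD[OF assms(2)]) (use assms(1) in auto)
  also have "\<dots> \<le> K * dist t u"
    using \<open>0 \<le> K\<close> by (intro mult_left_mono) (auto simp: dist_real_def)
  finally show "dist (clamp_fun b g t) (clamp_fun b g u) \<le> K * dist t u" .
qed

text \<open>The infimum of the Lipschitz constants lies strictly below
  \<open>lip_norm b g + 1\<close>, so some Lipschitz constant does too.\<close>

lemma lip_norm_bounds:
  assumes b: "0 \<le> b" and lip: "\<exists>K. K-lipschitz_on {0..b} g"
  shows "t \<in> {0..b} \<Longrightarrow> cmod (g t) \<le> lip_norm b g"
    and "(lip_norm b g + 1)-lipschitz_on {0..b} g"
proof -
  obtain K0 where K0: "K0-lipschitz_on {0..b} g"
    using lip by blast
  let ?S = "{K. K-lipschitz_on {0..b} g}"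
  have inf: "0 \<le> Inf ?S"
    using K0 by (intro cInf_greatest) (auto intro: lipschitz_on_nonneg)
  have "compact (g ` {0..b})"
    by (intro compact_continuous_image lipschitz_on_continuous_on[OF K0]) simp
  then have bdd: "bdd_above ((\<lambda>t. cmod (g t)) ` {0..b})"
    using compact_imp_bounded[of "g ` {0..b}"] by (auto simp: bounded_iff bdd_above_def)
  have sup: "cmod (g t) \<le> (SUP t\<in>{0..b}. cmod (g t))" if "t \<in> {0..b}" for t
    by (rule cSUP_upper[OF that bdd])
  show "t \<in> {0..b} \<Longrightarrow> cmod (g t) \<le> lip_norm b g"
    using sup inf unfolding lip_norm_def by fastforce
  have "0 \<le> (SUP t\<in>{0..b}. cmod (g t))"
    by (rule order_trans[OF norm_ge_zero sup[of 0]]) (use b in simp)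
  then have "Inf ?S < lip_norm b g + 1"
    by (simp add: lip_norm_def)
  then obtain K where "K \<in> ?S" "K < lip_norm b g + 1"
    using cInf_lessD[of ?S "lip_norm b g + 1"] K0 by blast
  then show "(lip_norm b g + 1)-lipschitz_on {0..b} g"
    by (auto intro: lipschitz_on_mono)
qed

text \<open>Indices outside the alphabet get the zero function, so that the bounds hold for every
  \<open>j\<close>.\<close>

definition clamp_family :: "nat \<Rightarrow> (nat \<Rightarrow> real) \<Rightarrow> (nat \<Rightarrow> real \<Rightarrow> complex) \<Rightarrow> nat \<Rightarrow> real \<Rightarrow> complex" where
  "clamp_family m s \<psi> j = (if j < m then clamp_fun (s j) (\<psi> j) else (\<lambda>_. 0))"

lemma clamp_family_bounds:
  assumes s: "\<And>j. j < m \<Longrightarrow> 0 \<le> s j" and fam: "lip_family m s \<psi>"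
  defines "L \<equiv> \<bar>lip_cyl_norm m s \<psi>\<bar> + 1"
  shows "L-lipschitz_on UNIV (clamp_family m s \<psi> j)" "cmod (clamp_family m s \<psi> j t) \<le> L"
proof -
  have le: "lip_norm (s j) (\<psi> j) + 1 \<le> L" if "j < m" for j
  proof -
    have "lip_norm (s j) (\<psi> j) \<le> lip_cyl_norm m s \<psi>"
      unfolding lip_cyl_norm_def by (rule Max_ge) (use that in auto)
    then show ?thesis by (simp add: L_def)
  qed
  have L: "0 \<le> L" by (simp add: L_def)
  have ex: "\<exists>K. K-lipschitz_on {0..s j} (\<psi> j)" if "j < m" for j
    using fam that by (simp add: lip_family_def)
  show "L-lipschitz_on UNIV (clamp_family m s \<psi> j)"
  proof (cases "j < m")
    case True
    have "L-lipschitz_on {0..s j} (\<psi> j)"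
      using lip_norm_bounds(2)[OF s[OF True] ex[OF True]] le[OF True] by (rule lipschitz_on_le)
    then show ?thesis
      using True s by (simp add: clamp_family_def clamp_fun_lipschitz)
  qed (use L in \<open>simp add: clamp_family_def lipschitz_on_def\<close>)
  show "cmod (clamp_family m s \<psi> j t) \<le> L"
  proof (cases "j < m")
    case True
    have "cmod (\<psi> j (max 0 (min (s j) t))) \<le> lip_norm (s j) (\<psi> j)"
      using s[OF True] by (intro lip_norm_bounds(1) ex True) auto
    then show ?thesis
      using le[OF True] True by (simp add: clamp_family_def clamp_fun_def)
  qed (use L in \<open>simp add: clamp_family_def\<close>)
qed

lemma clamp_family_eq: "j < m \<Longrightarrow> 0 \<le> t \<Longrightarrow> t \<le> s j \<Longrightarrow> clamp_family m s \<psi> j t = \<psi> j t"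
  by (simp add: clamp_family_def clamp_fun_def)

section \<open>The suspension flow in coordinates\<close>

lemma roof_sum_nat: "roof_sum s x (int n) = orb_sum s (\<lambda>i. x (int i)) n"
proof -
  have "{0..<int n} = int ` {..<n}"
    by (metis image_int_atLeastLessThan lessThan_atLeast0 of_nat_0)
  then show ?thesis
    by (simp add: roof_sum_def orb_sum_def sum.reindex)
qed

lemma roof_sum_step: "roof_sum s x (n + 1) = roof_sum s x n + s (x n)"
proof (cases "0 \<le> n")
  case True
  then have "{0..<n + 1} = insert n {0..<n}" by auto
  then show ?thesis using True by (simp add: roof_sum_def)
next
  case False
  then have "{n..<0} = insert n {n + 1..<0}" by auto
  then show ?thesis using False by (auto simp: roof_sum_def)
qed

lemma roof_sum_mono:
  assumes "\<And>i. 0 \<le> s (x i)" "k \<le> n"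
  shows "roof_sum s x k \<le> roof_sum s x n"
  using assms(2)
proof (induction n rule: int_ge_induct)
  case (step i)
  then show ?case using assms(1)[of i] by (simp add: roof_sum_step)
qed simp

text \<open>For a positive roof the sums \<open>roof_sum s x\<close> increase over all integers, so
  the index that defines the flow is unique; for \<open>0 \<le> u + t\<close> it is the natural
  number found by \<open>orb_idx\<close>.\<close>

lemma susp_flow_eq:
  assumes \<sigma>: "0 < \<sigma>" and s: "\<And>i. \<sigma> \<le> s (x i)" and u: "0 \<le> u + t"
  defines "y \<equiv> \<lambda>i. x (int i)"
  defines "n \<equiv> orb_idx s y (u + t)"
  shows "susp_flow s t (x, u) = (shift (int n) x, u + t - orb_sum s y n)"
proof -
  have s0: "0 \<le> s (x i)" for i
    using s[of i] \<sigma> by linarith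
  interpret roof_orbit s y \<sigma>
    by unfold_locales (auto simp: \<sigma> s y_def)
  have r: "roof_sum s x (int k) = orb_sum s y k" for k
    unfolding y_def by (rule roof_sum_nat)
  have "(THE k. roof_sum s x k \<le> u + t \<and> u + t < roof_sum s x (k + 1)) = int n"
  proof (rule the_equality)
    show "roof_sum s x (int n) \<le> u + t \<and> u + t < roof_sum s x (int n + 1)"
      using orb_idx_bounds[OF u] r[of n] r[of "Suc n"] by (simp add: n_def add.commute)
    fix k assume k: "roof_sum s x k \<le> u + t \<and> u + t < roof_sum s x (k + 1)"
    have bounds: "roof_sum s x (int n) \<le> u + t" "u + t < roof_sum s x (int n + 1)"
      using orb_idx_bounds[OF u] r[of n] r[of "Suc n"] by (simp_all add: n_def add.commute)
    have mono: "roof_sum s x i \<le> roof_sum s x j" if "i \<le> j" for i j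
      using that by (intro roof_sum_mono s0)
    show "k = int n"
    proof (rule ccontr)
      assume "k \<noteq> int n"
      then consider "k + 1 \<le> int n" | "int n + 1 \<le> k" by linarith
      then show False
        by cases (use mono[of "k + 1" "int n"] mono[of "int n + 1" k] bounds k in linarith)+
    qed
  qed
  then show ?thesis
    by (simp add: susp_flow_def r)
qed

text \<open>Points of the suspension satisfy \<open>t < s (x 0)\<close>, while the Fourier
  coefficient integrates over the closed interval; the two differ in one point.\<close>

lemma fcoef_0_indicator:
  assumes b: "0 \<le> b" "b \<le> 1" and \<phi>: "K-lipschitz_on UNIV \<phi>"
  shows "integral {0..1} (\<lambda>t. if 0 \<le> t \<and> t < b then \<phi> t else 0) = fcoef b \<phi> 0"
proof -
  have "continuous_on {0..b} \<phi>"
    using lipschitz_on_continuous_on[OF \<phi>] by (rule continuous_on_subset) simp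
  then have "(\<phi> has_integral integral {0..b} \<phi>) {0..b}"
    by (intro integrable_integral integrable_continuous_real)
  then have "((\<lambda>t. if t \<in> {0..b} then \<phi> t else 0) has_integral integral {0..b} \<phi>) {0..1}"
    using b by (subst has_integral_restrict) auto
  then have "((\<lambda>t. if 0 \<le> t \<and> t < b then \<phi> t else 0) has_integral integral {0..b} \<phi>) {0..1}"
    by (rule has_integral_spike_finite[of "{b}", rotated 2]) auto
  then show ?thesis
    by (simp add: integral_unique fcoef_def)
qed

context primitive_substitution
begin

context
  fixes \<mu> :: "(int \<Rightarrow> nat) measure" and s :: "nat \<Rightarrow> real" and \<psi> :: "nat \<Rightarrow> real \<Rightarrow> complex"
    and L \<sigma> :: real and \<phi> :: "nat \<Rightarrow> real \<Rightarrow> complex" and M :: "((int \<Rightarrow> nat) \<times> real) measure"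
  assumes \<mu>: "subst_measure m \<zeta> \<mu>" and fam: "lip_family m s \<psi>"
    and \<sigma>: "0 < \<sigma>" and s: "\<And>j. j < m \<Longrightarrow> \<sigma> \<le> s j" "\<And>j. j < m \<Longrightarrow> s j \<le> 1"
  defines "L \<equiv> \<bar>lip_cyl_norm m s \<psi>\<bar> + 1"
    and "\<phi> \<equiv> clamp_family m s \<psi>"
    and "M \<equiv> susp_measure m \<zeta> \<mu> s"
begin

lemma s_nonneg: "j < m \<Longrightarrow> 0 \<le> s j"
  using s(1)[of j] \<sigma> by linarith

lemma lip_\<phi>: "L-lipschitz_on UNIV (\<phi> j)" and bound_\<phi>: "cmod (\<phi> j t) \<le> L"
  unfolding L_def \<phi>_def by (rule clamp_family_bounds[OF s_nonneg fam], assumption)+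

lemma \<mu>_props: "space \<mu> = subst_space m \<zeta>" "sets \<mu> = sets (restrict_space borel (subst_space m \<zeta>))"
  "emeasure \<mu> (space \<mu>) = 1"
  using \<mu> by (auto simp: subst_measure_def)

lemma prob_\<mu>: "prob_space \<mu>"
  by (rule prob_spaceI) (rule \<mu>_props)

lemma coord_measurable [measurable]: "(\<lambda>x. x i) \<in> measurable \<mu> (count_space UNIV)"
  by (rule measurable_coordinate[OF \<mu>_props(2,1)])

lemma orbit_letters: "x \<in> subst_space m \<zeta> \<Longrightarrow> \<sigma> \<le> s (x i)" "x \<in> subst_space m \<zeta> \<Longrightarrow> s (x i) \<le> 1"
  using s subst_space_letters by blast+

lemma susp_space_eq:
  "susp_space m \<zeta> s = {z \<in> space (\<mu> \<Otimes>\<^sub>M lborel). 0 \<le> snd z \<and> snd z < s (fst z 0)}"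
  by (auto simp: susp_space_def space_pair_measure \<mu>_props)

lemma susp_space_sets: "susp_space m \<zeta> s \<in> sets (\<mu> \<Otimes>\<^sub>M lborel)"
  unfolding susp_space_eq by measurable

text \<open>The suspension lies between the boxes of heights \<open>\<sigma>\<close> and
  \<open>1\<close> over the base, so that normalizing it yields a probability measure.\<close>

lemma emeasure_susp_space: "emeasure (\<mu> \<Otimes>\<^sub>M lborel) (susp_space m \<zeta> s) \<noteq> 0"
  "emeasure (\<mu> \<Otimes>\<^sub>M lborel) (susp_space m \<zeta> s) \<noteq> \<infinity>"
proof -
  interpret prob_space \<mu> by (rule prob_\<mu>)
  have box: "emeasure (\<mu> \<Otimes>\<^sub>M lborel) (space \<mu> \<times> {0..<c}) = ennreal c" if "0 \<le> c" for c :: real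
    using that \<mu>_props(3) by (subst lborel.emeasure_pair_measure_Times) auto
  have "space \<mu> \<times> {0..<\<sigma>} \<subseteq> susp_space m \<zeta> s"
    using orbit_letters(1) by (auto simp: susp_space_def \<mu>_props intro: less_le_trans)
  then have "emeasure (\<mu> \<Otimes>\<^sub>M lborel) (space \<mu> \<times> {0..<\<sigma>}) \<le> emeasure (\<mu> \<Otimes>\<^sub>M lborel) (susp_space m \<zeta> s)"
    by (rule emeasure_mono) (rule susp_space_sets)
  then show "emeasure (\<mu> \<Otimes>\<^sub>M lborel) (susp_space m \<zeta> s) \<noteq> 0"
    using \<sigma> box[of \<sigma>] by auto
  have "susp_space m \<zeta> s \<subseteq> space \<mu> \<times> {0..<1::real}"
    by (auto simp: susp_space_def \<mu>_props intro: less_le_trans[OF _ orbit_letters(2)])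
  then have "emeasure (\<mu> \<Otimes>\<^sub>M lborel) (susp_space m \<zeta> s) \<le> emeasure (\<mu> \<Otimes>\<^sub>M lborel) (space \<mu> \<times> {0..<1::real})"
    by (rule emeasure_mono) simp
  also have "\<dots> = ennreal 1" by (rule box) simp
  finally have le: "emeasure (\<mu> \<Otimes>\<^sub>M lborel) (susp_space m \<zeta> s) \<le> ennreal 1" .
  show "emeasure (\<mu> \<Otimes>\<^sub>M lborel) (susp_space m \<zeta> s) \<noteq> \<infinity>"
    using neq_top_trans[OF ennreal_neq_top le] by simp
qed

lemma sets_M: "sets M = sets (restrict_space (\<mu> \<Otimes>\<^sub>M lborel) (susp_space m \<zeta> s))"
  and space_M: "space M = susp_space m \<zeta> s"
  using sets.sets_into_space[OF susp_space_sets]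
  by (auto simp: M_def susp_measure_def uniform_measure_def space_restrict_space)

lemma prob_M: "prob_space M"
  unfolding M_def susp_measure_def
  by (rule prob_space_uniform_measure) (use emeasure_susp_space susp_space_sets in \<open>auto simp: emeasure_restrict_space\<close>)

lemma ident_M: "(\<lambda>z. z) \<in> measurable M (\<mu> \<Otimes>\<^sub>M lborel)"
  unfolding measurable_cong_sets[OF sets_M refl] by (rule measurable_restrict_space1) simp

text \<open>This describes the function along the flow by a formula whose joint measurability is
  visible, unlike that of the \<open>THE\<close> in the flow.\<close>

definition H :: "(int \<Rightarrow> nat) \<times> real \<Rightarrow> real \<Rightarrow> complex" where
  "H p t = orb_fun \<phi> s (\<lambda>i. fst p (int i)) (snd p + t)"

lemma norm_H_le: "cmod (H p t) \<le> L"
  by (simp add: H_def orb_fun_def bound_\<phi>)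

lemma H_measurable: "(\<lambda>(p, t). H p t) \<in> borel_measurable (M \<Otimes>\<^sub>M lborel)"
proof -
  let ?N = "M \<Otimes>\<^sub>M (lborel :: real measure)"
  have fst: "fst \<in> measurable ?N M" by (rule measurable_fst)
  have p: "fst \<in> measurable ?N (\<mu> \<Otimes>\<^sub>M lborel)"
    using measurable_comp[OF fst ident_M] by (simp add: o_def)
  have [measurable]: "(\<lambda>z. fst (fst z) i) \<in> measurable ?N (count_space UNIV)" for i
    using measurable_compose[OF measurable_compose[OF p measurable_fst] coord_measurable] by simp
  have u: "(\<lambda>z. snd (fst z)) \<in> borel_measurable ?N"
    using measurable_compose[OF p measurable_snd] by simp
  have "snd \<in> measurable ?N lborel" by (rule measurable_snd)
  then have w [measurable]: "(\<lambda>z. snd (fst z) + snd z) \<in> borel_measurable ?N"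
    by (intro borel_measurable_add u) simp
  have sum [measurable]: "(\<lambda>z. orb_sum s (\<lambda>i. fst (fst z) (int i)) n) \<in> borel_measurable ?N" for n
    unfolding orb_sum_def by measurable
  have idx: "(\<lambda>z. orb_idx s (\<lambda>i. fst (fst z) (int i)) (snd (fst z) + snd z)) \<in> measurable ?N (count_space UNIV)"
    unfolding orb_idx_def by measurable
  have \<phi>m: "\<phi> j \<in> borel_measurable borel" for j
    by (intro borel_measurable_continuous_onI lipschitz_on_continuous_on[OF lip_\<phi>])
  \<comment> \<open>Both the letter and its index take countably many values, so measurability is
    checked for each value separately.\<close>
  have "(\<lambda>z. \<phi> (fst (fst z) (int n)) (snd (fst z) + snd z - orb_sum s (\<lambda>i. fst (fst z) (int i)) n)) \<in> borel_measurable ?N" for n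
    by (rule measurable_compose_countable[where g = "\<lambda>z. fst (fst z) (int n)"]) (use \<phi>m in measurable)
  then have "(\<lambda>z. H (fst z) (snd z)) \<in> borel_measurable ?N"
    unfolding H_def orb_fun_def by (rule measurable_compose_countable[OF _ idx])
  then show ?thesis by (simp add: case_prod_beta)
qed

lemma lip_cyl_flow:
  assumes p: "p \<in> space M" and t: "0 \<le> t"
  shows "lip_cyl \<psi> (susp_flow s t p) = H p t"
proof -
  obtain x u where xu: "p = (x, u)" "x \<in> subst_space m \<zeta>" "0 \<le> u" "u < s (x 0)"
    using p by (auto simp: space_M susp_space_def)
  define y where "y = (\<lambda>i. x (int i))"
  interpret roof_orbit s y \<sigma>
    by unfold_locales (auto simp: \<sigma> y_def orbit_letters xu)
  define n where "n = orb_idx s y (u + t)"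
  have ut: "0 \<le> u + t" using xu t by simp
  have "susp_flow s t p = (shift (int n) x, u + t - orb_sum s y n)"
    unfolding xu(1) n_def y_def by (rule susp_flow_eq[where \<sigma> = \<sigma> and s = s and x = x and u = u and t = t, OF \<sigma> orbit_letters(1)[OF xu(2)] ut])
  then have "lip_cyl \<psi> (susp_flow s t p) = \<psi> (y n) (u + t - orb_sum s y n)"
    by (simp add: lip_cyl_def shift_def y_def)
  also have "\<dots> = \<phi> (y n) (u + t - orb_sum s y n)"
  proof -
    have "orb_sum s y n \<le> u + t" "u + t < orb_sum s y n + s (y n)"
      using orb_idx_bounds[OF ut] orb_sum_Suc[of n] by (simp_all add: n_def)
    moreover have "y n < m"
      using subst_space_letters[OF xu(2)] by (simp add: y_def)
    ultimately show ?thesis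
      unfolding \<phi>_def by (intro clamp_family_eq[symmetric]) auto
  qed
  also have "\<dots> = H p t"
    by (simp add: H_def xu(1) orb_fun_def y_def n_def)
  finally show ?thesis .
qed

lemma lip_cyl_eq:
  assumes "p \<in> space M"
  shows "lip_cyl \<psi> p = \<phi> (fst p 0) (snd p)" "lip_cyl \<psi> p = H p 0"
proof -
  obtain x u where xu: "p = (x, u)" "x \<in> subst_space m \<zeta>" "0 \<le> u" "u < s (x 0)"
    using assms by (auto simp: space_M susp_space_def)
  show 1: "lip_cyl \<psi> p = \<phi> (fst p 0) (snd p)"
    using clamp_family_eq[of "x 0" m u s \<psi>] xu subst_space_letters[OF xu(2)] by (simp add: lip_cyl_def \<phi>_def)
  interpret roof_orbit s "\<lambda>i. x (int i)" \<sigma>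
    by unfold_locales (auto simp: \<sigma> orbit_letters xu)
  show "lip_cyl \<psi> p = H p 0"
    unfolding 1 using xu orb_fun_eq[of 0 u \<phi>] by (simp add: H_def orb_sum_Suc)
qed

lemma lip_cyl_measurable: "lip_cyl \<psi> \<in> borel_measurable M"
proof -
  have 0: "(\<lambda>p. (p, 0 :: real)) \<in> measurable M (M \<Otimes>\<^sub>M lborel)" by measurable
  have "(\<lambda>p. H p 0) \<in> borel_measurable M"
    using measurable_comp[OF 0 H_measurable] by (simp add: o_def)
  then show ?thesis
    using lip_cyl_eq(2) by (simp cong: measurable_cong)
qed

text \<open>By Fubini the integral over a fibre is the Fourier coefficient at frequency
  \<open>0\<close> of the letter below it, so up to normalization the mean on the suspension becomes
  a mean on the base.\<close>

lemma integral_lip_cyl_eq_0: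
  assumes "(\<integral>p. lip_cyl \<psi> p \<partial>M) = 0"
  shows "(\<integral>x. fcoef (s (x 0)) (\<phi> (x 0)) 0 \<partial>\<mu>) = 0"
proof -
  interpret prob_space \<mu> by (rule prob_\<mu>)
  let ?X = "susp_space m \<zeta> s"
  let ?P = "\<mu> \<Otimes>\<^sub>M (lborel :: real measure)"
  let ?N = "restrict_space ?P ?X"
  have X: "?X \<inter> space ?P \<in> sets ?P" "?X \<subseteq> space ?P"
    using susp_space_sets sets.sets_into_space[OF susp_space_sets] by auto
  have XN: "?X \<in> sets ?N" "emeasure ?N ?X = emeasure ?P ?X"
    using susp_space_sets by (auto simp: sets_restrict_space_iff emeasure_restrict_space X)
  define v where "v = measure ?N ?X"
  have v: "0 < v" "emeasure ?N ?X = ennreal v"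
    using emeasure_susp_space by (auto simp: v_def measure_def XN enn2real_positive_iff less_top zero_less_iff_neq_zero)
  define f where "f x t = (if 0 \<le> t \<and> t < s (x 0) then \<phi> (x 0) t else 0)" for x :: "int \<Rightarrow> nat" and t
  have f_eq: "f (fst z) (snd z) = indicator ?X z *\<^sub>R lip_cyl \<psi> z" if "z \<in> space ?P" for z
    using that lip_cyl_eq(1)[of z] by (auto simp: f_def susp_space_eq space_M indicator_def)
  have dens: "M = density ?N (\<lambda>z. ennreal (indicator ?X z / v))"
    unfolding M_def susp_measure_def uniform_measure_def v(2)
    by (intro arg_cong2[where f = density] refl ext) (simp add: divide_ennreal[symmetric] v(1) indicator_def)
  have lipN: "lip_cyl \<psi> \<in> borel_measurable ?N"
    using lip_cyl_measurable unfolding measurable_cong_sets[OF sets_M refl] .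
  have "0 = (\<integral>z. (indicator ?X z / v) *\<^sub>R lip_cyl \<psi> z \<partial>?N)"
    using assms unfolding dens
    by (subst (asm) integral_density) (use lipN XN v(1) in auto)
  also have "\<dots> = (\<integral>z. (1 / v) *\<^sub>R lip_cyl \<psi> z \<partial>?N)"
    by (rule Bochner_Integration.integral_cong) (auto simp: space_restrict_space)
  also have "\<dots> = (1 / v) *\<^sub>R (\<integral>z. lip_cyl \<psi> z \<partial>?N)"
    by simp
  finally have "(\<integral>z. lip_cyl \<psi> z \<partial>?N) = 0"
    using v(1) by simp
  then have "(\<integral>z. indicator ?X z *\<^sub>R lip_cyl \<psi> z \<partial>?P) = 0"
    by (simp only: integral_restrict_space[OF X(1)])
  then have int0: "(\<integral>z. f (fst z) (snd z) \<partial>?P) = 0"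
    using f_eq by (simp cong: Bochner_Integration.integral_cong)
  have \<phi>m: "\<phi> j \<in> borel_measurable borel" for j
    by (intro borel_measurable_continuous_onI lipschitz_on_continuous_on[OF lip_\<phi>])
  have [measurable]: "(\<lambda>z. fst z i) \<in> measurable ?P (count_space UNIV)" for i
    by (rule measurable_compose[OF measurable_fst coord_measurable])
  have "(\<lambda>z. f (fst z) (snd z)) \<in> borel_measurable ?P"
  proof -
    have "(\<lambda>z. \<phi> (fst z 0) (snd z)) \<in> borel_measurable ?P"
      by (rule measurable_compose_countable[where g = "\<lambda>z. fst z 0"]) (use \<phi>m in measurable)
    note [measurable] = this
    show ?thesis unfolding f_def by measurable
  qed
  then have fm: "(\<lambda>(x, t). f x t) \<in> borel_measurable ?P"
    by (simp add: case_prod_beta)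
  have L: "0 \<le> L" using lip_\<phi> by (rule lipschitz_on_nonneg)
  have "(\<integral>z. f (fst z) (snd z) \<partial>?P) = (\<integral>x. integral {0..1} (f x) \<partial>\<mu>)"
  proof (rule Fubini_compact(4)[OF finite_measure_axioms fm])
    show "cmod (f x t) \<le> L" for x t using L by (simp add: f_def bound_\<phi>)
    show "f x t = 0" if "x \<in> space \<mu>" "t \<notin> {0..1}" for x t
      using that orbit_letters(2)[of x 0] by (auto simp: f_def \<mu>_props)
  qed
  also have "\<dots> = (\<integral>x. fcoef (s (x 0)) (\<phi> (x 0)) 0 \<partial>\<mu>)"
  proof (rule Bochner_Integration.integral_cong[OF refl])
    fix x assume "x \<in> space \<mu>"
    then have "0 \<le> s (x 0)" "s (x 0) \<le> 1"
      using orbit_letters[of x 0] \<sigma> by (auto simp: \<mu>_props)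
    then show "integral {0..1} (f x) = fcoef (s (x 0)) (\<phi> (x 0)) 0"
      unfolding f_def by (rule fcoef_0_indicator) (rule lip_\<phi>)
  qed
  finally show ?thesis using int0 by simp
qed

lemma admissible_fcoef:
  assumes "(\<integral>p. lip_cyl \<psi> p \<partial>M) = 0"
  shows "admissible m \<mu> L (\<lambda>\<omega> j. fcoef (s j) (\<phi> j) \<omega>)"
  unfolding admissible_def
proof (intro conjI allI impI)
  fix \<omega> j assume j: "j < m"
  have L: "0 \<le> L" using lip_\<phi> by (rule lipschitz_on_nonneg)
  show "cmod (fcoef (s j) (\<phi> j) \<omega>) \<le> L"
    using norm_fcoef_le[OF lip_\<phi> bound_\<phi> s_nonneg[OF j], of j \<omega>] mult_left_mono[OF s(2)[OF j] L] by simp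
  show "\<bar>\<omega>\<bar> * cmod (fcoef (s j) (\<phi> j) \<omega>) \<le> 3 * L"
    by (rule norm_fcoef_decay[OF lip_\<phi> bound_\<phi> s_nonneg[OF j] s(2)[OF j]])
  show "cmod (fcoef (s j) (\<phi> j) \<omega> - fcoef (s j) (\<phi> j) 0) \<le> 2 * pi * \<bar>\<omega>\<bar> * L"
    by (rule norm_fcoef_diff_le[OF lip_\<phi> bound_\<phi> s_nonneg[OF j] s(2)[OF j]])
qed (rule integral_lip_cyl_eq_0[OF assms])

text \<open>The orbit of a point starting at height \<open>u < 1\<close> is followed for time \<open>R\<close>, so it meets at most
  \<open>(R + 1) / \<sigma>\<close> letters.\<close>

lemma spectral_measure_interval_le_wsum:
  assumes spec: "spectral_measure M (susp_flow s) (lip_cyl \<psi>) \<tau>" and R: "0 < R"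
    and W: "\<And>x N. x \<in> subst_space m \<zeta> \<Longrightarrow> real N * \<sigma> \<le> R + 1 \<Longrightarrow>
      cmod (wsum s \<omega> (\<lambda>j. fcoef (s j) (\<phi> j) \<omega>) (map (\<lambda>i. x (int i)) [0..<N])) \<le> W"
  shows "measure \<tau> {\<omega> - 1 / (2 * pi * R)..\<omega> + 1 / (2 * pi * R)} \<le> 16 * L * (W + L) / R"
proof -
  have orbit: "(\<lambda>t. cis (- (2 * pi * (\<omega> * t))) * H p t) integrable_on {0..T}
      \<and> cmod (integral {0..T} (\<lambda>t. cis (- (2 * pi * (\<omega> * t))) * H p t)) \<le> 2 * (W + L)"
    if p: "p \<in> space M" and T: "T \<in> {0..R}" for p T
  proof -
    obtain x u where xu: "p = (x, u)" "x \<in> subst_space m \<zeta>" "0 \<le> u" "u < s (x 0)"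
      using p by (auto simp: space_M susp_space_def)
    interpret lip_orbit s "\<lambda>i. x (int i)" \<sigma> \<phi> L
      by unfold_locales (auto simp: \<sigma> orbit_letters xu lip_\<phi> bound_\<phi>)
    have M: "cmod (integral {0..T'} (F \<omega>)) \<le> W + L" if T': "0 \<le> T'" "T' \<le> u + T" for T'
    proof -
      obtain n where n: "real n * \<sigma> \<le> T'"
        "cmod (integral {0..T'} (F \<omega>)) \<le> cmod (wsum s \<omega> (\<lambda>j. fcoef (s j) (\<phi> j) \<omega>) (map (\<lambda>i. x (int i)) [0..<n])) + L"
        using integral_orbit_bound[OF T'(1), of \<omega>] by blast
      have "real n * \<sigma> \<le> R + 1"
        using n(1) T'(2) T xu(4) orbit_letters(2)[OF xu(2), of 0] by simp
      then show ?thesis using W[OF xu(2), of n] n(2) by linarith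
    qed
    show ?thesis
      unfolding H_def xu fst_conv snd_conv
      using integral_orbit_translate[OF xu(3), of T \<omega> "W + L"] M T by auto
  qed
  have "measure \<tau> {\<omega> - 1 / (2 * pi * R)..\<omega> + 1 / (2 * pi * R)} \<le> 8 * L * (2 * (W + L)) / R"
  proof (rule spectral_measure_interval_le[OF spec prob_M lip_cyl_measurable _ H_measurable norm_H_le _ R])
    show "cmod (lip_cyl \<psi> p) \<le> L" if "p \<in> space M" for p
      using lip_cyl_eq(1)[OF that] by (simp add: bound_\<phi>)
    show "lip_cyl \<psi> (susp_flow s t p) = H p t" if "p \<in> space M" "t \<in> {0..R}" for p t
      using that by (intro lip_cyl_flow) auto
  qed (use orbit R in auto)
  also have "8 * L * (2 * (W + L)) / R = 16 * L * (W + L) / R" by simp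
  finally show ?thesis .
qed

end

end

section \<open>The Hoelder bound\<close>

context primitive_substitution
begin

text \<open>The scale is quadratic because the incomplete blocks contribute \<open>B ^ n\<close>,
  which is then at most the square root of \<open>R\<close>.\<close>

lemma B_power_bracket:
  assumes "1 \<le> R"
  obtains n :: nat where "real B ^ (2 * n) \<le> R" "R < real B ^ (2 * n + 2)"
proof -
  define P where "P n \<longleftrightarrow> R < real B ^ (2 * n)" for n
  have "1 < real B ^ 2"
    using B_ge_2 by (intro one_less_power) auto
  then obtain k where "R < (real B ^ 2) ^ k"
    using real_arch_pow by blast
  then have "P k" by (simp add: P_def power_mult)
  define n where "n = (LEAST n. P n)"
  have "P n" unfolding n_def by (rule LeastI) fact
  moreover have "\<not> P 0" using assms by (simp add: P_def)
  ultimately obtain n' where n': "n = Suc n'" by (cases n) auto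
  then have "\<not> P n'"
    unfolding n_def using not_less_Least by (metis lessI)
  then show thesis
    using \<open>P n\<close> by (intro that[of n']) (simp_all add: P_def n')
qed

text \<open>All constants may depend on \<open>s\<close>: halving the exponent absorbs them into \<open>r\<^sub>0\<close>.\<close>

lemma Hoelder_of_word_sum_bound:
  fixes \<xi> C :: real and s :: "nat \<Rightarrow> real" and n0 :: nat
  assumes \<xi>: "0 < \<xi>" "\<xi> < 1" "1 \<le> \<xi> * real B" and C: "0 < C" and s: "s \<in> open_simplex m"
    and bound: "\<And>n \<mu> L c \<omega> x N. n0 \<le> n \<Longrightarrow> subst_measure m \<zeta> \<mu> \<Longrightarrow> admissible m \<mu> L c \<Longrightarrow>
      x \<in> subst_space m \<zeta> \<Longrightarrow>
      cmod (wsum s \<omega> (c \<omega>) (map (\<lambda>i. x (int i)) [0..<N])) \<le> L * C * (real N * \<xi> ^ n + real B ^ n)"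
  defines "\<gamma> \<equiv> - ln \<xi> / (4 * ln (real B))"
  shows "\<exists>r0>0. \<forall>\<mu> \<psi> \<tau> \<omega> r. subst_measure m \<zeta> \<mu> \<longrightarrow> lip_family m s \<psi> \<longrightarrow>
    (\<integral>p. lip_cyl \<psi> p \<partial>susp_measure m \<zeta> \<mu> s) = 0 \<longrightarrow>
    spectral_measure (susp_measure m \<zeta> \<mu> s) (susp_flow s) (lip_cyl \<psi>) \<tau> \<longrightarrow> 0 < r \<longrightarrow> r \<le> r0 \<longrightarrow>
    measure \<tau> {\<omega> - r..\<omega> + r} \<le> (\<bar>lip_cyl_norm m s \<psi>\<bar> + 1)\<^sup>2 * r powr \<gamma>"
proof -
  have lnB: "0 < ln (real B)" using B_ge_2 by (intro ln_gt_zero) auto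
  have \<gamma>: "0 < \<gamma>"
    unfolding \<gamma>_def by (rule divide_pos_pos) (use \<xi> lnB in \<open>simp_all add: ln_less_zero\<close>)
  define \<sigma> where "\<sigma> = Min (s ` {..<m})"
  have ne: "{..<m} \<noteq> {}" using m2 by (simp add: lessThan_empty_iff)
  have \<sigma>: "0 < \<sigma>"
    unfolding \<sigma>_def using ne open_simplex_bounds(1)[OF s] by (subst Min_gr_iff) auto
  have \<sigma>_le: "\<sigma> \<le> s j" if "j < m" for j
    unfolding \<sigma>_def by (rule Min_le) (use that in auto)
  \<comment> \<open>For \<open>1 \<le> R\<close> at most
    \<open>(R + 1) / \<sigma> \<le> 2 * R / \<sigma>\<close> letters occur; the inner summand
    \<open>1\<close> stands for the incomplete blocks, the outer one for the incomplete
    letter.\<close>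
  define C' where "C' = C * (2 / \<sigma> + 1) + 1"
  have C': "0 < C'" using C \<sigma> by (simp add: C'_def add_pos_pos)
  \<comment> \<open>The factor \<open>1 / \<xi>\<close> comes from passing from \<open>n + 1\<close>
    to \<open>n\<close>, the power of \<open>2 * pi\<close> from
    \<open>R = 1 / (2 * pi * r)\<close>.\<close>
  define A where "A = 16 * C' / \<xi> * (2 * pi) powr (2 * \<gamma>)"
  have A: "0 < A" using C' \<xi> by (simp add: A_def)
  \<comment> \<open>The first bound on \<open>r\<close> gives
    \<open>A * r powr \<gamma> \<le> 1\<close>, the second gives \<open>n0 \<le> n\<close>.\<close>
  define r0 where "r0 = min ((1 / A) powr (1 / \<gamma>)) (1 / (2 * pi * real B ^ (2 * n0 + 2)))"
  have Bpos: "0 < real B" using B_ge_2 by simp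
  have r0: "0 < r0"
    unfolding r0_def using A Bpos by simp
  show ?thesis
  proof (intro exI[of _ r0] conjI r0 allI impI)
    fix \<mu> \<psi> \<tau> \<omega> r
    assume \<mu>: "subst_measure m \<zeta> \<mu>" and fam: "lip_family m s \<psi>"
      and zero: "(\<integral>p. lip_cyl \<psi> p \<partial>susp_measure m \<zeta> \<mu> s) = 0"
      and spec: "spectral_measure (susp_measure m \<zeta> \<mu> s) (susp_flow s) (lip_cyl \<psi>) \<tau>"
      and r: "0 < r" "r \<le> r0"
    define L where "L = \<bar>lip_cyl_norm m s \<psi>\<bar> + 1"
    have L: "1 \<le> L" by (simp add: L_def)
    define R where "R = 1 / (2 * pi * r)"
    have R: "0 < R" using r by (simp add: R_def)
    have r_eq: "r = 1 / (2 * pi * R)" using r by (simp add: R_def)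
    have "r \<le> 1 / (2 * pi * real B ^ (2 * n0 + 2))"
      using r by (simp add: r0_def)
    then have "1 / (2 * pi * (1 / (2 * pi * real B ^ (2 * n0 + 2)))) \<le> R"
      unfolding R_def using r Bpos by (intro divide_left_mono mult_left_mono mult_pos_pos) auto
    then have RB: "real B ^ (2 * n0 + 2) \<le> R"
      using Bpos by simp
    have "1 \<le> real B ^ (2 * n0 + 2)"
      using B_ge_2 by (intro one_le_power) auto
    then have R1: "1 \<le> R" using RB by linarith
    obtain n where n: "real B ^ (2 * n) \<le> R" "R < real B ^ (2 * n + 2)"
      using B_power_bracket[OF R1] by blast
    have "real B ^ (2 * n0 + 2) < real B ^ (2 * n + 2)"
      using RB n(2) by linarith
    then have "n0 \<le> n"
      using B_ge_2 by (simp add: power_strict_increasing_iff)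
    define W where "W = L * C * ((2 * R / \<sigma>) * \<xi> ^ n + real B ^ n)"
    have "real B ^ n * real B ^ n \<le> R"
      using n(1) by (simp add: mult_2 power_add)
    moreover have "1 \<le> (\<xi> * real B) ^ n" using \<xi>(3) by (rule one_le_power)
    \<comment> \<open>Because of \<open>1 \<le> \<xi> * real B\<close> the incomplete blocks are
      dominated by the main term \<open>R * \<xi> ^ n\<close>.\<close>
    ultimately have Bn: "real B ^ n \<le> R * \<xi> ^ n"
    proof -
      have "real B ^ n * 1 \<le> real B ^ n * (\<xi> * real B) ^ n"
        using \<open>1 \<le> (\<xi> * real B) ^ n\<close> by (intro mult_left_mono) auto
      also have "\<dots> = (real B ^ n * real B ^ n) * \<xi> ^ n"
        by (simp add: power_mult_distrib mult_ac)
      also have "\<dots> \<le> R * \<xi> ^ n"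
        using \<open>real B ^ n * real B ^ n \<le> R\<close> \<xi> by (intro mult_right_mono) auto
      finally show ?thesis by simp
    qed
    have one: "1 \<le> R * \<xi> ^ n"
    proof -
      have "1 \<le> real B ^ n" using B_ge_2 by (intro one_le_power) auto
      then show ?thesis using Bn by linarith
    qed
    have adm: "admissible m \<mu> L (\<lambda>\<omega> j. fcoef (s j) (clamp_family m s \<psi> j) \<omega>)"
      unfolding L_def by (rule admissible_fcoef[OF \<mu> fam \<sigma> \<sigma>_le open_simplex_bounds(2)[OF s] zero])
    have "measure \<tau> {\<omega> - 1 / (2 * pi * R)..\<omega> + 1 / (2 * pi * R)} \<le> 16 * L * (W + L) / R"
      unfolding L_def
    proof (rule spectral_measure_interval_le_wsum[OF \<mu> fam \<sigma> \<sigma>_le open_simplex_bounds(2)[OF s] spec R])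
      fix x N assume x: "x \<in> subst_space m \<zeta>" and N: "real N * \<sigma> \<le> R + 1"
      have "real N \<le> 2 * R / \<sigma>"
        using N R1 \<sigma> by (simp add: field_simps)
      then have "real N * \<xi> ^ n + real B ^ n \<le> (2 * R / \<sigma>) * \<xi> ^ n + real B ^ n"
        using \<xi> by (intro add_right_mono mult_right_mono) auto
      then have "L * C * (real N * \<xi> ^ n + real B ^ n) \<le> W"
        unfolding W_def using L C by (intro mult_left_mono) auto
      then show "cmod (wsum s \<omega> (\<lambda>j. fcoef (s j) (clamp_family m s \<psi> j) \<omega>) (map (\<lambda>i. x (int i)) [0..<N])) \<le> W"
        using bound[OF \<open>n0 \<le> n\<close> \<mu> adm x, of \<omega> N] by linarith
    qed
    also have "\<dots> \<le> 16 * L * (L * C' * (R * \<xi> ^ n)) / R"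
    proof (intro divide_right_mono mult_left_mono)
      have "W \<le> L * C * ((2 * R / \<sigma>) * \<xi> ^ n + R * \<xi> ^ n)"
        unfolding W_def using L C Bn by (intro mult_left_mono add_left_mono) auto
      moreover have "L * 1 \<le> L * (R * \<xi> ^ n)"
        using one L by (intro mult_left_mono) auto
      ultimately have "W + L \<le> L * C * ((2 * R / \<sigma>) * \<xi> ^ n + R * \<xi> ^ n) + L * (R * \<xi> ^ n)"
        by linarith
      also have "\<dots> = L * C' * (R * \<xi> ^ n)"
        by (simp add: C'_def algebra_simps)
      finally show "W + L \<le> L * C' * (R * \<xi> ^ n)" .
    qed (use L R in auto)
    also have "\<dots> = L\<^sup>2 * (16 * C' * \<xi> ^ n)"
      using R by (simp add: power2_eq_square)
    also have "\<dots> \<le> L\<^sup>2 * (A * r powr (2 * \<gamma>))"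
    proof (intro mult_left_mono)
      \<comment> \<open>The origin of \<open>\<gamma>\<close>: a decay by \<open>\<xi>\<close> per
        level, with \<open>B\<^sup>2\<close> as the ratio of consecutive scales, amounts to the
        exponent \<open>2 * \<gamma>\<close>.\<close>
      have "\<xi> powr (real n + 1) = (real B ^ (2 * n + 2)) powr (- 2 * \<gamma>)"
      proof -
        have "ln (real B ^ (2 * n + 2)) = (2 * real n + 2) * ln (real B)"
          by (subst ln_realpow) simp
        then have "(real B ^ (2 * n + 2)) powr (- 2 * \<gamma>) = exp (- 2 * \<gamma> * ((2 * real n + 2) * ln (real B)))"
          using Bpos by (simp add: powr_def)
        also have "- 2 * \<gamma> * ((2 * real n + 2) * ln (real B)) = (real n + 1) * ln \<xi>"
          using lnB by (simp add: \<gamma>_def field_simps)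
        finally show ?thesis using \<xi> by (simp add: powr_def)
      qed
      also have "\<dots> \<le> R powr (- 2 * \<gamma>)"
        using n(2) R \<gamma> by (intro powr_mono2') auto
      also have "\<dots> = (2 * pi) powr (2 * \<gamma>) * r powr (2 * \<gamma>)"
        using r by (simp add: R_def powr_minus powr_divide powr_mult)
      finally have "\<xi> ^ n * \<xi> \<le> (2 * pi) powr (2 * \<gamma>) * r powr (2 * \<gamma>)"
        using \<xi> by (simp add: powr_add powr_realpow)
      then have "\<xi> ^ n \<le> (2 * pi) powr (2 * \<gamma>) * r powr (2 * \<gamma>) / \<xi>"
        using \<xi> by (simp add: pos_le_divide_eq)
      then have "16 * C' * \<xi> ^ n \<le> 16 * C' * ((2 * pi) powr (2 * \<gamma>) * r powr (2 * \<gamma>) / \<xi>)"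
        using C' by (intro mult_left_mono) auto
      then show "16 * C' * \<xi> ^ n \<le> A * r powr (2 * \<gamma>)"
        by (simp add: A_def)
    qed simp
    also have "\<dots> \<le> L\<^sup>2 * r powr \<gamma>"
    proof (intro mult_left_mono)
      have "r powr \<gamma> \<le> ((1 / A) powr (1 / \<gamma>)) powr \<gamma>"
        using r \<gamma> by (intro powr_mono2) (auto simp: r0_def)
      also have "\<dots> = 1 / A"
        using A \<gamma> by (simp add: powr_powr)
      finally have "A * r powr \<gamma> \<le> 1"
        using A by (simp add: field_simps)
      then have "A * r powr \<gamma> * r powr \<gamma> \<le> 1 * r powr \<gamma>"
        by (intro mult_right_mono) auto
      moreover have "r powr (2 * \<gamma>) = r powr \<gamma> * r powr \<gamma>"
        by (simp flip: powr_add)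
      ultimately show "A * r powr (2 * \<gamma>) \<le> r powr \<gamma>"
        by (simp add: mult.assoc)
    qed simp
    finally show "measure \<tau> {\<omega> - r..\<omega> + r} \<le> (\<bar>lip_cyl_norm m s \<psi>\<bar> + 1)\<^sup>2 * r powr \<gamma>"
      by (simp add: L_def r_eq[symmetric])
  qed
qed

end

theorem theorem1p2:
  fixes m :: nat and \<zeta> :: "nat \<Rightarrow> nat list" and \<theta> :: "complex list"
  assumes "substitution m \<zeta>"
    and "primitive_subst m \<zeta>"
    and "aperiodic_subst m \<zeta>"
    and "irreducible (char_poly (map_mat rat_of_int (subst_mat m \<zeta>)))"
    and "eigenvalues_by_modulus (map_mat complex_of_int (subst_mat m \<zeta>)) \<theta>"
    and "2 \<le> length \<theta>" and "cmod (\<theta> ! 1) > 1"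
  shows "\<exists>\<gamma>::real. \<gamma> > 0 \<and> (\<exists>C :: real \<Rightarrow> real. (\<forall>L. C L > 0) \<and>
    (\<forall>\<mu>. subst_measure m \<zeta> \<mu> \<longrightarrow>
      (AE s in simplex_lebesgue m. \<exists>r0>0. \<forall>\<psi>.
         lip_family m s \<psi> \<and> (\<integral>p. lip_cyl \<psi> p \<partial>susp_measure m \<zeta> \<mu> s) = 0 \<longrightarrow>
         (\<forall>\<sigma>. spectral_measure (susp_measure m \<zeta> \<mu> s) (susp_flow s) (lip_cyl \<psi>) \<sigma> \<longrightarrow>
            (\<forall>\<omega> r. 0 < r \<and> r \<le> r0 \<longrightarrow>
               measure \<sigma> {\<omega> - r..\<omega> + r} \<le> C (lip_cyl_norm m s \<psi>) * r powr \<gamma>)))))"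
proof -
  have carrier: "map_mat complex_of_int (subst_mat m \<zeta>) \<in> carrier_mat m m"
    by (simp add: subst_mat_def)
  have prod: "degree (\<Prod>z\<leftarrow>zs. [:- z, 1:]) = length zs \<and> (\<Prod>z\<leftarrow>zs. [:- z, 1:]) \<noteq> 0" for zs :: "complex list"
    by (induction zs) (auto simp: degree_mult_eq simp del: mult_pCons_left)
  \<comment> \<open>The eigenvalue list is as long as the degree of the characteristic polynomial;
    since there is a second eigenvalue, the alphabet has at least two letters.\<close>
  have "m = length \<theta>"
    using assms(5) degree_monic_char_poly[OF carrier] prod[of \<theta>] by (simp add: eigenvalues_by_modulus_def)
  then interpret primitive_substitution m \<zeta>
    using assms by unfold_locales auto
  obtain \<xi>0 C :: real where \<xi>0: "0 < \<xi>0" "\<xi>0 < 1" and C: "0 < C" and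
    ae: "AE s in simplex_lebesgue m. \<exists>n0. \<forall>n\<ge>n0. \<forall>\<mu> L c \<omega> x N.
       subst_measure m \<zeta> \<mu> \<longrightarrow> admissible m \<mu> L c \<longrightarrow> x \<in> subst_space m \<zeta> \<longrightarrow>
       cmod (wsum s \<omega> (c \<omega>) (map (\<lambda>i. x (int i)) [0..<N])) \<le> L * C * (real N * \<xi>0 ^ n + real B ^ n)"
    using exists_word_sum_bound[OF assms(4-7)] by blast
  \<comment> \<open>Enlarging the rate to at least \<open>1 / B\<close> only weakens the bound, and
    lets the incomplete blocks be absorbed.\<close>
  define \<xi> where "\<xi> = max \<xi>0 (1 / real B)"
  have B2: "2 \<le> real B" using B_ge_2 by simp
  have \<xi>: "0 < \<xi>" "\<xi> < 1" "1 \<le> \<xi> * real B"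
    using \<xi>0 B2 by (auto simp: \<xi>_def max_def field_simps)
  define \<gamma> where "\<gamma> = - ln \<xi> / (4 * ln (real B))"
  have \<gamma>: "0 < \<gamma>"
    unfolding \<gamma>_def by (rule divide_pos_pos) (use \<xi> B2 in \<open>simp_all add: ln_less_zero\<close>)
  have main: "AE s in simplex_lebesgue m. \<exists>r0>0. \<forall>\<psi>.
         lip_family m s \<psi> \<and> (\<integral>p. lip_cyl \<psi> p \<partial>susp_measure m \<zeta> \<mu> s) = 0 \<longrightarrow>
         (\<forall>\<sigma>. spectral_measure (susp_measure m \<zeta> \<mu> s) (susp_flow s) (lip_cyl \<psi>) \<sigma> \<longrightarrow>
            (\<forall>\<omega> r. 0 < r \<and> r \<le> r0 \<longrightarrow>
               measure \<sigma> {\<omega> - r..\<omega> + r} \<le> (\<bar>lip_cyl_norm m s \<psi>\<bar> + 1)\<^sup>2 * r powr \<gamma>))"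
    if \<mu>: "subst_measure m \<zeta> \<mu>" for \<mu>
    using ae AE_space
  proof eventually_elim
    case (elim s)
    then obtain n0 where n0: "\<And>n \<mu> L c \<omega> x N. n0 \<le> n \<Longrightarrow> subst_measure m \<zeta> \<mu> \<Longrightarrow> admissible m \<mu> L c \<Longrightarrow>
      x \<in> subst_space m \<zeta> \<Longrightarrow>
      cmod (wsum s \<omega> (c \<omega>) (map (\<lambda>i. x (int i)) [0..<N])) \<le> L * C * (real N * \<xi>0 ^ n + real B ^ n)"
      by blast
    have s: "s \<in> open_simplex m"
      using elim by (simp add: space_simplex_lebesgue)
    have bound: "cmod (wsum s \<omega> (c \<omega>) (map (\<lambda>i. x (int i)) [0..<N])) \<le> L * C * (real N * \<xi> ^ n + real B ^ n)"
      if "n0 \<le> n" "subst_measure m \<zeta> \<mu>" and adm: "admissible m \<mu> L c" and "x \<in> subst_space m \<zeta>" for n \<mu> L c \<omega> x N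
    proof -
      have "0 < m" using m2 by simp
      then have "cmod (c 0 0) \<le> L" using adm by (simp add: admissible_def)
      then have "0 \<le> L * C" using C order_trans[OF norm_ge_zero] by (simp add: zero_le_mult_iff)
      moreover have "\<xi>0 ^ n \<le> \<xi> ^ n" using \<xi>0 by (intro power_mono) (auto simp: \<xi>_def)
      ultimately have "L * C * (real N * \<xi>0 ^ n + real B ^ n) \<le> L * C * (real N * \<xi> ^ n + real B ^ n)"
        by (intro mult_left_mono add_right_mono) auto
      then show ?thesis using n0[OF that, of \<omega> N] by linarith
    qed
    have "\<exists>r0>0. \<forall>\<mu> \<psi> \<tau> \<omega> r. subst_measure m \<zeta> \<mu> \<longrightarrow> lip_family m s \<psi> \<longrightarrow>
      (\<integral>p. lip_cyl \<psi> p \<partial>susp_measure m \<zeta> \<mu> s) = 0 \<longrightarrow>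
      spectral_measure (susp_measure m \<zeta> \<mu> s) (susp_flow s) (lip_cyl \<psi>) \<tau> \<longrightarrow> 0 < r \<longrightarrow> r \<le> r0 \<longrightarrow>
      measure \<tau> {\<omega> - r..\<omega> + r} \<le> (\<bar>lip_cyl_norm m s \<psi>\<bar> + 1)\<^sup>2 * r powr \<gamma>"
      unfolding \<gamma>_def
    proof (rule Hoelder_of_word_sum_bound[where ?n0.0 = n0, OF \<xi> C s])
      fix n \<mu> L c \<omega> x N
      assume "n0 \<le> n" "subst_measure m \<zeta> \<mu>" "admissible m \<mu> L c" "x \<in> subst_space m \<zeta>"
      then show "cmod (wsum s \<omega> (c \<omega>) (map (\<lambda>i. x (int i)) [0..<N])) \<le> L * C * (real N * \<xi> ^ n + real B ^ n)"
        by (rule bound)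
    qed
    then obtain r0 where r0: "0 < r0" "\<And>\<psi> \<tau> \<omega> r. lip_family m s \<psi> \<Longrightarrow>
      (\<integral>p. lip_cyl \<psi> p \<partial>susp_measure m \<zeta> \<mu> s) = 0 \<Longrightarrow>
      spectral_measure (susp_measure m \<zeta> \<mu> s) (susp_flow s) (lip_cyl \<psi>) \<tau> \<Longrightarrow> 0 < r \<Longrightarrow> r \<le> r0 \<Longrightarrow>
      measure \<tau> {\<omega> - r..\<omega> + r} \<le> (\<bar>lip_cyl_norm m s \<psi>\<bar> + 1)\<^sup>2 * r powr \<gamma>"
      using \<mu> by blast
    show ?case
      using r0(1) by (intro exI[of _ r0] conjI allI impI r0(2)) auto
  qed
  show ?thesis
  \<comment> \<open>The square reflects that correlations are quadratic in the function: one factor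
    bounds the function itself, the other its orbit integrals.\<close>
  proof (intro exI[of _ \<gamma>] conjI exI[of _ "\<lambda>L. (\<bar>L\<bar> + 1)\<^sup>2"] allI impI)
    show "0 < (\<bar>L\<bar> + 1)\<^sup>2" for L :: real
      by (intro zero_less_power) linarith
  qed (fact \<gamma>, rule main)
qed

end
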